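(* Let $K$ be a field of characteristic zero, $(A,\delta)$ a graded commutative unital DG $K$-algebra, $(\mathcal K,\delta_0)$ a DG Lie–Rinehart algebra over $(A,\delta)$, $(\underline{\mathcal K},\underline\delta)$ a DG module over $(A,\delta)$, and $(p_0,j_0,h_0)$ $A$-linear contraction data for $(\mathcal K,\delta_0)$ over $(\underline{\mathcal K},\underline\delta)$, extended to contraction data $(p_0,j_0,h_0)$ for $(S_A^\bullet\mathcal K,\delta_0)$ over $(S_A^\bullet\underline{\mathcal K},\underline\delta)$ as in the context. Let $(U(\mathcal K),\delta)$ be the universal enveloping DG algebra of $(\mathcal K,\delta_0)$ and suppose that $\mathsf{PBW}:S_A^\bullet\mathcal K\to U(\mathcal K)$ is a PBW type isomorphism. Use $\mathsf{PBW}$ to identify $U(\mathcal K)$ and $S_A^\bullet\mathcal K$, and put $t:=\delta_0-\delta$. Then: (1) $t(U_i(\mathcal K))\subset U_{i-1}(\mathcal K)$ for all $i$, $th_0$ is locally nilpotent, and with $X:=\sum_{i\ge0}t(h_0t)^i$ the maps $$p_t:=p_0(\mathrm{id}+Xh_0),\qquad j_t:=(\mathrm{id}+h_0X)j_0,\qquad h_t:=h_0+h_0Xh_0$$ are contraction data for $(U(\mathcal K),\delta)$ over $(S_A^\bullet\underline{\mathcal K},\underline\delta_t)$, where $\underline\delta_t:=\underline\delta-p_0Xj_0$. (2) Consequently there is an $A_\infty$-algebra structure on $S_A^\bullet\underline{\mathcal K}$, canonically determined by $(p_0,j_0,h_0)$ and $\mathsf{PBW}$, given by $\alpha_1:=\underline\delta_t$,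 $\alpha_k:=p_t\beta_k$ for $k\ge2$, where $\gamma_1:=-j_t$, $\gamma_k:=h_t\beta_k$, and $$\beta_k(x_1,\dots,x_k):=\sum_{\ell+m=k,\ \ell,m\ge1}(-1)^{\ell-1+(m-1)(\bar x_1+\cdots+\bar x_\ell)}\gamma_\ell(x_1,\dots,x_\ell)\,\gamma_m(x_{\ell+1},\dots,x_k),$$ the product on the right being that of $U(\mathcal K)$.
   Context: $\bar v$ is the degree of $v$, written $v$ in exponents of signs; $\odot$ is the product in the graded symmetric algebra $S^\bullet_A$. A graded Lie–Rinehart algebra $(A,Q)$: $Q$ is a graded Lie algebra and an $A$-module, $A$ is a $Q$-module, and $(a\cdot q)\cdot b=a\cdot(q\cdot b)$, $q\cdot(ab)=(q\cdot a)b+(-1)^{aq}a(q\cdot b)$, $[a\cdot q,r]=a\cdot[q,r]-(-1)^{r(a+q)}(r\cdot a)\cdot q$. It is a DG Lie–Rinehart algebra over $(A,\delta)$ if $Q$ has a degree $1$ differential $\delta_0$ that is a derivation of the Lie bracket, satisfies $\delta_0(a\cdot q)=\delta a\cdot q+(-1)^a a\cdot\delta_0q$, and is compatible with the action: $\delta(q\cdot a)=(\delta_0q)\cdot a+(-1)^q q\cdot\delta a$. Contraction data for a cochain complex $(\mathcal K,\delta_0)$ over $(\underline{\mathcal K},\underline\delta)$: cochain maps $p:\mathcal K\to\underline{\mathcal K}$, $j:\underline{\mathcal K}\to\mathcal K$ and a degree $-1$ map $h:\mathcal K\to\mathcal K$ with $pj=\mathrm{id}$, $[h,\delta_0]=\mathrm{id}-jp$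 (graded commutator), $h^2=0$, $hj=0$, $ph=0$. Extension to symmetric algebras: $\delta_0$ and $\underline\delta$ extend as derivations (equal to $\delta$ on $A$) of $S_A^\bullet\mathcal K$, $S_A^\bullet\underline{\mathcal K}$. Put $\mathcal Z:=\ker p_0\subset\mathcal K$, so $\mathcal K=j_0\underline{\mathcal K}\oplus\mathcal Z$ and $S_A^\bullet\mathcal K\simeq S_A^\bullet\underline{\mathcal K}\otimes_AS_A^\bullet\mathcal Z$. Extend $p_0,j_0$ as $A$-algebra morphisms; let $h'$ be the extension of $h_0$ as a derivation of $S_A^\bullet\mathcal K$ (zero on $A$), and set $h_0:=\frac1ih'$ on $S_A^\bullet\underline{\mathcal K}\otimes_AS_A^i\mathcal Z$ for $i>0$, $h_0:=0$ for $i=0$. Universal enveloping algebra: $U(Q)$ is the quotient of the tensor algebra (over $K$) of $A\oplus Q$ by the two-sided ideal generated by $a\otimes b=ab$, $a\otimes q=a\cdot q$, $q\otimes a-(-1)^{aq}a\otimes q=q\cdot a$, $q\otimes r-(-1)^{qr}r\otimes q=[q,r]$ ($a,b\in A$, $q,r\in Q$; the unit of $A$ is the unit of $U(Q)$). $U_i(Q)$ is the left $A$-submodule generated by products of at most $i$ elements of $Q$; $\mathrm{Gr}_iU(Q):=U_i(Q)/U_{i-1}(Q)$. The differential $\delta$ on $U(Q)$ is the unique derivation induced by $\delta$ on $A$ and $\delta_0$ on $Q$. There is a canonical surjection $S_A^iQ\to\mathrm{Gr}_iU(Q)$, $q_1\odot\cdots\odot q_i\mapsto q_1\cdots q_i+U_{i-1}(Q)$.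 A PBW type isomorphism is an isomorphism $\mathsf{PBW}:S_A^\bullet\mathcal K\to U(\mathcal K)$ of filtered $A$-modules such that for each $k$ the composition $S_A^{\le k}\mathcal K\to U_k(\mathcal K)\to\mathrm{Gr}_kU(\mathcal K)$ equals the composition $S_A^{\le k}\mathcal K\to S_A^k\mathcal K\to\mathrm{Gr}_kU(\mathcal K)$ of the projection and the canonical surjection. An operator is locally nilpotent if for each $x$ some power of it kills $x$. An $A_\infty$-algebra is a graded space $\mathcal A$ with multilinear degree $2-k$ maps $\alpha_k:\mathcal A^{\otimes k}\to\mathcal A$, $k\ge1$, such that for all $k \geq 1$ $$\sum_{i+j=k,\,i\ge1}(-1)^{ij}\sum_{\ell=0}^{j}(-1)^{\ell(i+1)+i(x_1+\cdots+x_\ell)}\alpha_{j+1}(x_1,\dots,x_\ell,\alpha_i(x_{\ell+1},\dots,x_{\ell+i}),x_{\ell+i+1},\dots,x_{i+j})=0.$$ *)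

theory Defs
  imports Complex_Main "HOL-Library.Poly_Mapping"
begin

section \<open>Graded spaces and cochain complexes\<close>

text \<open>
  A graded vector space is the total space of its homogeneous components: a type with a scalar
  multiplication and a family of subspaces indexed by the integers of which it is the direct sum.
\<close>

record ('k, 'v) gspace =
  scl :: "'k \<Rightarrow> 'v \<Rightarrow> 'v"
  grd :: "int \<Rightarrow> 'v set"

record ('k, 'v) cochain = "('k, 'v) gspace" +
  dif :: "'v \<Rightarrow> 'v"

definition graded_space :: "('k::field, 'v::ab_group_add, 'z) gspace_scheme \<Rightarrow> bool" where
  "graded_space G \<longleftrightarrow>
     vector_space (scl G) \<and>
     (\<forall>n. module.subspace (scl G) (grd G n)) \<and>
     (\<forall>x. \<exists>!c. (\<forall>n. c n \<in> grd G n) \<and> finite {n. c n \<noteq> 0} \<and> x = (\<Sum>n | c n \<noteq> 0. c n))"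

definition degree_map ::
  "('k::field, 'v::ab_group_add, 'y) gspace_scheme \<Rightarrow> ('k, 'w::ab_group_add, 'z) gspace_scheme
     \<Rightarrow> int \<Rightarrow> ('v \<Rightarrow> 'w) \<Rightarrow> bool" where
  "degree_map G H e f \<longleftrightarrow>
     Vector_Spaces.linear (scl G) (scl H) f \<and> (\<forall>n. \<forall>x\<in>grd G n. f x \<in> grd H (n + e))"

definition graded_bilinear ::
  "('k::field, 'u::ab_group_add, 'x) gspace_scheme \<Rightarrow> ('k, 'v::ab_group_add, 'y) gspace_scheme
     \<Rightarrow> ('k, 'w::ab_group_add, 'z) gspace_scheme \<Rightarrow> ('u \<Rightarrow> 'v \<Rightarrow> 'w) \<Rightarrow> bool" where
  "graded_bilinear G H L f \<longleftrightarrow>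
     (\<forall>x. Vector_Spaces.linear (scl H) (scl L) (f x)) \<and>
     (\<forall>y. Vector_Spaces.linear (scl G) (scl L) (\<lambda>x. f x y)) \<and>
     (\<forall>m n. \<forall>x\<in>grd G m. \<forall>y\<in>grd H n. f x y \<in> grd L (m + n))"

definition cochain_complex :: "('k::field, 'v::ab_group_add, 'z) cochain_scheme \<Rightarrow> bool" where
  "cochain_complex C \<longleftrightarrow>
     graded_space C \<and> degree_map C C 1 (dif C) \<and> (\<forall>x. dif C (dif C x) = 0)"

text \<open>\<open>sg n x\<close> is $(-1)^n x$.\<close>

definition sg :: "int \<Rightarrow> 'v::ab_group_add \<Rightarrow> 'v" where
  "sg n x = (if even n then x else - x)"

text \<open>The graded commutator of two operators of odd degree is their anticommutator.\<close>

definition contraction ::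
  "('k::field, 'v::ab_group_add, 'y) cochain_scheme \<Rightarrow> ('k, 'w::ab_group_add, 'z) cochain_scheme
     \<Rightarrow> ('v \<Rightarrow> 'w) \<Rightarrow> ('w \<Rightarrow> 'v) \<Rightarrow> ('v \<Rightarrow> 'v) \<Rightarrow> bool" where
  "contraction C D p j h \<longleftrightarrow>
     cochain_complex C \<and> cochain_complex D \<and>
     degree_map C D 0 p \<and> (\<forall>x. p (dif C x) = dif D (p x)) \<and>
     degree_map D C 0 j \<and> (\<forall>y. j (dif D y) = dif C (j y)) \<and>
     degree_map C C (-1) h \<and>
     (\<forall>y. p (j y) = y) \<and>
     (\<forall>x. h (dif C x) + dif C (h x) = x - j (p x)) \<and>
     (\<forall>x. h (h x) = 0) \<and> (\<forall>y. h (j y) = 0) \<and> (\<forall>x. p (h x) = 0)"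

definition locally_nilpotent :: "('v::zero \<Rightarrow> 'v) \<Rightarrow> bool" where
  "locally_nilpotent f \<longleftrightarrow> (\<forall>x. \<exists>n. (f ^^ n) x = 0)"


section \<open>DG algebras, DG modules and DG Lie--Rinehart algebras\<close>

text \<open>
  The unit is a field of the record, and the type class is only \<open>ring\<close>, so that the zero algebra
  is not excluded.
\<close>

record ('k, 'a) dg_alg = "('k, 'a) cochain" +
  unt :: 'a

definition graded_comm_dga :: "('k::field, 'a::ring) dg_alg \<Rightarrow> bool" where
  "graded_comm_dga A \<longleftrightarrow>
     cochain_complex A \<and>
     graded_bilinear A A A (*) \<and>
     unt A \<in> grd A 0 \<and> (\<forall>a. unt A * a = a \<and> a * unt A = a) \<and>
     (\<forall>m n. \<forall>a\<in>grd A m. \<forall>b\<in>grd A n. b * a = sg (m * n) (a * b)) \<and>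
     (\<forall>n. \<forall>a\<in>grd A n. \<forall>b. dif A (a * b) = dif A a * b + sg n (a * dif A b))"

record ('k, 'a, 'm) dg_mod = "('k, 'm) cochain" +
  smul :: "'a \<Rightarrow> 'm \<Rightarrow> 'm"

definition dg_module ::
  "('k::field, 'a::ring) dg_alg \<Rightarrow> ('k, 'a, 'm::ab_group_add, 'z) dg_mod_scheme \<Rightarrow> bool" where
  "dg_module A M \<longleftrightarrow>
     cochain_complex M \<and>
     graded_bilinear A M M (smul M) \<and>
     (\<forall>x. smul M (unt A) x = x) \<and>
     (\<forall>a b x. smul M (a * b) x = smul M a (smul M b x)) \<and>
     (\<forall>n. \<forall>a\<in>grd A n. \<forall>x. dif M (smul M a x) = smul M (dif A a) x + sg n (smul M a (dif M x)))"

record ('k, 'a, 'q) lie_rinehart = "('k, 'a, 'q) dg_mod" +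
  brk :: "'q \<Rightarrow> 'q \<Rightarrow> 'q"
  anc :: "'q \<Rightarrow> 'a \<Rightarrow> 'a"

definition graded_lie_algebra :: "('k::field, 'a, 'q::ab_group_add) lie_rinehart \<Rightarrow> bool" where
  "graded_lie_algebra Q \<longleftrightarrow>
     graded_bilinear Q Q Q (brk Q) \<and>
     (\<forall>m n. \<forall>q\<in>grd Q m. \<forall>r\<in>grd Q n. brk Q q r = - sg (m * n) (brk Q r q)) \<and>
     (\<forall>m n. \<forall>q\<in>grd Q m. \<forall>r\<in>grd Q n. \<forall>s.
        brk Q q (brk Q r s) = brk Q (brk Q q r) s + sg (m * n) (brk Q r (brk Q q s)))"

definition dg_lie_rinehart ::
  "('k::field, 'a::ring) dg_alg \<Rightarrow> ('k, 'a, 'q::ab_group_add) lie_rinehart \<Rightarrow> bool" where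
  "dg_lie_rinehart A Q \<longleftrightarrow>
     dg_module A Q \<and>
     graded_lie_algebra Q \<and>
     graded_bilinear Q A A (anc Q) \<and>
     (\<forall>m n. \<forall>q\<in>grd Q m. \<forall>r\<in>grd Q n. \<forall>a.
        anc Q (brk Q q r) a = anc Q q (anc Q r a) - sg (m * n) (anc Q r (anc Q q a))) \<and>
     (\<forall>a q b. anc Q (smul Q a q) b = a * anc Q q b) \<and>
     (\<forall>m n. \<forall>q\<in>grd Q m. \<forall>a\<in>grd A n. \<forall>b.
        anc Q q (a * b) = anc Q q a * b + sg (n * m) (a * anc Q q b)) \<and>
     (\<forall>l m n. \<forall>a\<in>grd A l. \<forall>q\<in>grd Q m. \<forall>r\<in>grd Q n.
        brk Q (smul Q a q) r = smul Q a (brk Q q r) - sg (n * (l + m)) (smul Q (anc Q r a) q)) \<and>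
     (\<forall>m. \<forall>q\<in>grd Q m. \<forall>r. dif Q (brk Q q r) = brk Q (dif Q q) r + sg m (brk Q q (dif Q r))) \<and>
     (\<forall>m. \<forall>q\<in>grd Q m. \<forall>a. dif A (anc Q q a) = anc Q (dif Q q) a + sg m (anc Q q (dif A a)))"

text \<open>
  Linearity over \<open>A\<close> follows the Koszul rule; for \<open>h\<close>, of degree $-1$, this produces the sign below,
  which is the one forced by extending \<open>h\<close> to a derivation vanishing on \<open>A\<close>.
\<close>

definition A_linear_contraction ::
  "('k::field, 'a::ring) dg_alg \<Rightarrow> ('k, 'a, 'q::ab_group_add, 'y) dg_mod_scheme
     \<Rightarrow> ('k, 'a, 'r::ab_group_add, 'z) dg_mod_scheme
     \<Rightarrow> ('q \<Rightarrow> 'r) \<Rightarrow> ('r \<Rightarrow> 'q) \<Rightarrow> ('q \<Rightarrow> 'q) \<Rightarrow> bool" where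
  "A_linear_contraction A Q M p j h \<longleftrightarrow>
     contraction Q M p j h \<and>
     (\<forall>a x. p (smul Q a x) = smul M a (p x)) \<and>
     (\<forall>a y. j (smul M a y) = smul Q a (j y)) \<and>
     (\<forall>n. \<forall>a\<in>grd A n. \<forall>x. h (smul Q a x) = sg n (smul Q a (h x)))"


section \<open>Tensor algebras and their quotients\<close>

text \<open>
  \<open>('k, 'v) free_alg\<close> is the free associative unital \<open>'k\<close>-algebra on the set \<open>'v\<close>: finitely
  supported functions on words, with the convolution product of \<open>poly_mapping\<close>.  The tensor algebra
  of a vector space on \<open>'v\<close> is its quotient by the linearity relations between the generators.
\<close>

datatype 'v word = Word (letters: "'v list")

instantiation word :: (type) monoid_add
begin
definition zero_word :: "'v word" where "zero_word = Word []"
definition plus_word :: "'v word \<Rightarrow> 'v word \<Rightarrow> 'v word" where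
  "plus_word v w = Word (letters v @ letters w)"
instance by standard (simp_all add: zero_word_def plus_word_def)
end

type_synonym ('k, 'v) free_alg = "'v word \<Rightarrow>\<^sub>0 'k"

definition cnst :: "'k::field \<Rightarrow> ('k, 'v) free_alg" where
  "cnst c = Poly_Mapping.single 0 c"

definition monom :: "'v list \<Rightarrow> ('k::field, 'v) free_alg" where
  "monom vs = Poly_Mapping.single (Word vs) 1"

definition two_sided_ideal :: "'x::ring set \<Rightarrow> bool" where
  "two_sided_ideal I \<longleftrightarrow>
     0 \<in> I \<and> (\<forall>x\<in>I. \<forall>y\<in>I. x - y \<in> I) \<and> (\<forall>x\<in>I. \<forall>r. r * x \<in> I \<and> x * r \<in> I)"

text \<open>
  In the following, generators are pairs \<open>(a, q)\<close>, i.e. elements of the direct sum of \<open>A\<close> and a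
  module; \<open>gA a\<close> and \<open>gM q\<close> are the generators given by the two summands.
\<close>

definition gA :: "'a \<Rightarrow> ('k::field, 'a \<times> 'm::zero) free_alg" where
  "gA a = monom [(a, 0)]"

definition gM :: "'m \<Rightarrow> ('k::field, 'a::zero \<times> 'm) free_alg" where
  "gM q = monom [(0, q)]"

definition tensor_rels ::
  "('k::field, 'a::ring) dg_alg \<Rightarrow> ('k, 'a, 'm::ab_group_add, 'z) dg_mod_scheme
     \<Rightarrow> ('k, 'a \<times> 'm) free_alg set" where
  "tensor_rels A M =
     {monom [(a + b, q + r)] - monom [(a, q)] - monom [(b, r)] | a b q r. True} \<union>
     {monom [(scl A c a, scl M c q)] - cnst c * monom [(a, q)] | c a q. True}"

definition module_rels ::
  "('k::field, 'a::ring) dg_alg \<Rightarrow> ('k, 'a, 'm::ab_group_add, 'z) dg_mod_scheme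
     \<Rightarrow> ('k, 'a \<times> 'm) free_alg set" where
  "module_rels A M =
     {gA (unt A) - 1} \<union>
     {gA a * gA b - gA (a * b) | a b. True} \<union>
     {gA a * gM q - gM (smul M a q) | a q. True}"

definition sym_rels ::
  "('k::field, 'a::ring) dg_alg \<Rightarrow> ('k, 'a, 'm::ab_group_add, 'z) dg_mod_scheme
     \<Rightarrow> ('k, 'a \<times> 'm) free_alg set" where
  "sym_rels A M =
     {gM q * gA a - sg (m * n) (gA a * gM q) | m n a q. a \<in> grd A m \<and> q \<in> grd M n} \<union>
     {gM q * gM r - sg (m * n) (gM r * gM q) | m n q r. q \<in> grd M m \<and> r \<in> grd M n}"

definition env_rels ::
  "('k::field, 'a::ring) dg_alg \<Rightarrow> ('k, 'a, 'q::ab_group_add) lie_rinehart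
     \<Rightarrow> ('k, 'a \<times> 'q) free_alg set" where
  "env_rels A Q =
     {gM q * gA a - sg (m * n) (gA a * gM q) - gA (anc Q q a)
        | m n a q. a \<in> grd A m \<and> q \<in> grd Q n} \<union>
     {gM q * gM r - sg (m * n) (gM r * gM q) - gM (brk Q q r)
        | m n q r. q \<in> grd Q m \<and> r \<in> grd Q n}"

text \<open>
  A quotient depends on the ideal and hence cannot be a type constructed here; instead a type \<open>'u\<close>
  \<^emph>\<open>together with a projection\<close> \<open>\<pi>\<close> is a quotient by \<open>I\<close> if \<open>\<pi>\<close> is a surjective ring
  homomorphism with kernel \<open>I\<close>.  The unit of \<open>'u\<close> is \<open>\<pi> 1\<close> and its scalars are \<open>\<pi> (cnst c)\<close>.
\<close>

definition quotient_by :: "'x::ring set \<Rightarrow> ('x \<Rightarrow> 'u::ring) \<Rightarrow> bool" where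
  "quotient_by I \<pi> \<longleftrightarrow>
     (\<forall>x y. \<pi> (x + y) = \<pi> x + \<pi> y) \<and> (\<forall>x y. \<pi> (x * y) = \<pi> x * \<pi> y) \<and>
     surj \<pi> \<and> {x. \<pi> x = 0} = I"

text \<open>
  The first of the \<open>sym_rels\<close> is the usual right module structure on a module over a graded
  commutative algebra, so modulo it one obtains the tensor algebra over \<open>A\<close>; the second makes the
  quotient graded commutative.
\<close>

definition symmetric_algebra ::
  "('k::field, 'a::ring) dg_alg \<Rightarrow> ('k, 'a, 'm::ab_group_add, 'z) dg_mod_scheme
     \<Rightarrow> (('k, 'a \<times> 'm) free_alg \<Rightarrow> 's::ring) \<Rightarrow> bool" where
  "symmetric_algebra A M \<pi> \<longleftrightarrow>
     quotient_by (two_sided_ideal hull (tensor_rels A M \<union> module_rels A M \<union> sym_rels A M)) \<pi>"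

definition enveloping_algebra ::
  "('k::field, 'a::ring) dg_alg \<Rightarrow> ('k, 'a, 'q::ab_group_add) lie_rinehart
     \<Rightarrow> (('k, 'a \<times> 'q) free_alg \<Rightarrow> 'u::ring) \<Rightarrow> bool" where
  "enveloping_algebra A Q \<pi> \<longleftrightarrow>
     quotient_by (two_sided_ideal hull (tensor_rels A Q \<union> module_rels A Q \<union> env_rels A Q)) \<pi>"

definition inA :: "(('k::field, 'a \<times> 'm::zero) free_alg \<Rightarrow> 'u) \<Rightarrow> 'a \<Rightarrow> 'u" where
  "inA \<pi> a = \<pi> (gA a)"

definition inM :: "(('k::field, 'a::zero \<times> 'm) free_alg \<Rightarrow> 'u) \<Rightarrow> 'm \<Rightarrow> 'u" where
  "inM \<pi> q = \<pi> (gM q)"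

text \<open>The product in the quotient of a list of elements of the module.\<close>

definition prods :: "(('k::field, 'a::zero \<times> 'm) free_alg \<Rightarrow> 'u) \<Rightarrow> 'm list \<Rightarrow> 'u" where
  "prods \<pi> qs = \<pi> (monom (map (\<lambda>q. (0, q)) qs))"

text \<open>
  The degree \<open>n\<close> part of a quotient is the span of the products of homogeneous generators of total
  degree \<open>n\<close>.
\<close>

definition homogeneous_word ::
  "('k, 'a, 'x) gspace_scheme \<Rightarrow> ('k, 'm, 'z) gspace_scheme \<Rightarrow> int \<Rightarrow> ('a \<times> 'm) word \<Rightarrow> bool" where
  "homogeneous_word A M n w \<longleftrightarrow>
     (\<exists>ns. list_all2 (\<lambda>v i. v \<in> grd A i \<times> grd M i) (letters w) ns \<and> sum_list ns = n)"

definition quot_space ::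
  "('k::field, 'a::ring) dg_alg \<Rightarrow> ('k, 'a, 'm::ab_group_add, 'z) dg_mod_scheme
     \<Rightarrow> (('k, 'a \<times> 'm) free_alg \<Rightarrow> 'u::ring) \<Rightarrow> ('k, 'u) gspace" where
  "quot_space A M \<pi> =
     \<lparr>scl = (\<lambda>c u. \<pi> (cnst c) * u),
      grd = (\<lambda>n. {\<pi> f | f. \<forall>w\<in>Poly_Mapping.keys f. homogeneous_word A M n w})\<rparr>"

definition with_dif :: "('k, 'u) gspace \<Rightarrow> ('u \<Rightarrow> 'u) \<Rightarrow> ('k, 'u) cochain" where
  "with_dif G d = \<lparr>scl = scl G, grd = grd G, dif = d\<rparr>"

definition A_submodule ::
  "(('k::field, 'a \<times> 'm::zero) free_alg \<Rightarrow> 'u::ring) \<Rightarrow> 'u set \<Rightarrow> bool" where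
  "A_submodule \<pi> N \<longleftrightarrow> 0 \<in> N \<and> (\<forall>x\<in>N. \<forall>y\<in>N. x + y \<in> N) \<and> (\<forall>a. \<forall>x\<in>N. inA \<pi> a * x \<in> N)"

text \<open>
  The filtration \<open>filt\<close> is $U_i$ for an enveloping algebra and $S^{\le i}$ for a symmetric algebra;
  it is zero for negative \<open>i\<close>.
\<close>

definition sym_power :: "(('k::field, 'a::zero \<times> 'm::zero) free_alg \<Rightarrow> 's::ring) \<Rightarrow> nat \<Rightarrow> 's set" where
  "sym_power \<pi> i = A_submodule \<pi> hull {prods \<pi> qs | qs. length qs = i}"

definition filt :: "(('k::field, 'a::zero \<times> 'm::zero) free_alg \<Rightarrow> 'u::ring) \<Rightarrow> int \<Rightarrow> 'u set" where
  "filt \<pi> i = A_submodule \<pi> hull {prods \<pi> qs | qs. int (length qs) \<le> i}"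


section \<open>Extensions to symmetric and enveloping algebras\<close>

definition graded_derivation :: "('k::field, 'u::ring) gspace \<Rightarrow> int \<Rightarrow> ('u \<Rightarrow> 'u) \<Rightarrow> bool" where
  "graded_derivation G e D \<longleftrightarrow>
     degree_map G G e D \<and>
     (\<forall>n. \<forall>x\<in>grd G n. \<forall>y. D (x * y) = D x * y + sg (e * n) (x * D y))"

definition ext_derivation ::
  "('k::field, 'a::ring) dg_alg \<Rightarrow> ('k, 'a, 'm::ab_group_add, 'z) dg_mod_scheme
     \<Rightarrow> (('k, 'a \<times> 'm) free_alg \<Rightarrow> 'u::ring) \<Rightarrow> int \<Rightarrow> ('a \<Rightarrow> 'a) \<Rightarrow> ('m \<Rightarrow> 'm) \<Rightarrow> 'u \<Rightarrow> 'u" where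
  "ext_derivation A M \<pi> e f g =
     (THE D. graded_derivation (quot_space A M \<pi>) e D \<and>
        (\<forall>a. D (inA \<pi> a) = inA \<pi> (f a)) \<and> (\<forall>q. D (inM \<pi> q) = inM \<pi> (g q)))"

definition ext_morphism ::
  "(('k::field, 'a::zero \<times> 'm::zero) free_alg \<Rightarrow> 's::ring)
     \<Rightarrow> (('k, 'a \<times> 'n::zero) free_alg \<Rightarrow> 't::ring) \<Rightarrow> ('m \<Rightarrow> 'n) \<Rightarrow> 's \<Rightarrow> 't" where
  "ext_morphism \<pi> \<rho> f =
     (THE F. (\<forall>x y. F (x + y) = F x + F y) \<and> (\<forall>x y. F (x * y) = F x * F y) \<and>
        (\<forall>a. F (inA \<pi> a) = inA \<rho> a) \<and> (\<forall>q. F (inM \<pi> q) = inM \<rho> (f q)))"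

text \<open>
  The image of $S_A \underline{\mathcal K} \otimes_A S_A^i \mathcal Z$ in $S_A \mathcal K$ under the
  multiplication map, where $\mathcal Z$ is \<open>Z\<close> and \<open>J\<close> is the inclusion of
  $S_A \underline{\mathcal K}$.
\<close>

definition Z_part ::
  "(('k::field, 'a::zero \<times> 'q::zero) free_alg \<Rightarrow> 's::ring) \<Rightarrow> ('t \<Rightarrow> 's) \<Rightarrow> 'q set \<Rightarrow> nat \<Rightarrow> 's set" where
  "Z_part \<pi> J Z i = A_submodule \<pi> hull
     {J s * w | s w. w \<in> A_submodule \<pi> hull {prods \<pi> zs | zs. length zs = i \<and> set zs \<subseteq> Z}}"

definition ext_homotopy ::
  "('k::field, 'a::ring) dg_alg \<Rightarrow> ('k, 'a, 'q::ab_group_add, 'z) dg_mod_scheme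
     \<Rightarrow> (('k, 'a \<times> 'q) free_alg \<Rightarrow> 's::ring) \<Rightarrow> (('k, 'a \<times> 'r::zero) free_alg \<Rightarrow> 't::ring)
     \<Rightarrow> ('q \<Rightarrow> 'r) \<Rightarrow> ('r \<Rightarrow> 'q) \<Rightarrow> ('q \<Rightarrow> 'q) \<Rightarrow> 's \<Rightarrow> 's" where
  "ext_homotopy A Q \<pi> \<rho> p j h =
     (let S = quot_space A Q \<pi>;
          Zp = Z_part \<pi> (ext_morphism \<rho> \<pi> j) {q. p q = 0};
          h' = ext_derivation A Q \<pi> (-1) (\<lambda>_. 0) h
      in THE H. Vector_Spaces.linear (scl S) (scl S) H \<and>
           (\<forall>x\<in>Zp 0. H x = 0) \<and>
           (\<forall>i>0. \<forall>x\<in>Zp i. H x = scl S (1 / of_nat i) (h' x)))"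


section \<open>PBW type isomorphisms\<close>

definition gr_class ::
  "(('k::field, 'a::zero \<times> 'q::zero) free_alg \<Rightarrow> 'u::ring) \<Rightarrow> nat \<Rightarrow> 'u \<Rightarrow> 'u set" where
  "gr_class \<pi> k u = {v. v - u \<in> filt \<pi> (int k - 1)}"

text \<open>
  The canonical surjection $S_A^k Q \to \mathrm{Gr}_k U(Q)$: the elements of the coset assigned to
  $x = \sum_i a_i q_{i1} \odot \cdots \odot q_{ik}$ are those congruent to
  $\sum_i a_i q_{i1} \cdots q_{ik}$.
\<close>

definition gr_surjection ::
  "(('k::field, 'a::zero \<times> 'q::zero) free_alg \<Rightarrow> 's::ring)
     \<Rightarrow> (('k, 'a \<times> 'q) free_alg \<Rightarrow> 'u::ring) \<Rightarrow> nat \<Rightarrow> 's \<Rightarrow> 'u set" where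
  "gr_surjection \<sigma> \<upsilon> k x =
     {u. \<exists>ts. (\<forall>(a, qs)\<in>set ts. length qs = k) \<and>
          x = (\<Sum>(a, qs)\<leftarrow>ts. inA \<sigma> a * prods \<sigma> qs) \<and>
          u \<in> gr_class \<upsilon> k (\<Sum>(a, qs)\<leftarrow>ts. inA \<upsilon> a * prods \<upsilon> qs)}"

text \<open>
  In the last clause, \<open>x + y\<close> is a general element of $S^{\le k} = S^k \oplus S^{\le k-1}$ and \<open>x\<close>
  its projection to $S^k$.
\<close>

definition pbw_isomorphism ::
  "('k::field, 'a::ring) dg_alg \<Rightarrow> ('k, 'a, 'q::ab_group_add) lie_rinehart
     \<Rightarrow> (('k, 'a \<times> 'q) free_alg \<Rightarrow> 's::ring) \<Rightarrow> (('k, 'a \<times> 'q) free_alg \<Rightarrow> 'u::ring)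
     \<Rightarrow> ('s \<Rightarrow> 'u) \<Rightarrow> bool" where
  "pbw_isomorphism A Q \<sigma> \<upsilon> \<Phi> \<longleftrightarrow>
     bij \<Phi> \<and>
     degree_map (quot_space A Q \<sigma>) (quot_space A Q \<upsilon>) 0 \<Phi> \<and>
     (\<forall>a x. \<Phi> (inA \<sigma> a * x) = inA \<upsilon> a * \<Phi> x) \<and>
     (\<forall>i. \<Phi> ` filt \<sigma> i = filt \<upsilon> i) \<and>
     (\<forall>k. \<forall>x\<in>sym_power \<sigma> k. \<forall>y\<in>filt \<sigma> (int k - 1).
        gr_class \<upsilon> k (\<Phi> (x + y)) = gr_surjection \<sigma> \<upsilon> k x)"


section \<open>Perturbation and transfer\<close>

text \<open>
  $\sum_{i \ge 0} t (h t)^i$, evaluated pointwise; the sum at \<open>u\<close> is finite if \<open>t h\<close> is locally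
  nilpotent.
\<close>

definition pert_series :: "('u::ab_group_add \<Rightarrow> 'u) \<Rightarrow> ('u \<Rightarrow> 'u) \<Rightarrow> 'u \<Rightarrow> 'u" where
  "pert_series t h u = (\<Sum>i | t (((h \<circ> t) ^^ i) u) \<noteq> 0. t (((h \<circ> t) ^^ i) u))"

text \<open>
  A family of maps with \<open>k\<close> arguments for each \<open>k \<ge> 1\<close> is given as one function on lists; its value
  at the empty list is irrelevant.
\<close>

definition multilinear ::
  "('k::field, 'v::ab_group_add, 'y) gspace_scheme \<Rightarrow> ('k, 'w::ab_group_add, 'z) gspace_scheme
     \<Rightarrow> nat \<Rightarrow> ('v list \<Rightarrow> 'w) \<Rightarrow> bool" where
  "multilinear G H k f \<longleftrightarrow>
     (\<forall>xs ys. length xs + length ys + 1 = k \<longrightarrow>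
        Vector_Spaces.linear (scl G) (scl H) (\<lambda>x. f (xs @ x # ys)))"

definition homogeneous_list :: "('k, 'v, 'z) gspace_scheme \<Rightarrow> 'v list \<Rightarrow> int list \<Rightarrow> bool" where
  "homogeneous_list G xs ns \<longleftrightarrow> list_all2 (\<lambda>x n. x \<in> grd G n) xs ns"

definition A_infinity_algebra ::
  "('k::field, 'v::ab_group_add, 'z) gspace_scheme \<Rightarrow> ('v list \<Rightarrow> 'v) \<Rightarrow> bool" where
  "A_infinity_algebra G \<alpha> \<longleftrightarrow>
     graded_space G \<and>
     (\<forall>k\<ge>1. multilinear G G k \<alpha>) \<and>
     (\<forall>xs ns. xs \<noteq> [] \<and> homogeneous_list G xs ns \<longrightarrow>
        \<alpha> xs \<in> grd G (sum_list ns + 2 - int (length xs))) \<and>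
     (\<forall>k\<ge>1. \<forall>xs ns. length xs = k \<and> homogeneous_list G xs ns \<longrightarrow>
        (\<Sum>i = 1..k. let j = k - i in sg (int (i * j))
           (\<Sum>l = 0..j. sg (int (l * (i + 1)) + int i * sum_list (take l ns))
              (\<alpha> (take l xs @ [\<alpha> (take i (drop l xs))] @ drop (l + i) xs)))) = 0)"

text \<open>
  The recursion for the transferred operations; the signs involve degrees, so the formula for
  \<open>\<beta>\<close> is imposed on homogeneous arguments and extended multilinearly.
\<close>

definition transfer_ops ::
  "('k::field, 't::ab_group_add) gspace \<Rightarrow> ('k, 'u::ring) gspace
     \<Rightarrow> ('u \<Rightarrow> 't) \<Rightarrow> ('t \<Rightarrow> 'u) \<Rightarrow> ('u \<Rightarrow> 'u) \<Rightarrow> ('t \<Rightarrow> 't)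
     \<Rightarrow> ('t list \<Rightarrow> 't) \<Rightarrow> ('t list \<Rightarrow> 'u) \<Rightarrow> ('t list \<Rightarrow> 'u) \<Rightarrow> bool" where
  "transfer_ops G H p j h d \<alpha> \<beta> \<gamma> \<longleftrightarrow>
     (\<forall>x. \<alpha> [x] = d x) \<and> (\<forall>x. \<gamma> [x] = - j x) \<and>
     (\<forall>xs. length xs \<ge> 2 \<longrightarrow> \<alpha> xs = p (\<beta> xs) \<and> \<gamma> xs = h (\<beta> xs)) \<and>
     (\<forall>k\<ge>2. multilinear G H k \<beta>) \<and>
     (\<forall>k\<ge>2. \<forall>xs ns. length xs = k \<and> homogeneous_list G xs ns \<longrightarrow>
        \<beta> xs = (\<Sum>l = 1..k - 1. let m = k - l in
                  sg (int (l - 1) + int (m - 1) * sum_list (take l ns))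
                    (\<gamma> (take l xs) * \<gamma> (drop l xs))))"

end

theory Submission
  imports Defs
begin

text \<open>
  \<^bold>\<open>The filtration.\<close>  A PBW type isomorphism turns a product $q_1 \odot \cdots \odot q_k$ into
  $q_1 \cdots q_k$ up to terms of lower order (\<open>PBW_prods\<close>).  Both \<open>\<delta>\<^sub>0\<close> and \<open>\<delta>\<close> expand such a
  product by the same Leibniz rule into products of \<open>k\<close> factors, and both preserve the filtration,
  so that their difference \<open>t\<close> lowers it (\<open>t_filt\<close>).  The homotopy preserves the filtration, the
  filtration is exhaustive and vanishes in negative degrees, and hence \<open>t h\<close> is locally nilpotent
  (\<open>t_h_nilpotent\<close>).

  \<^bold>\<open>The unperturbed contraction.\<close>  The maps on the symmetric algebras satisfy the axioms of
  contraction data (\<open>sym_contraction\<close>) because the graded commutator \<open>N\<close> of the derivation $h'$ with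
  the differential is the derivation that vanishes on $A$ and on the image of \<open>j0\<close> and is the
  identity on \<open>Z\<close>: its eigenspace for the eigenvalue \<open>i\<close> is the part with \<open>i\<close> factors in \<open>Z\<close>
  (\<open>Zp_iff\<close>), it commutes with both maps, and division by \<open>i\<close> turns $h'$ into a homotopy.  The
  contraction data for \<open>\<delta>\<close> follow by the perturbation lemma (\<open>perturbation_lemma\<close>), whose main
  computation is $\delta_0 X + X \delta_0 = X j p X$.

  \<^bold>\<open>The transfer.\<close>  After suspension the recursion says that \<open>\<gamma>\<close> is a twisting cochain from the
  tensor coalgebra, with the coderivation given by \<open>\<alpha>\<close>, to the differential algebra at hand:
  $\delta\gamma = \beta + \gamma\partial$, where $\beta$ is the product of $\gamma$ with itself.
  By induction on the number of arguments, this and the Leibniz rule give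
  $\delta\beta + \beta\partial = 0$; then $\delta\gamma = \delta h\beta$ is computed with the
  homotopy identity (\<open>twisting\<close>).  Applying \<open>p\<close> gives $\alpha\partial = 0$ (\<open>bar_relation\<close>),
  which is the $A_\infty$-relation with the suspension undone (\<open>a_infinity_relation\<close>).

  \<^bold>\<open>The algebras.\<close>  The symmetric and the enveloping algebra are quotients of a free algebra by
  relations of one shape (locale \<open>quot_alg\<close>), and everything about them comes from one universal
  property (\<open>lift_exists\<close>), applied to suitable target rings: Laurent polynomials give the grading
  and the decomposition by the number of factors in \<open>Z\<close>, and upper triangular matrices give the
  extension of derivations.
\<close>


section \<open>Signs and additive maps\<close>

lemma sg_even [simp]: "even n \<Longrightarrow> sg n x = x"
  and sg_odd [simp]: "odd n \<Longrightarrow> sg n x = - x"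
  by (simp_all add: sg_def)

lemma sg_add: "sg n (x + y) = sg n x + sg n y"
  and sg_zero [simp]: "sg n 0 = 0"
  and sg_sg: "sg m (sg n x) = sg (m + n) x"
  by (simp_all add: sg_def)

lemma sg_mult_left: "sg n x * y = sg n (x * y)"
  and sg_mult_right: "x * sg n y = sg n (x * y)"
  for x y :: "'b::ring"
  by (simp_all add: sg_def)

lemma sg_sum: "sg n (\<Sum>i\<in>I. f i) = (\<Sum>i\<in>I. sg n (f i))"
  by (simp add: sg_def sum_negf)

lemma sg_cong: "even (m - n) \<Longrightarrow> sg m x = sg n x"
  by (simp add: sg_def)

lemma additive_sg: "additive f \<Longrightarrow> f (sg n x) = sg n (f x)"
  by (simp add: sg_def additive.minus)

lemma linearD:
  assumes "Vector_Spaces.linear s s' f"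
  shows "vector_space s" "vector_space s'" "f (x + y) = f x + f y" "f (s c x) = s' c (f x)" "additive f"
  using assms by (simp_all add: Vector_Spaces.linear_iff additive_def)

lemma linearI:
  assumes "vector_space s" "vector_space s'"
    and "\<And>x y. f (x + y) = f x + f y" "\<And>c x. f (s c x) = s' c (f x)"
  shows "Vector_Spaces.linear s s' f"
  using assms by (simp add: Vector_Spaces.linear_iff)

lemma degree_mapD:
  assumes "degree_map G H e f"
  shows "Vector_Spaces.linear (scl G) (scl H) f" "x \<in> grd G n \<Longrightarrow> f x \<in> grd H (n + e)" "additive f"
    "f (x + y) = f x + f y" "f (scl G c x) = scl H c (f x)" "f 0 = 0" "f (x - y) = f x - f y"
    "f (- x) = - f x"
proof -
  show l: "Vector_Spaces.linear (scl G) (scl H) f" and "x \<in> grd G n \<Longrightarrow> f x \<in> grd H (n + e)"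
    using assms by (auto simp: degree_map_def)
  show a: "additive f" and "f (x + y) = f x + f y" and "f (scl G c x) = scl H c (f x)"
    using linearD[OF l] by auto
  show "f 0 = 0" "f (x - y) = f x - f y" "f (- x) = - f x"
    by (fact additive.zero[OF a] additive.diff[OF a] additive.minus[OF a])+
qed

lemma degree_map_compose:
  "degree_map G H e f \<Longrightarrow> degree_map H L e' g \<Longrightarrow> degree_map G L (e + e') (g \<circ> f)"
  unfolding degree_map_def Vector_Spaces.linear_iff by (auto simp: add.assoc[symmetric])

lemma linear_combine:
  assumes "Vector_Spaces.linear s s' f" "Vector_Spaces.linear s s' g"
  shows "Vector_Spaces.linear s s' (\<lambda>x. f x + g x)" "Vector_Spaces.linear s s' (\<lambda>x. f x - g x)"
    "Vector_Spaces.linear s s' (\<lambda>x. - f x)"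
proof -
  interpret vector_space s' by (rule linearD(2)[OF assms(1)])
  show "Vector_Spaces.linear s s' (\<lambda>x. f x + g x)" "Vector_Spaces.linear s s' (\<lambda>x. f x - g x)"
    "Vector_Spaces.linear s s' (\<lambda>x. - f x)"
    using assms by (auto simp: Vector_Spaces.linear_iff scale_right_distrib scale_right_diff_distrib)
qed

lemmas linear_add = linear_combine(1)

lemma linear_minus: "Vector_Spaces.linear s s' f \<Longrightarrow> Vector_Spaces.linear s s' (\<lambda>x. - f x)"
  using linear_combine(3) by blast

lemma linear_zero: "vector_space s \<Longrightarrow> vector_space s' \<Longrightarrow> Vector_Spaces.linear s s' (\<lambda>_. 0)"
  by (auto intro!: linearI simp: module.scale_zero_right module_iff_vector_space)

lemma linear_sum:
  assumes "vector_space s" "vector_space s'" "\<And>i. i \<in> I \<Longrightarrow> Vector_Spaces.linear s s' (f i)"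
  shows "Vector_Spaces.linear s s' (\<lambda>x. \<Sum>i\<in>I. f i x)"
  using assms(3)
  by (induction I rule: infinite_finite_induct)
     (simp_all add: linear_zero assms(1,2) linear_combine)

lemma linear_compose: "Vector_Spaces.linear s s' f \<Longrightarrow> Vector_Spaces.linear s' s'' g \<Longrightarrow>
    Vector_Spaces.linear s s'' (\<lambda>x. g (f x))"
  by (auto simp: Vector_Spaces.linear_iff)


section \<open>Homogeneous components\<close>

context
  fixes G :: "('k::field, 'v::ab_group_add, 'z) gspace_scheme"
  assumes G: "graded_space G"
begin

lemma graded_vector_space: "vector_space (scl G)"
  using G by (simp add: graded_space_def)

lemma grd_zero [simp]: "0 \<in> grd G n"
  and grd_add: "x \<in> grd G n \<Longrightarrow> y \<in> grd G n \<Longrightarrow> x + y \<in> grd G n"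
  and grd_scl: "x \<in> grd G n \<Longrightarrow> scl G c x \<in> grd G n"
  and grd_diff: "x \<in> grd G n \<Longrightarrow> y \<in> grd G n \<Longrightarrow> x - y \<in> grd G n"
  and grd_minus: "x \<in> grd G n \<Longrightarrow> - x \<in> grd G n"
  and grd_sg: "x \<in> grd G n \<Longrightarrow> sg m x \<in> grd G n"
  and grd_sum: "(\<And>i. i \<in> I \<Longrightarrow> f i \<in> grd G n) \<Longrightarrow> sum f I \<in> grd G n"
proof -
  interpret vector_space "scl G" by (rule graded_vector_space)
  have s: "subspace (grd G n)" for n using G by (simp add: graded_space_def)
  show "0 \<in> grd G n" and "x \<in> grd G n \<Longrightarrow> y \<in> grd G n \<Longrightarrow> x + y \<in> grd G n"
    and "x \<in> grd G n \<Longrightarrow> scl G c x \<in> grd G n"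
    and "x \<in> grd G n \<Longrightarrow> y \<in> grd G n \<Longrightarrow> x - y \<in> grd G n"
    and "x \<in> grd G n \<Longrightarrow> - x \<in> grd G n"
    and "(\<And>i. i \<in> I \<Longrightarrow> f i \<in> grd G n) \<Longrightarrow> sum f I \<in> grd G n"
    using s by (auto intro: subspace_0 subspace_add subspace_scale subspace_diff subspace_neg subspace_sum)
  then show "x \<in> grd G n \<Longrightarrow> sg m x \<in> grd G n" by (simp add: sg_def)
qed

lemma graded_decomp: "\<exists>!c. (\<forall>n. c n \<in> grd G n) \<and> finite {n. c n \<noteq> 0} \<and> x = (\<Sum>n | c n \<noteq> 0. c n)"
  using G by (simp add: graded_space_def)

end

text \<open>The homogeneous component of \<open>x\<close> of degree \<open>n\<close> is \<open>hcomp G x n\<close>.\<close>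

definition hcomp :: "('k::field, 'v::ab_group_add, 'z) gspace_scheme \<Rightarrow> 'v \<Rightarrow> int \<Rightarrow> 'v" where
  "hcomp G x = (THE c. (\<forall>n. c n \<in> grd G n) \<and> finite {n. c n \<noteq> 0} \<and> x = (\<Sum>n | c n \<noteq> 0. c n))"

text \<open>
  The value at \<open>x\<close> of the additive map that is \<open>F n\<close> in degree \<open>n\<close>.
\<close>

definition gext :: "('k::field, 'v::ab_group_add, 'z) gspace_scheme \<Rightarrow> (int \<Rightarrow> 'v \<Rightarrow> 'w) \<Rightarrow> 'v \<Rightarrow> 'w::ab_group_add" where
  "gext G F x = (\<Sum>n | hcomp G x n \<noteq> 0. F n (hcomp G x n))"

context
  fixes G :: "('k::field, 'v::ab_group_add, 'z) gspace_scheme"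
  assumes G: "graded_space G"
begin

lemma hcomp: "hcomp G x n \<in> grd G n" "finite {n. hcomp G x n \<noteq> 0}"
    "x = (\<Sum>n | hcomp G x n \<noteq> 0. hcomp G x n)"
  using theI'[OF graded_decomp[OF G, of x]] by (auto simp: hcomp_def)

lemma hcomp_unique:
  assumes "\<And>n. c n \<in> grd G n" "finite {n. c n \<noteq> 0}" "x = (\<Sum>n | c n \<noteq> 0. c n)"
  shows "hcomp G x = c"
  unfolding hcomp_def using assms by (intro the1_equality[OF graded_decomp[OF G]]) auto

lemma hcomp_homogeneous:
  assumes "x \<in> grd G n"
  shows "hcomp G x = (\<lambda>m. if m = n then x else 0)"
proof (rule hcomp_unique)
  have "{m. (if m = n then x else 0) \<noteq> 0} = (if x = 0 then {} else {n})" by auto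
  then show "finite {m. (if m = n then x else 0) \<noteq> 0}"
    and "x = (\<Sum>m | (if m = n then x else 0) \<noteq> 0. if m = n then x else 0)" by auto
qed (use assms G in \<open>auto intro: grd_zero\<close>)

lemma hcomp_add: "hcomp G (x + y) n = hcomp G x n + hcomp G y n"
proof -
  let ?c = "\<lambda>n. hcomp G x n + hcomp G y n"
  let ?S = "{n. hcomp G x n \<noteq> 0} \<union> {n. hcomp G y n \<noteq> 0}"
  have fin: "finite ?S" using hcomp(2) by auto
  have sub: "{n. ?c n \<noteq> 0} \<subseteq> ?S" by auto
  have "hcomp G (x + y) = ?c"
  proof (rule hcomp_unique)
    show "finite {n. ?c n \<noteq> 0}" using fin sub by (rule rev_finite_subset)
    have "(\<Sum>n | ?c n \<noteq> 0. ?c n) = (\<Sum>n\<in>?S. ?c n)"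
      using fin sub by (intro sum.mono_neutral_left) auto
    also have "\<dots> = (\<Sum>n\<in>?S. hcomp G x n) + (\<Sum>n\<in>?S. hcomp G y n)" by (rule sum.distrib)
    also have "(\<Sum>n\<in>?S. hcomp G x n) = (\<Sum>n | hcomp G x n \<noteq> 0. hcomp G x n)"
      using fin by (intro sum.mono_neutral_right) auto
    also have "(\<Sum>n\<in>?S. hcomp G y n) = (\<Sum>n | hcomp G y n \<noteq> 0. hcomp G y n)"
      using fin by (intro sum.mono_neutral_right) auto
    finally show "x + y = (\<Sum>n | ?c n \<noteq> 0. ?c n)" using hcomp(3)[of x] hcomp(3)[of y] by simp
  qed (use hcomp(1) G in \<open>auto intro: grd_add\<close>)
  then show ?thesis by simp
qed

lemma graded_induct [consumes 0, case_names add homogeneous]: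
  assumes add: "\<And>x y. P x \<Longrightarrow> P y \<Longrightarrow> P (x + y)"
    and hom: "\<And>n x. x \<in> grd G n \<Longrightarrow> P x"
  shows "P x"
proof -
  have "P (\<Sum>n\<in>I. hcomp G x n)" if "finite I" for I
    using that by (induction I) (use add hom[OF hcomp(1)] hom[OF grd_zero[OF G]] in auto)
  then show ?thesis using hcomp(2,3)[of x] by metis
qed

lemma additive_eqI:
  assumes "additive f" "additive g" "\<And>n x. x \<in> grd G n \<Longrightarrow> f x = g x"
  shows "f x = g x"
  by (induction x rule: graded_induct) (use assms in \<open>auto simp: additive.add\<close>)

context
  fixes F :: "int \<Rightarrow> 'v \<Rightarrow> 'w::ab_group_add"
  assumes F: "\<And>n. additive (F n)"
begin

lemma gext_superset:
  "finite I \<Longrightarrow> {n. hcomp G x n \<noteq> 0} \<subseteq> I \<Longrightarrow> gext G F x = (\<Sum>n\<in>I. F n (hcomp G x n))"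
  unfolding gext_def by (rule sum.mono_neutral_left) (auto simp: additive.zero[OF F])

lemma gext_additive: "additive (gext G F)"
proof
  fix x y
  let ?S = "{n. hcomp G x n \<noteq> 0} \<union> {n. hcomp G y n \<noteq> 0}"
  have "finite ?S" using hcomp(2) by auto
  then show "gext G F (x + y) = gext G F x + gext G F y"
    by (subst (1 2 3) gext_superset[where I = ?S])
       (auto simp: hcomp_add additive.add[OF F] sum.distrib)
qed

lemma gext_homogeneous: "x \<in> grd G n \<Longrightarrow> gext G F x = F n x"
  by (subst gext_superset[where I = "{n}"]) (auto simp: hcomp_homogeneous)

end
end

text \<open>The sign automorphism, \<open>x\<close> \<open>\<mapsto>\<close> $(-1)^n x$ in degree \<open>n\<close>.\<close>

definition tw :: "('k::field, 'v::ab_group_add, 'z) gspace_scheme \<Rightarrow> 'v \<Rightarrow> 'v" where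
  "tw G = gext G sg"

lemma additive_sg': "additive (sg n)"
  by (simp add: additive_def sg_add)

context
  fixes G :: "('k::field, 'v::ab_group_add, 'z) gspace_scheme"
  assumes G: "graded_space G"
begin

lemma tw_additive: "additive (tw G)"
  unfolding tw_def by (rule gext_additive[OF G additive_sg'])

lemmas tw_add = additive.add[OF tw_additive]
  and tw_zero = additive.zero[OF tw_additive]
  and tw_minus = additive.minus[OF tw_additive]

lemma tw_homogeneous: "x \<in> grd G n \<Longrightarrow> tw G x = sg n x"
  unfolding tw_def by (rule gext_homogeneous[OF G additive_sg'])

lemma tw_grd: "x \<in> grd G n \<Longrightarrow> tw G x \<in> grd G n"
  by (simp add: tw_homogeneous grd_sg[OF G])

lemma tw_tw: "tw G (tw G x) = x"
proof (rule additive_eqI[OF G, where f = "\<lambda>x. tw G (tw G x)" and g = "\<lambda>x. x"])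
  show "additive (\<lambda>x. tw G (tw G x))" "additive (\<lambda>x::'v. x)" by (auto simp: additive_def tw_add)
  show "tw G (tw G x) = x" if "x \<in> grd G n" for n x
    using that by (metis tw_homogeneous tw_grd sg_sg even_add sg_even)
qed

lemma tw_linear: "Vector_Spaces.linear (scl G) (scl G) (tw G)"
proof -
  interpret vector_space "scl G" by (rule graded_vector_space[OF G])
  show ?thesis
  proof (rule linearI)
    fix c x
    show "tw G (scl G c x) = scl G c (tw G x)"
    proof (rule additive_eqI[OF G, where f = "\<lambda>x. tw G (scl G c x)" and g = "\<lambda>x. scl G c (tw G x)"])
      fix n x assume "x \<in> grd G n"
      then show "tw G (scl G c x) = scl G c (tw G x)"
        by (simp add: tw_homogeneous[OF grd_scl[OF G, of x n c]] tw_homogeneous[of x n] sg_def)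
    qed (auto simp: additive_def tw_add scale_right_distrib)
  qed (auto simp: tw_add vector_space_axioms)
qed

lemma tw_degree_map:
  assumes H: "graded_space H" and f: "degree_map G H e f"
  shows "tw H (f x) = sg e (f (tw G x))"
proof (rule additive_eqI[OF G, where f = "\<lambda>x. tw H (f x)" and g = "\<lambda>x. sg e (f (tw G x))"])
  show "additive (\<lambda>x. tw H (f x))" "additive (\<lambda>x. sg e (f (tw G x)))"
    using degree_mapD(4)[OF f] additive.add[OF gext_additive[OF H additive_sg']]
    by (auto simp: additive_def tw_add sg_add tw_def[of H])
  fix n x assume "x \<in> grd G n"
  then show "tw H (f x) = sg e (f (tw G x))"
    using degree_mapD(2)[OF f, of x n] gext_homogeneous[OF H additive_sg', of "f x" "n + e"]
    by (simp add: tw_homogeneous[of x n] tw_def[of H] additive_sg[OF degree_mapD(3)[OF f]] sg_sg add.commute)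
qed

end

lemma tw_mult:
  fixes x y :: "'v::ring"
  assumes G: "graded_space G"
    and mult: "\<And>m n x y. x \<in> grd G m \<Longrightarrow> y \<in> grd G n \<Longrightarrow> x * y \<in> grd G (m + n)"
  shows "tw G (x * y) = tw G x * tw G y"
proof (rule additive_eqI[OF G, where f = "\<lambda>x. tw G (x * y)" and g = "\<lambda>x. tw G x * tw G y"])
  fix m x assume x: "x \<in> grd G m"
  show "tw G (x * y) = tw G x * tw G y"
  proof (rule additive_eqI[OF G, where f = "\<lambda>y. tw G (x * y)" and g = "\<lambda>y. tw G x * tw G y"])
    fix n y assume y: "y \<in> grd G n"
    show "tw G (x * y) = tw G x * tw G y"
      by (simp add: tw_homogeneous[OF G x] tw_homogeneous[OF G y]
          tw_homogeneous[OF G mult[OF x y]] sg_mult_left sg_mult_right sg_sg add.commute)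
  qed (auto simp: additive_def tw_add[OF G] distrib_left)
qed (auto simp: additive_def tw_add[OF G] distrib_right)


section \<open>The perturbation lemma\<close>

lemma with_dif_simps [simp]:
  "scl (with_dif G d) = scl G" "grd (with_dif G d) = grd G" "dif (with_dif G d) = d"
  by (simp_all add: with_dif_def)

lemma graded_space_with_dif [simp]: "graded_space (with_dif G d) = graded_space G"
  by (simp add: graded_space_def)

lemma degree_map_with_dif_left [simp]: "degree_map (with_dif G d) H e f = degree_map G H e f"
  by (simp add: degree_map_def)

lemma degree_map_with_dif_right [simp]: "degree_map H (with_dif G d) e f = degree_map H G e f"
  by (simp add: degree_map_def)

text \<open>
  The support of the perturbation series is replaced by any initial segment of exponents beyond
  which the terms vanish.
\<close>

lemma pert_series_eq:
  assumes t: "additive t" and h: "additive h" and n: "((t \<circ> h) ^^ n) (t u) = 0"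
  shows "pert_series t h u = (\<Sum>i<n. ((t \<circ> h) ^^ i) (t u))"
proof -
  have th: "((t \<circ> h) ^^ i) 0 = 0" for i
    by (induction i) (simp_all add: additive.zero[OF t] additive.zero[OF h])
  have *: "t (((h \<circ> t) ^^ i) u) = ((t \<circ> h) ^^ i) (t u)" for i
    by (induction i) simp_all
  have "((t \<circ> h) ^^ i) (t u) = 0" if "n \<le> i" for i
  proof -
    have "((t \<circ> h) ^^ i) (t u) = ((t \<circ> h) ^^ (i - n)) (((t \<circ> h) ^^ n) (t u))"
      using that by (metis comp_apply funpow_add le_add_diff_inverse2)
    then show ?thesis by (simp add: n th)
  qed
  then have "{i. ((t \<circ> h) ^^ i) (t u) \<noteq> 0} \<subseteq> {..<n}" by (auto simp: not_less[symmetric])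
  then show ?thesis unfolding pert_series_def * by (intro sum.mono_neutral_left) auto
qed

locale nilpotent_pair =
  fixes t h :: "'u::ab_group_add \<Rightarrow> 'u"
  assumes t_additive: "additive t" and h_additive: "additive h" and nil: "locally_nilpotent (t \<circ> h)"
begin

abbreviation "X \<equiv> pert_series t h"

lemma th_additive: "additive ((t \<circ> h) ^^ i)"
  by (induction i) (simp_all add: additive_def additive.add[OF t_additive] additive.add[OF h_additive])

lemma nil_obtain: obtains n where "((t \<circ> h) ^^ n) u = 0"
  using nil by (auto simp: locally_nilpotent_def)

lemma nil_mono: "((t \<circ> h) ^^ n) u = 0 \<Longrightarrow> n \<le> m \<Longrightarrow> ((t \<circ> h) ^^ m) u = 0"
  by (metis additive.zero[OF th_additive] comp_apply funpow_add le_add_diff_inverse2)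

lemmas X_eq = pert_series_eq[OF t_additive h_additive]

lemma X_left: "X u = t u + t (h (X u))"
proof -
  obtain n where n: "((t \<circ> h) ^^ n) (t u) = 0" by (rule nil_obtain)
  have "t u + (\<Sum>i<n. ((t \<circ> h) ^^ Suc i) (t u)) = (\<Sum>i<Suc n. ((t \<circ> h) ^^ i) (t u))"
    by (simp only: sum.lessThan_Suc_shift funpow_0)
  also have "\<dots> = X u" using n by (simp add: X_eq[OF n])
  finally show ?thesis by (simp add: X_eq[OF n] additive.sum[OF t_additive] additive.sum[OF h_additive])
qed

lemma X_right: "X u = t u + X (h (t u))"
proof -
  obtain n where n: "((t \<circ> h) ^^ n) (t u) = 0" by (rule nil_obtain)
  have n': "((t \<circ> h) ^^ n) (t (h (t u))) = 0"
    using nil_mono[OF n, of "Suc n"] by (simp add: funpow_swap1)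
  have "t u + (\<Sum>i<n. ((t \<circ> h) ^^ Suc i) (t u)) = (\<Sum>i<Suc n. ((t \<circ> h) ^^ i) (t u))"
    by (simp only: sum.lessThan_Suc_shift funpow_0)
  also have "\<dots> = X u" using n by (simp add: X_eq[OF n])
  finally show ?thesis by (simp add: X_eq[OF n'] funpow_swap1)
qed

lemma X_additive: "additive X"
proof
  fix u v
  obtain m n where m: "((t \<circ> h) ^^ m) (t u) = 0" and n: "((t \<circ> h) ^^ n) (t v) = 0"
    by (metis nil_obtain)
  define k where "k = max m n"
  have k: "((t \<circ> h) ^^ k) (t u) = 0" "((t \<circ> h) ^^ k) (t v) = 0"
    using nil_mono[OF m] nil_mono[OF n] by (auto simp: k_def)
  then have "((t \<circ> h) ^^ k) (t (u + v)) = 0"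
    by (simp add: additive.add[OF t_additive] additive.add[OF th_additive])
  then show "X (u + v) = X u + X v"
    by (simp add: X_eq[OF k(1)] X_eq[OF k(2)] X_eq additive.add[OF t_additive] additive.add[OF th_additive]
        sum.distrib)
qed

lemma X_degree_map:
  assumes G: "graded_space G" and tG: "degree_map G G 1 t" and hG: "degree_map G G (-1) h"
  shows "degree_map G G 1 X"
proof -
  have th: "((t \<circ> h) ^^ i) (scl G c x) = scl G c (((t \<circ> h) ^^ i) x)" for i c x
    by (induction i) (simp_all add: degree_mapD(5)[OF tG] degree_mapD(5)[OF hG])
  interpret vector_space "scl G" by (rule graded_vector_space[OF G])
  have "X (scl G c x) = scl G c (X x)" for c x
  proof -
    obtain n where n: "((t \<circ> h) ^^ n) (t x) = 0" by (rule nil_obtain)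
    then have "((t \<circ> h) ^^ n) (t (scl G c x)) = 0" by (simp add: degree_mapD(5)[OF tG] th)
    then show ?thesis by (simp add: X_eq[OF n] X_eq degree_mapD(5)[OF tG] th scale_sum_right)
  qed
  moreover have "X x \<in> grd G (n + 1)" if x: "x \<in> grd G n" for n x
  proof -
    obtain k where k: "((t \<circ> h) ^^ k) (t x) = 0" by (rule nil_obtain)
    have "((t \<circ> h) ^^ i) (t x) \<in> grd G (n + 1)" for i
    proof (induction i)
      case (Suc i)
      have "h (((t \<circ> h) ^^ i) (t x)) \<in> grd G n"
        using degree_mapD(2)[OF hG Suc] by (metis add.right_inverse add.right_neutral add.assoc)
      then have "t (h (((t \<circ> h) ^^ i) (t x))) \<in> grd G (n + 1)" by (rule degree_mapD(2)[OF tG])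
      moreover have "((t \<circ> h) ^^ Suc i) (t x) = t (h (((t \<circ> h) ^^ i) (t x)))"
        by (simp only: funpow.simps comp_apply)
      ultimately show ?case by (simp only:)
    qed (simp add: degree_mapD(2)[OF tG x])
    then show ?thesis unfolding X_eq[OF k] by (intro grd_sum[OF G]) auto
  qed
  ultimately show ?thesis
    by (simp add: degree_map_def linearI vector_space_axioms additive.add[OF X_additive])
qed

end

lemma degree_map_add:
  assumes "graded_space H" "degree_map G H e f" "degree_map G H e g"
  shows "degree_map G H e (\<lambda>x. f x + g x)" "degree_map G H e (\<lambda>x. f x - g x)"
    "degree_map G H e (\<lambda>x. - f x)"
  using assms
  by (auto simp: degree_map_def linear_combine intro: grd_add[OF assms(1)] grd_diff[OF assms(1)]
      grd_minus[OF assms(1)])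

text \<open>
  Everything but the identity \<open>key\<close>, which is $\delta_0 X + X \delta_0 = X j p X$, is a formal
  consequence of $X = t + thX = t + Xht$.  The identity \<open>key\<close> is checked after composition with
  the surjective map $1 - ht$ on the right, where $X(1 - ht) = t$.
\<close>

theorem perturbation_lemma:
  fixes G :: "('k::field, 'u::ab_group_add) gspace" and H :: "('k, 'w::ab_group_add) gspace"
  assumes con: "contraction (with_dif G d0) (with_dif H d) p j h"
    and tG: "degree_map G G 1 t"
    and sq: "\<And>x. d0 (d0 x - t x) - t (d0 x - t x) = 0"
    and nil: "locally_nilpotent (t \<circ> h)"
  defines "X \<equiv> pert_series t h"
  shows "contraction (with_dif G (\<lambda>u. d0 u - t u)) (with_dif H (\<lambda>y. d y - p (X (j y))))
    (\<lambda>u. p (u + X (h u))) (\<lambda>y. j y + h (X (j y))) (\<lambda>u. h u + h (X (h u)))"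
proof -
  have G: "graded_space G" and H: "graded_space H" and d0: "degree_map G G 1 d0"
    and d: "degree_map H H 1 d" and p: "degree_map G H 0 p" and j: "degree_map H G 0 j"
    and h: "degree_map G G (-1) h"
    and d0d0: "\<And>x. d0 (d0 x) = 0"
    and pd: "\<And>x. p (d0 x) = d (p x)" and jd: "\<And>y. j (d y) = d0 (j y)"
    and pj: "\<And>y. p (j y) = y" and hd: "\<And>x. h (d0 x) + d0 (h x) = x - j (p x)"
    and hh: "\<And>x. h (h x) = 0" and hj: "\<And>y. h (j y) = 0" and ph: "\<And>x. p (h x) = 0"
    using con by (auto simp: contraction_def cochain_complex_def)
  interpret nilpotent_pair t h
    by standard (use nil tG h in \<open>auto simp: degree_mapD\<close>)
  note defs = X_def[symmetric]
  have X: "degree_map G G 1 X" unfolding X_def by (rule X_degree_map[OF G tG h])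
  have Xl: "t (h (X u)) = X u - t u" and Xr: "X (h (t u)) = X u - t u" for u
    using X_left[of u] X_right[of u] by (simp_all add: defs)
  note lin = degree_mapD(4,6,7,8)[OF d0] degree_mapD(4,6,7,8)[OF d] degree_mapD(4,6,7,8)[OF p]
    degree_mapD(4,6,7,8)[OF j] degree_mapD(4,6,7,8)[OF h] degree_mapD(4,6,7,8)[OF X]
    degree_mapD(4,6,7,8)[OF tG]
  have d0t: "t (d0 x) = t (t x) - d0 (t x)" for x
    using sq[of x] d0d0[of x] by (simp add: lin algebra_simps)
  have d0h: "d0 (h x) = x - j (p x) - h (d0 x)" for x
    using hd[of x] by (simp add: algebra_simps)
  have key: "X (d0 x) = X (j (p (X x))) - d0 (X x)" for x
  proof -
    define E where "E x = d0 (X x) + X (d0 x) - X (j (p (X x)))" for x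
    have 1: "E (v - h (t v)) = 0" for v
    proof -
      have Xv: "X (v - h (t v)) = t v" by (simp add: lin Xr)
      define y where "y = E (v - h (t v))"
      have y: "y = d0 (t v) + X (d0 v) - X (d0 (h (t v))) - X (j (p (t v)))"
        unfolding y_def E_def Xv by (simp add: lin)
      have e: "X (d0 (h (t v))) = X (t v) - X (j (p (t v))) - X (h (d0 (t v)))"
        by (simp add: d0h lin)
      then have y2: "y = d0 (t v) + X (d0 v) - X (t v) + X (h (d0 (t v)))"
        using y unfolding e by (simp add: algebra_simps)
      have "X (h (t (d0 v))) = X (d0 v) - t (d0 v)" by (rule Xr)
      then have "X (h (t (t v))) - X (h (d0 (t v))) = X (d0 v) - t (t v) + d0 (t v)"
        by (simp add: d0t lin algebra_simps)
      then have "X (t v) - t (t v) - X (h (d0 (t v))) = X (d0 v) - t (t v) + d0 (t v)"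
        by (simp add: Xr)
      then show ?thesis using y2 by (simp add: y_def algebra_simps)
    qed
    \<comment> \<open>surjectivity of $1 - ht$, with the preimage $(1 + hX) x$ of \<open>x\<close>\<close>
    have 2: "x = (x + h (X x)) - h (t (x + h (X x)))"
      by (simp add: lin Xl)
    have "E x = 0" by (subst 2) (rule 1)
    then show ?thesis by (simp add: E_def algebra_simps)
  qed
  let ?d = "\<lambda>y. d y - p (X (j y))" and ?D = "\<lambda>u. d0 u - t u"
  let ?p = "\<lambda>u. p (u + X (h u))" and ?j = "\<lambda>y. j y + h (X (j y))" and ?h = "\<lambda>u. h u + h (X (h u))"
  have degs: "degree_map G G 1 ?D" "degree_map H H 1 ?d" "degree_map G H 0 ?p"
    "degree_map H G 0 ?j" "degree_map G G (-1) ?h"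
  proof -
    show "degree_map G G 1 ?D" by (intro degree_map_add G d0 tG)
    show "degree_map H H 1 ?d"
      using degree_map_compose[OF degree_map_compose[OF j X] p]
      by (intro degree_map_add H d) (simp add: o_def)
    have 1: "degree_map G H 0 (\<lambda>u. p (X (h u)))"
      using degree_map_compose[OF degree_map_compose[OF h X] p] by (simp add: o_def)
    show "degree_map G H 0 ?p"
      using degree_map_add(1)[OF H p 1] by (simp add: lin)
    show "degree_map H G 0 ?j"
      using degree_map_compose[OF degree_map_compose[OF j X] h]
      by (intro degree_map_add G j) (simp add: o_def)
    show "degree_map G G (-1) ?h"
      using degree_map_compose[OF degree_map_compose[OF h X] h]
      by (intro degree_map_add G h) (simp add: o_def)
  qed
  have jt: "?j (?d y) = ?D (?j y)" for y
    by (simp add: lin Xl d0h jd key algebra_simps)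
  have pt: "?p (?D x) = ?d (?p x)" for x
  proof -
    have e: "X (h (d0 x)) = X x - X (j (p x)) - X (d0 (h x))"
    proof -
      have "h (d0 x) = x - j (p x) - d0 (h x)" using d0h[of x] by (simp add: algebra_simps)
      then show ?thesis by (simp add: lin)
    qed
    show ?thesis by (simp add: lin Xr pd[symmetric] e key algebra_simps)
  qed
  have pjt: "?p (?j y) = y" for y by (simp add: lin hh hj ph pj)
  have DD: "?D (?D x) = 0" for x using sq by simp
  have homt: "?h (?D x) + ?D (?h x) = x - ?j (?p x)" for x
  proof -
    have hd': "h (d0 x) = x - j (p x) - d0 (h x)" for x using d0h[of x] by (simp add: algebra_simps)
    have "?h (?D x) + ?D (?h x) = h (d0 x) + d0 (h x) + h (X (h (d0 x))) + d0 (h (X (h x))) - h (X x) - X (h x)"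
      by (simp add: lin Xr Xl algebra_simps)
    also have "h (d0 x) + d0 (h x) = x - j (p x)" by (rule hd)
    also have "h (X (h (d0 x))) = h (X x) - h (X (j (p x))) - h (X (d0 (h x)))"
      by (simp add: hd' lin)
    also have "d0 (h (X (h x))) = X (h x) - j (p (X (h x))) - h (d0 (X (h x)))"
      by (rule d0h)
    finally show ?thesis by (simp add: lin key algebra_simps)
  qed
  have dd: "?d (?d y) = 0" for y
  proof -
    have "?d (?d y) = ?p (?j (?d (?d y)))" by (simp only: pjt)
    also have "?j (?d (?d y)) = ?D (?D (?j y))" by (simp only: jt)
    also have "?D (?D (?j y)) = 0" by (rule DD)
    finally show ?thesis by (simp add: lin)
  qed
  have sides: "?h (?h x) = 0" "?h (?j y) = 0" "?p (?h x) = 0" for x y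
    by (simp_all add: lin hh hj ph)
  show ?thesis
    unfolding contraction_def cochain_complex_def with_dif_simps graded_space_with_dif
      degree_map_with_dif_left degree_map_with_dif_right
    using G H degs jt pt pjt DD homt dd sides by auto
qed

text \<open>
  The components of \<open>f x\<close> are the images of the components of \<open>x\<close>, so that the inverse of a
  degree preserving bijection preserves degrees.
\<close>

lemma degree_map_inv:
  assumes G: "graded_space G" and H: "graded_space H" and f: "degree_map G H 0 f" and b: "bij f"
  shows "degree_map H G 0 (inv f)"
proof -
  have inv: "inv f (f x) = x" "f (inv f y) = y" for x y
    using b by (simp_all add: bij_is_inj bij_is_surj surj_f_inv_f)
  have lin: "Vector_Spaces.linear (scl H) (scl G) (inv f)"
  proof (rule linearI)
    show "inv f (x + y) = inv f x + inv f y" for x y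
      by (metis inv degree_mapD(4)[OF f])
    show "inv f (scl H c x) = scl G c (inv f x)" for c x
      by (metis inv degree_mapD(5)[OF f])
  qed (use G H in \<open>auto simp: graded_space_def\<close>)
  moreover have "inv f y \<in> grd G n" if y: "y \<in> grd H n" for y n
  proof -
    define x where "x = inv f y"
    have "hcomp H (f x) = (\<lambda>m. f (hcomp G x m))"
    proof (rule hcomp_unique[OF H])
      have z: "{m. f (hcomp G x m) \<noteq> 0} = {m. hcomp G x m \<noteq> 0}"
        by (metis (lifting) inv(1) degree_mapD(6)[OF f])
      show "f (hcomp G x m) \<in> grd H m" for m using degree_mapD(2)[OF f hcomp(1)[OF G]] by simp
      show "finite {m. f (hcomp G x m) \<noteq> 0}" unfolding z by (rule hcomp(2)[OF G])
      show "f x = (\<Sum>m | f (hcomp G x m) \<noteq> 0. f (hcomp G x m))"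
        unfolding z by (subst hcomp(3)[OF G, of x]) (rule additive.sum[OF degree_mapD(3)[OF f]])
    qed
    then have "f (hcomp G x m) = 0" if "m \<noteq> n" for m
      using hcomp_homogeneous[OF H y] that by (metis inv(2) x_def)
    then have "hcomp G x m = 0" if "m \<noteq> n" for m
      using that by (metis inv(1) degree_mapD(6)[OF f])
    then have "{m. hcomp G x m \<noteq> 0} \<subseteq> {n}" by auto
    then have "x = hcomp G x n"
      by (subst hcomp(3)[OF G, of x], subst sum.mono_neutral_left[where T = "{n}"]) auto
    then show ?thesis using hcomp(1)[OF G] x_def by metis
  qed
  ultimately show ?thesis by (simp add: degree_map_def)
qed

lemma contraction_transport:
  assumes con: "contraction (with_dif G d0) (with_dif H d) p j h"
    and G': "graded_space G'" and f: "degree_map G G' 0 f" and b: "bij f"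
  shows "contraction (with_dif G' (f \<circ> d0 \<circ> inv f)) (with_dif H d) (p \<circ> inv f) (f \<circ> j) (f \<circ> h \<circ> inv f)"
proof -
  have G: "graded_space G" using con by (simp add: contraction_def cochain_complex_def)
  have i: "degree_map G' G 0 (inv f)" by (rule degree_map_inv[OF G G' f b])
  have inv: "inv f (f x) = x" "f (inv f y) = y" for x y
    using b by (simp_all add: bij_is_inj bij_is_surj surj_f_inv_f)
  have c: "degree_map G' G' e (f \<circ> k \<circ> inv f)" if "degree_map G G e k" for e k
    using degree_map_compose[OF degree_map_compose[OF i that] f] by (simp add: o_assoc)
  have p: "degree_map G H 0 p" and j: "degree_map H G 0 j"
    using con by (simp_all add: contraction_def)
  have deg: "degree_map G' H 0 (p \<circ> inv f)" "degree_map H G' 0 (f \<circ> j)"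
    using degree_map_compose[OF i p] degree_map_compose[OF j f] by simp_all
  have hom: "h (d0 x) + d0 (h x) = x - j (p x)" for x
    using con by (simp add: contraction_def)
  have "f (h (d0 x)) + f (d0 (h x)) = f x - f (j (p x))" for x
    by (simp add: degree_mapD(4)[OF f, symmetric] degree_mapD(7)[OF f, symmetric] hom)
  then have hom': "f (h (d0 (inv f y))) + f (d0 (h (inv f y))) = y - f (j (p (inv f y)))" for y
    by (metis inv(2))
  show ?thesis
    using con G' deg c hom'
    by (simp add: contraction_def cochain_complex_def inv degree_mapD(6)[OF f])
qed


section \<open>Sums over the decompositions of a list\<close>

text \<open>The sum of \<open>F us vs\<close> over all \<open>us @ vs = xs\<close>.\<close>

definition cuts :: "('x list \<Rightarrow> 'x list \<Rightarrow> 'v::ab_group_add) \<Rightarrow> 'x list \<Rightarrow> 'v" where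
  "cuts F xs = (\<Sum>l\<le>length xs. F (take l xs) (drop l xs))"

lemma cuts_Nil [simp]: "cuts F [] = F [] []"
  by (simp add: cuts_def)

lemma cuts_Cons: "cuts F (x # xs) = F [] (x # xs) + cuts (\<lambda>u v. F (x # u) v) xs"
  by (simp add: cuts_def sum.atMost_Suc_shift del: sum.atMost_Suc)

lemma cuts_cong: "(\<And>u v. u @ v = xs \<Longrightarrow> F u v = F' u v) \<Longrightarrow> cuts F xs = cuts F' xs"
  by (simp add: cuts_def)

lemma cuts_add: "cuts (\<lambda>u v. F u v + F' u v) xs = cuts F xs + cuts F' xs"
  and cuts_diff: "cuts (\<lambda>u v. F u v - F' u v) xs = cuts F xs - cuts F' xs"
  and cuts_minus: "cuts (\<lambda>u v. - F u v) xs = - cuts F xs"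
  and cuts_zero [simp]: "cuts (\<lambda>u v. 0) xs = 0"
  by (simp_all add: cuts_def sum.distrib sum_subtractf sum_negf)

lemma cuts_additive: "additive f \<Longrightarrow> f (cuts F xs) = cuts (\<lambda>u v. f (F u v)) xs"
  by (simp add: cuts_def additive.sum)

lemma cuts_mult:
  fixes c :: "'b::ring"
  shows "c * cuts F xs = cuts (\<lambda>u v. c * F u v) xs" "cuts F xs * c = cuts (\<lambda>u v. F u v * c) xs"
  by (simp_all add: cuts_def sum_distrib_left sum_distrib_right)

lemma cuts_map: "cuts F (map f xs) = cuts (\<lambda>u v. F (map f u) (map f v)) xs"
  by (simp add: cuts_def take_map drop_map)

lemma cuts_swap: "cuts (\<lambda>u v. cuts (\<lambda>u' v'. F u v u' v') ys) xs = cuts (\<lambda>u' v'. cuts (\<lambda>u v. F u v u' v') xs) ys"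
  unfolding cuts_def by (rule sum.swap)

lemma cuts_assoc:
  "cuts (\<lambda>u v. cuts (\<lambda>u1 u2. F u1 u2 v) u) xs = cuts (\<lambda>u v. cuts (\<lambda>v1 v2. F u v1 v2) v) xs"
  by (induction xs arbitrary: F) (simp_all add: cuts_Cons cuts_add add.assoc)

lemma cuts_insert:
  "cuts F (us @ y # ws) =
    cuts (\<lambda>u1 u2. F u1 (u2 @ y # ws)) us + cuts (\<lambda>w1 w2. F (us @ y # w1) w2) ws"
  by (induction us arbitrary: F) (simp_all add: cuts_Cons add.assoc)

lemma cuts_only_first: "cuts (\<lambda>u v. if u = [] then F v else 0) xs = F xs"
  by (cases xs) (simp_all add: cuts_Cons)

lemma cuts_only_last: "cuts (\<lambda>u v. if v = [] then F u else 0) xs = F xs"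
  by (induction xs arbitrary: F) (simp_all add: cuts_Cons)

lemma cuts_inner:
  assumes "\<And>u. F u [] = 0" "\<And>v. F [] v = 0"
  shows "cuts F xs = (\<Sum>l = 1..<length xs. F (take l xs) (drop l xs))"
  unfolding cuts_def
proof (rule sum.mono_neutral_right)
  show "\<forall>l\<in>{..length xs} - {1..<length xs}. F (take l xs) (drop l xs) = 0"
  proof
    fix l assume "l \<in> {..length xs} - {1..<length xs}"
    then have "l = 0 \<or> l = length xs" by auto
    then show "F (take l xs) (drop l xs) = 0" using assms by auto
  qed
qed auto

lemma cuts_cuts_reindex:
  assumes "\<And>u w. F u [] w = 0"
  shows "cuts (\<lambda>u v. cuts (\<lambda>m w. F u m w) v) xs =
    (\<Sum>i = 1..length xs. \<Sum>l = 0..length xs - i. F (take l xs) (take i (drop l xs)) (drop (l + i) xs))"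
proof -
  let ?n = "length xs" and ?f = "\<lambda>l i. F (take l xs) (take i (drop l xs)) (drop (l + i) xs)"
  have "cuts (\<lambda>u v. cuts (\<lambda>m w. F u m w) v) xs = (\<Sum>l\<le>?n. \<Sum>i\<le>?n - l. ?f l i)"
    by (simp add: cuts_def add.commute)
  also have "\<dots> = (\<Sum>l\<le>?n. \<Sum>i\<le>?n. if l + i \<le> ?n then ?f l i else 0)"
    by (intro sum.cong refl sum.mono_neutral_cong_left) auto
  also have "\<dots> = (\<Sum>i\<le>?n. \<Sum>l\<le>?n. if l + i \<le> ?n then ?f l i else 0)" by (rule sum.swap)
  also have "\<dots> = (\<Sum>i\<le>?n. \<Sum>l = 0..?n - i. ?f l i)"
    by (intro sum.cong refl sum.mono_neutral_cong_right) auto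
  also have "\<dots> = (\<Sum>i = 1..?n. \<Sum>l = 0..?n - i. ?f l i)"
  proof (rule sum.mono_neutral_right)
    show "\<forall>i\<in>{..?n} - {1..?n}. (\<Sum>l = 0..?n - i. ?f l i) = 0"
    proof
      fix i assume "i \<in> {..?n} - {1..?n}"
      then have "i = 0" by auto
      then show "(\<Sum>l = 0..?n - i. ?f l i) = 0" by (simp add: assms)
    qed
  qed auto
  finally show ?thesis .
qed


section \<open>Transfer of an associative product along a contraction\<close>

text \<open>
  The recursion for the operations \<open>\<gamma>\<close> on the suspension, with \<open>s\<close> its sign automorphism.  The
  value at the empty list is zero, so that sums over all cuts of a list may include the trivial ones.
\<close>

function tree_op :: "('t \<Rightarrow> 't) \<Rightarrow> ('t \<Rightarrow> 'u::ring) \<Rightarrow> ('u \<Rightarrow> 'u) \<Rightarrow> 't list \<Rightarrow> 'u" where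
  "tree_op s j h xs =
    (if xs = [] then 0 else if length xs = 1 then - j (hd xs)
     else h (- (\<Sum>l = 1..<length xs. tree_op s j h (map s (take l xs)) * tree_op s j h (drop l xs))))"
  by auto
termination by (relation "measure (\<lambda>(s, j, h, xs). length xs)") auto

declare tree_op.simps [simp del]

text \<open>
  A contraction of a differential graded algebra \<open>H\<close>, with product \<open>(*)\<close> and differential \<open>\<delta>\<close>, to
  a complex \<open>G\<close> with differential \<open>d\<close>.
\<close>

locale dg_contraction =
  fixes G :: "('k::field, 't::ab_group_add) gspace" and H :: "('k, 'u::ring) gspace"
    and p :: "'u \<Rightarrow> 't" and j :: "'t \<Rightarrow> 'u" and h :: "'u \<Rightarrow> 'u"
    and d :: "'t \<Rightarrow> 't" and \<delta> :: "'u \<Rightarrow> 'u"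
  assumes con: "contraction (with_dif H \<delta>) (with_dif G d) p j h"
    and mul: "graded_bilinear H H H (*)"
    and der: "graded_derivation H 1 \<delta>"
begin

lemma G: "graded_space G" and H: "graded_space H"
  and degs: "degree_map H H 1 \<delta>" "degree_map G G 1 d" "degree_map H G 0 p" "degree_map G H 0 j"
    "degree_map H H (-1) h"
  and pd: "p (\<delta> u) = d (p u)" and jd: "j (d x) = \<delta> (j x)"
  and hd: "\<delta> (h u) = u - j (p u) - h (\<delta> u)"
  and dd: "d (d x) = 0"
proof -
  have "h (\<delta> u) + \<delta> (h u) = u - j (p u)" using con by (simp add: contraction_def)
  then show "\<delta> (h u) = u - j (p u) - h (\<delta> u)" by (simp add: algebra_simps)
qed (use con in \<open>simp_all add: contraction_def cochain_complex_def\<close>)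

lemmas lin = degree_mapD(4,6,7,8)[OF degs(1)] degree_mapD(4,6,7,8)[OF degs(2)]
  degree_mapD(4,6,7,8)[OF degs(3)] degree_mapD(4,6,7,8)[OF degs(4)] degree_mapD(4,6,7,8)[OF degs(5)]

lemma mult_degree: "x \<in> grd H m \<Longrightarrow> y \<in> grd H n \<Longrightarrow> x * y \<in> grd H (m + n)"
  using mul by (simp add: graded_bilinear_def)

lemmas T_mult = tw_mult[OF H mult_degree]

lemma leibniz: "\<delta> (x * y) = \<delta> x * y + tw H x * \<delta> y"
proof (rule additive_eqI[OF H, where f = "\<lambda>x. \<delta> (x * y)" and g = "\<lambda>x. \<delta> x * y + tw H x * \<delta> y"])
  fix n x assume x: "x \<in> grd H n"
  then show "\<delta> (x * y) = \<delta> x * y + tw H x * \<delta> y"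
    using der by (simp add: graded_derivation_def tw_homogeneous[OF H x] sg_mult_left)
qed (auto simp: additive_def tw_add[OF H] distrib_right lin)

text \<open>
  On the suspension of the small complex the signs of the recursion and of the
  $A_\infty$-relations become plain Koszul signs, and \<open>s\<close>, the sign automorphism of the suspension,
  produces them without reference to degrees: an odd map that passes the arguments \<open>us\<close> turns them
  into \<open>map s us\<close>.  The families \<open>g\<close>, \<open>b\<close> and \<open>a\<close> are \<open>\<gamma>\<close>, \<open>\<beta>\<close> and \<open>\<alpha>\<close> on the suspension.
\<close>

definition s :: "'t \<Rightarrow> 't" where "s x = - tw G x"

definition g :: "'t list \<Rightarrow> 'u" where "g = tree_op s j h"

definition b :: "'t list \<Rightarrow> 'u" where "b xs = - cuts (\<lambda>u v. g (map s u) * g v) xs"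

definition a :: "'t list \<Rightarrow> 't" where
  "a xs = (if length xs = 1 then d (hd xs) else p (b xs))"

lemma s_linear: "Vector_Spaces.linear (scl G) (scl G) s"
  unfolding s_def by (intro linear_minus tw_linear[OF G])

lemma s_s [simp]: "s (s x) = x" and s_o_s: "map s (map s xs) = xs"
proof -
  show s: "s (s x) = x" for x by (simp add: s_def tw_minus[OF G] tw_tw[OF G])
  show "map s (map s xs) = xs" by (simp add: s o_def)
qed

lemma g_Nil [simp]: "g [] = 0" and g_single: "g [x] = - j x"
  by (simp_all add: g_def tree_op.simps)

lemma b_Nil [simp]: "b [] = 0" and b_single: "b [x] = 0"
  by (simp_all add: b_def cuts_Cons)

lemma a_Nil [simp]: "a [] = 0"
  by (simp add: a_def lin)

lemma g_long: "length xs \<ge> 2 \<Longrightarrow> g xs = h (b xs)"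
  by (subst g_def, subst tree_op.simps) (auto simp: g_def[symmetric] b_def cuts_inner)

text \<open>Since \<open>b\<close> vanishes on lists of length one, both families are given by one formula.\<close>

lemma g_eq: "g xs = h (b xs) + (if length xs = 1 then - j (hd xs) else 0)"
proof (cases "length xs \<ge> 2")
  case False
  then have "xs = [] \<or> (\<exists>x. xs = [x])" by (cases xs rule: list.exhaust[case_product list.exhaust[of "tl xs"]]) auto
  then show ?thesis by (auto simp: g_single b_single lin)
qed (simp add: g_long)

lemma a_eq: "a xs = p (b xs) + (if length xs = 1 then d (hd xs) else 0)"
  by (auto simp: a_def length_Suc_conv b_single lin)

lemma mult_linear: "Vector_Spaces.linear (scl H) (scl H) (\<lambda>y. x * y)"
    "Vector_Spaces.linear (scl H) (scl H) (\<lambda>x. x * y)"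
  using mul by (simp_all add: graded_bilinear_def)

lemma b_linear_aux:
  assumes "\<And>us ws. length us + length ws < n \<Longrightarrow> Vector_Spaces.linear (scl G) (scl H) (\<lambda>x. g (us @ x # ws))"
    and "length us + length ws = n"
  shows "Vector_Spaces.linear (scl G) (scl H) (\<lambda>x. b (us @ x # ws))"
proof -
  have vs: "vector_space (scl G)" "vector_space (scl H)"
    by (rule graded_vector_space[OF G], rule graded_vector_space[OF H])
  have 1: "Vector_Spaces.linear (scl G) (scl H) (\<lambda>x. g (map s u) * g (v @ x # ws))" if "u @ v = us" for u v
  proof (cases "u = []")
    case False
    then show ?thesis using assms(2) that
      by (intro linear_compose[OF assms(1) mult_linear(1)]) (cases u, auto)
  qed (simp add: linear_zero vs)
  have 2: "Vector_Spaces.linear (scl G) (scl H) (\<lambda>x. g (map s us @ s x # map s u) * g v)" if "u @ v = ws" for u v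
  proof (cases "v = []")
    case False
    then show ?thesis using assms(2) that
      by (intro linear_compose[OF linear_compose[OF s_linear assms(1)] mult_linear(2)]) (cases v, auto)
  qed (simp add: linear_zero vs)
  show ?thesis
    unfolding b_def cuts_insert
    by (simp only: cuts_def, intro linear_minus linear_add linear_sum vs) (simp_all add: 1 2)
qed

lemma g_linear: "Vector_Spaces.linear (scl G) (scl H) (\<lambda>x. g (us @ x # ws))"
proof (induction "length us + length ws" arbitrary: us ws rule: less_induct)
  case less
  then have b: "Vector_Spaces.linear (scl G) (scl H) (\<lambda>x. b (us @ x # ws))" by (blast intro: b_linear_aux)
  show ?case
  proof (cases "us = [] \<and> ws = []")
    case True
    then show ?thesis using linear_minus[OF degree_mapD(1)[OF degs(4)]]
      by (simp add: g_single)
  next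
    case False
    then have "length (us @ x # ws) \<ge> 2" for x by (cases us; cases ws) auto
    then show ?thesis using linear_compose[OF b degree_mapD(1)[OF degs(5)]] by (simp add: g_long)
  qed
qed

lemma b_linear: "Vector_Spaces.linear (scl G) (scl H) (\<lambda>x. b (us @ x # ws))"
  by (rule b_linear_aux) (auto intro: g_linear)

lemma a_linear: "Vector_Spaces.linear (scl G) (scl G) (\<lambda>x. a (us @ x # ws))"
proof (cases "us = [] \<and> ws = []")
  case False
  then have "a (us @ x # ws) = p (b (us @ x # ws))" for x by (auto simp: a_def)
  then show ?thesis using linear_compose[OF b_linear degree_mapD(1)[OF degs(3)]] by simp
qed (use degree_mapD(1)[OF degs(2)] in \<open>simp add: a_def\<close>)

lemmas g_additive = linearD(5)[OF g_linear]
  and a_additive = linearD(5)[OF a_linear]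

text \<open>
  With respect to the degrees on the suspension, \<open>b\<close> is of even degree, and \<open>g\<close> and \<open>a\<close> are of
  odd degree.
\<close>

lemma T_b_g: "tw H (b xs) = b (map s xs) \<and> tw H (g xs) = - g (map s xs)"
proof (induction "length xs" arbitrary: xs rule: less_induct)
  case less
  have b: "tw H (b xs) = b (map s xs)"
  proof -
    have "tw H (g (map s u) * g v) = g (map s (map s u)) * g (map s v)" if uv: "u @ v = xs" for u v
    proof (cases "u = [] \<or> v = []")
      case False
      then have "length (map s u) < length xs" "length v < length xs" using uv by auto
      then have "tw H (g (map s u)) = - g (map s (map s u))" "tw H (g v) = - g (map s v)"
        using less by blast+
      then show ?thesis by (simp add: T_mult del: map_map)
    qed (use tw_zero[OF H] in auto)
    then show ?thesis
      by (simp add: b_def tw_minus[OF H] cuts_additive[OF tw_additive[OF H]] cuts_map cong: cuts_cong)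
  qed
  moreover have "tw H (g xs) = - g (map s xs)"
  proof -
    have 1: "tw H (h u) = - h (tw H u)" for u using tw_degree_map[OF H H degs(5), of u] by simp
    have 2: "tw H (j x) = j (tw G x)" for x using tw_degree_map[OF G H degs(4), of x] by simp
    have "hd (map s xs) = - tw G (hd xs)" if "length xs = 1"
      using that by (auto simp: length_Suc_conv s_def)
    then show ?thesis
      using b by (auto simp: g_eq[of xs] g_eq[of "map s xs"] tw_add[OF H] tw_minus[OF H] tw_zero[OF H]
          1 2 lin)
  qed
  ultimately show ?case ..
qed

lemma s_a: "s (a xs) = - a (map s xs)"
proof (cases "length xs = 1")
  case True
  then obtain x where "xs = [x]" by (auto simp: length_Suc_conv)
  then show ?thesis using tw_degree_map[OF G G degs(2), of x] by (simp add: a_def s_def lin)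
next
  case False
  then show ?thesis using tw_degree_map[OF H G degs(3), of "b xs"] T_b_g[of xs]
    by (simp add: a_def s_def)
qed

text \<open>Precomposition with the coderivation of the tensor coalgebra that corestricts to \<open>a\<close>.\<close>

definition coder :: "('t list \<Rightarrow> 'v::ab_group_add) \<Rightarrow> 't list \<Rightarrow> 'v" where
  "coder f xs = cuts (\<lambda>u v. cuts (\<lambda>m w. f (map s u @ a m # w)) v) xs"

lemma coder_split:
  assumes "\<And>ys. f ys = f' ys + (if length ys = 1 then k (hd ys) else 0)"
  shows "coder f xs = coder f' xs + k (a xs)"
proof -
  have "coder f xs = coder f' xs +
    cuts (\<lambda>u v. cuts (\<lambda>m w. if length (map s u @ a m # w) = 1 then k (hd (map s u @ a m # w)) else 0) v) xs"
    by (simp only: coder_def assms cuts_add)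
  also have "(\<lambda>u v. cuts (\<lambda>m w. if length (map s u @ a m # w) = 1 then k (hd (map s u @ a m # w)) else 0) v)
      = (\<lambda>u v. if u = [] then cuts (\<lambda>m w. if w = [] then k (a m) else 0) v else 0)"
    by (auto simp: fun_eq_iff intro!: cuts_cong)
  finally show ?thesis by (simp add: cuts_only_first cuts_only_last)
qed

lemma coder_additive: "additive f \<Longrightarrow> coder (\<lambda>ys. f (k ys)) xs = f (coder k xs)"
  by (simp add: coder_def cuts_additive)

lemma coder_g_Nil [simp]: "coder g [] = 0"
  using additive.zero[OF g_additive[of "[]" "[]"]] by (simp add: coder_def)

text \<open>
  The coderivation acts on the product of \<open>g\<close> with itself by the Leibniz rule: the inserted element
  \<open>a m\<close> lies either in the second or in the first part of a cut.
\<close>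

lemma coder_b:
  "coder b xs = - cuts (\<lambda>y z. g y * coder g z - coder g (map s y) * g z) xs"
proof -
  have 1: "cuts (\<lambda>u v. cuts (\<lambda>m w. cuts (\<lambda>u1 u2. g (map s (map s u1)) * g (map s u2 @ a m # w)) u) v) xs
      = cuts (\<lambda>y z. g y * coder g z) xs"
    proof -
    have "cuts (\<lambda>m w. cuts (\<lambda>u1 u2. g (map s (map s u1)) * g (map s u2 @ a m # w)) u) v
        = cuts (\<lambda>u1 u2. cuts (\<lambda>m w. g u1 * g (map s u2 @ a m # w)) v) u" for u v
      by (subst cuts_swap) (simp only: s_o_s)
    then show ?thesis by (simp only: cuts_assoc coder_def cuts_mult)
  qed
  have "coder g (map s y) = - cuts (\<lambda>u v. cuts (\<lambda>m w. g (map s (map s u @ a m # w))) v) y" for y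
    by (simp add: coder_def cuts_map s_a additive.minus[OF g_additive] cuts_minus)
  then have 2: "cuts (\<lambda>u v. cuts (\<lambda>m w. cuts (\<lambda>w1 w2. g (map s (map s u @ a m # w1)) * g w2) w) v) xs
      = - cuts (\<lambda>y z. coder g (map s y) * g z) xs"
    by (simp only: cuts_assoc[symmetric] cuts_mult[symmetric] append_assoc append_Cons minus_mult_left
        cuts_minus[symmetric] minus_minus)
  have "coder b xs = - (cuts (\<lambda>u v. cuts (\<lambda>m w. cuts (\<lambda>u1 u2. g (map s (map s u1)) * g (map s u2 @ a m # w)) u) v) xs
      + cuts (\<lambda>u v. cuts (\<lambda>m w. cuts (\<lambda>w1 w2. g (map s (map s u @ a m # w1)) * g w2) w) v) xs)"
  proof -
    have "b (map s u @ a m # w) = - (cuts (\<lambda>u1 u2. g (map s (map s u1)) * g (map s u2 @ a m # w)) u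
        + cuts (\<lambda>w1 w2. g (map s (map s u @ a m # w1)) * g w2) w)" for u m w
      by (simp only: b_def cuts_insert cuts_map)
    then show ?thesis by (simp only: coder_def cuts_minus cuts_add)
  qed
  then show ?thesis unfolding 1 2 by (simp add: cuts_diff)
qed

text \<open>
  The family \<open>g\<close> is a twisting cochain on the tensor coalgebra with the coderivation of \<open>a\<close>.  In the
  induction the Leibniz expansion of \<open>\<delta> (b xs)\<close> involves \<open>g\<close> on proper parts of \<open>xs\<close> only, and the
  triple products of \<open>g\<close> cancel by associativity.
\<close>

lemma twisting: "\<delta> (b xs) + coder b xs = 0 \<and> \<delta> (g xs) = b xs + coder g xs"
proof (induction "length xs" arbitrary: xs rule: less_induct)
  case less
  have "\<delta> (g (map s y) * g z) = (b (map s y) + coder g (map s y)) * g z - g y * (b z + coder g z)"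
    if yz: "y @ z = xs" for y z
  proof -
    have T: "tw H (g (map s y)) = - g y" using T_b_g[of "map s y"] by (simp add: s_o_s del: map_map)
    show ?thesis
    proof (cases "y = [] \<or> z = []")
      case False
      then have "length (map s y) < length xs" "length z < length xs" using yz by auto
      then have "\<delta> (g (map s y)) = b (map s y) + coder g (map s y)" "\<delta> (g z) = b z + coder g z"
        using less by blast+
      then show ?thesis by (simp add: leibniz T)
    qed (auto simp: lin)
  qed
  then have "\<delta> (b xs) = - cuts (\<lambda>y z. (b (map s y) + coder g (map s y)) * g z - g y * (b z + coder g z)) xs"
    by (simp add: b_def[of xs] lin cuts_additive[OF degree_mapD(3)[OF degs(1)]] cong: cuts_cong)
  also have "\<dots> = - cuts (\<lambda>y z. b (map s y) * g z) xs + cuts (\<lambda>y z. g y * b z) xs - coder b xs"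
    by (simp add: coder_b distrib_left distrib_right cuts_add cuts_diff)
  also have "cuts (\<lambda>y z. b (map s y) * g z) xs = cuts (\<lambda>y z. g y * b z) xs"
    using cuts_assoc[of "\<lambda>u v w. g u * g (map s v) * g w" xs]
    by (simp add: b_def cuts_map cuts_mult cuts_minus s_o_s mult.assoc del: map_map)
  finally have b: "\<delta> (b xs) = - coder b xs" by simp
  have "coder g xs = coder (\<lambda>ys. h (b ys)) xs - j (a xs)"
    using coder_split[OF g_eq, of xs] by simp
  then have g: "coder g xs = h (coder b xs) - j (a xs)"
    by (simp add: coder_additive[OF degree_mapD(3)[OF degs(5)]])
  have "\<delta> (g xs) = b xs + coder g xs"
    by (auto simp: g g_eq[of xs] a_eq lin hd b jd length_Suc_conv)
  then show ?case using b by simp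
qed

lemma bar_relation: "coder a xs = 0"
proof -
  have "coder a xs = coder (\<lambda>ys. p (b ys)) xs + d (a xs)"
    using coder_split[OF a_eq, of xs] by simp
  also have "coder (\<lambda>ys. p (b ys)) xs = - d (p (b xs))"
    using twisting[of xs] by (simp add: coder_additive[OF degree_mapD(3)[OF degs(3)]]
        eq_neg_iff_add_eq_0[symmetric] add.commute pd[symmetric] lin)
  also have "d (a xs) = d (p (b xs))" by (simp add: a_eq lin dd)
  finally show ?thesis by simp
qed

lemma b_g_degree:
  assumes "homogeneous_list G xs ns"
  shows "b xs \<in> grd H (sum_list ns + 2 - int (length xs)) \<and>
    g xs \<in> grd H (sum_list ns + 1 - int (length xs))"
  using assms
proof (induction "length xs" arbitrary: xs ns rule: less_induct)
  case less
  have ln: "length xs = length ns" using less.prems by (simp add: homogeneous_list_def list_all2_lengthD)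
  have "g (map s (take l xs)) * g (drop l xs) \<in> grd H (sum_list ns + 2 - int (length xs))"
    if l: "l \<in> {1..<length xs}" for l
  proof -
    have "homogeneous_list G (map s (take l xs)) (take l ns)" "homogeneous_list G (drop l xs) (drop l ns)"
      using less.prems by (auto simp: homogeneous_list_def list_all2_conv_all_nth s_def
          intro!: grd_minus[OF G] tw_grd[OF G])
    then have "g (map s (take l xs)) \<in> grd H (sum_list (take l ns) + 1 - int l)"
      "g (drop l xs) \<in> grd H (sum_list (drop l ns) + 1 - int (length xs - l))"
      using less.hyps[of "map s (take l xs)" "take l ns"] less.hyps[of "drop l xs" "drop l ns"] l by auto
    from mult_degree[OF this] show ?thesis
      using l sum_list_append[of "take l ns" "drop l ns"] by (simp add: algebra_simps of_nat_diff)
  qed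
  then have b: "b xs \<in> grd H (sum_list ns + 2 - int (length xs))"
    unfolding b_def by (subst cuts_inner) (auto intro!: grd_minus[OF H] grd_sum[OF H])
  moreover have "g xs \<in> grd H (sum_list ns + 1 - int (length xs))"
  proof -
    have "h (b xs) \<in> grd H (sum_list ns + 1 - int (length xs))"
      using degree_mapD(2)[OF degs(5) b] by (simp add: algebra_simps)
    moreover have "- j (hd xs) \<in> grd H (sum_list ns + 1 - int (length xs))" if "length xs = 1"
      using that less.prems degree_mapD(2)[OF degs(4)]
      by (auto simp: length_Suc_conv homogeneous_list_def list_all2_Cons1 intro!: grd_minus[OF H])
    then have "(if length xs = 1 then - j (hd xs) else 0) \<in> grd H (sum_list ns + 1 - int (length xs))"
      using grd_zero[OF H] by simp
    ultimately show ?thesis unfolding g_eq[of xs] by (intro grd_add[OF H])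
  qed
  ultimately show ?case ..
qed

lemma a_degree:
  assumes "homogeneous_list G xs ns"
  shows "a xs \<in> grd G (sum_list ns + 2 - int (length xs))"
proof -
  have "p (b xs) \<in> grd G (sum_list ns + 2 - int (length xs))"
    using degree_mapD(2)[OF degs(3) conjunct1[OF b_g_degree[OF assms]]] by simp
  moreover have "d (hd xs) \<in> grd G (sum_list ns + 2 - int (length xs))" if "length xs = 1"
    using that assms degree_mapD(2)[OF degs(2)]
    by (auto simp: length_Suc_conv homogeneous_list_def list_all2_Cons1 algebra_simps)
  ultimately show ?thesis unfolding a_eq by (auto intro!: grd_add[OF G] grd_zero[OF G])
qed

end


context dg_contraction
begin

text \<open>The passage to the suspension: \<open>et [x\<^sub>1, \<dots>, x\<^sub>k]\<close> has $i$-th entry $(-1)^{(k-i)x_i}x_i$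
  if the arguments are homogeneous.\<close>

fun et :: "'t list \<Rightarrow> 't list" where
  "et [] = []"
| "et (x # xs) = (tw G ^^ length xs) x # et xs"

lemma length_et [simp]: "length (et xs) = length xs"
  by (induction xs) simp_all

lemma et_append: "et (xs @ ys) = map (tw G ^^ length ys) (et xs) @ et ys"
  by (induction xs) (simp_all add: funpow_add add.commute[of "length _" "length ys"])

lemma tw_pow_grd: "x \<in> grd G n \<Longrightarrow> (tw G ^^ m) x \<in> grd G n"
  by (induction m) (simp_all add: tw_grd[OF G])

lemma tw_pow: "x \<in> grd G n \<Longrightarrow> (tw G ^^ m) x = sg (int m * n) x"
proof (induction m)
  case (Suc m)
  then show ?case
    using tw_homogeneous[OF G grd_sg[OF G, of x n "int m * n"]] by (simp add: sg_sg distrib_right)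
qed simp

lemma s_tw_pow: "x \<in> grd G n \<Longrightarrow> s ((tw G ^^ m) x) = sg (int (m + 1) * n + 1) x"
  using tw_pow[of x n "Suc m"] by (simp add: s_def) (simp add: sg_def)

lemma tw_pow_linear: "Vector_Spaces.linear (scl G) (scl G) (tw G ^^ m)"
proof (induction m)
  case 0
  then show ?case using graded_vector_space[OF G] by (auto intro!: linearI)
next
  case (Suc m)
  then show ?case using linear_compose[OF Suc tw_linear[OF G]] by (simp add: o_def)
qed

lemma et_homogeneous: "homogeneous_list G xs ns \<Longrightarrow> homogeneous_list G (et xs) ns"
  unfolding homogeneous_list_def by (induction rule: list_all2_induct) (simp_all add: tw_pow_grd)

lemma multilinear_et:
  assumes "\<And>us ws. Vector_Spaces.linear (scl G) (scl L) (\<lambda>x. f (us @ x # ws))"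
  shows "multilinear G L k (\<lambda>xs. f (et xs))"
proof -
  have "Vector_Spaces.linear (scl G) (scl L) (\<lambda>x. f (us @ (tw G ^^ m) x # ws))" for us m ws
    by (rule linear_compose[OF tw_pow_linear assms])
  then show ?thesis by (simp add: multilinear_def et_append)
qed

text \<open>
  A sign map applied to some of the arguments of a multilinear map comes out as a global sign.
\<close>

lemma multilinear_sign:
  assumes f: "\<And>us ws. Vector_Spaces.linear (scl G) (scl L) (\<lambda>x. f (us @ x # ws))"
    and \<phi>: "\<And>n x. x \<in> grd G n \<Longrightarrow> \<phi> x = sg (c * n + e) x"
    and ys: "homogeneous_list G ys ns"
  shows "f (us @ map \<phi> ys @ ws) = sg (c * sum_list ns + e * int (length ys)) (f (us @ ys @ ws))"
  using ys[unfolded homogeneous_list_def]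
proof (induction arbitrary: us rule: list_all2_induct)
  case (Cons y ys n ns)
  have "f (us @ map \<phi> (y # ys) @ ws) = sg (c * n + e) (f ((us @ [y]) @ map \<phi> ys @ ws))"
    using additive_sg[OF linearD(5)[OF f[of us "map \<phi> ys @ ws"]]] by (simp add: \<phi>[OF Cons(1)])
  also have "\<dots> = sg (c * n + e) (sg (c * sum_list ns + e * int (length ys)) (f ((us @ [y]) @ ys @ ws)))"
    by (simp only: Cons(3))
  finally show ?case by (simp add: sg_sg algebra_simps)
qed simp

text \<open>
  The operations \<open>\<beta>\<close>, \<open>\<gamma>\<close>, \<open>\<alpha>\<close> are \<open>b\<close>, \<open>g\<close>, \<open>a\<close> with the suspension undone, that is,
  precomposed with \<open>et\<close>.  The next two lemmas compare the signs.
\<close>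

lemma b_et:
  assumes xs: "homogeneous_list G xs ns"
  shows "b (et xs) = (\<Sum>l = 1..length xs - 1. let m = length xs - l in
    sg (int (l - 1) + int (m - 1) * sum_list (take l ns)) (g (et (take l xs)) * g (et (drop l xs))))"
proof -
  have "b (et xs) = (\<Sum>l = 1..<length xs. - (g (map s (take l (et xs))) * g (drop l (et xs))))"
    unfolding b_def by (subst cuts_inner) (simp_all add: sum_negf)
  also have "\<dots> = (\<Sum>l = 1..<length xs. let m = length xs - l in
    sg (int (l - 1) + int (m - 1) * sum_list (take l ns)) (g (et (take l xs)) * g (et (drop l xs))))"
  proof (intro sum.cong refl)
    fix l assume l: "l \<in> {1..<length xs}"
    define m where "m = length xs - l"
    define e where "e = et (take l xs)"
    have "et xs = map (tw G ^^ m) e @ et (drop l xs)"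
      using et_append[of "take l xs" "drop l xs"] by (simp add: m_def e_def)
    moreover have len: "length e = l" using l by (simp add: e_def)
    ultimately have td: "take l (et xs) = map (tw G ^^ m) e" "drop l (et xs) = et (drop l xs)"
      by simp_all
    have e: "homogeneous_list G e (take l ns)"
      using xs unfolding e_def by (intro et_homogeneous) (auto simp: homogeneous_list_def)
    have \<phi>: "s ((tw G ^^ m) x) = sg (int (m + 1) * n + 1) x" if "x \<in> grd G n" for n x
      using s_tw_pow[OF that] by blast
    have "g (map s (take l (et xs))) = sg (int (m + 1) * sum_list (take l ns) + int l) (g e)"
      using multilinear_sign[OF g_linear \<phi> e, of "[]" "[]"] by (simp add: td o_def len)
    moreover have "m \<ge> 1" "l \<ge> 1" using l by (auto simp: m_def)
    ultimately show "- (g (map s (take l (et xs))) * g (drop l (et xs))) = (let m = length xs - l in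
      sg (int (l - 1) + int (m - 1) * sum_list (take l ns)) (g (et (take l xs)) * g (et (drop l xs))))"
      by (auto simp: td Let_def m_def[symmetric] e_def[symmetric] sg_mult_left sg_def of_nat_diff)
  qed
  also have "{1..<length xs} = {1..length xs - 1}" by auto
  finally show ?thesis .
qed

lemma a_infinity_relation:
  assumes xs: "homogeneous_list G xs ns" and k: "length xs = k"
  shows "(\<Sum>i = 1..k. let j = k - i in sg (int (i * j))
    (\<Sum>l = 0..j. sg (int (l * (i + 1)) + int i * sum_list (take l ns))
      (a (et (take l xs @ [a (et (take i (drop l xs)))] @ drop (l + i) xs))))) = 0"
proof -
  have "(\<Sum>i = 1..k. let j = k - i in sg (int (i * j))
    (\<Sum>l = 0..j. sg (int (l * (i + 1)) + int i * sum_list (take l ns))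
      (a (et (take l xs @ [a (et (take i (drop l xs)))] @ drop (l + i) xs))))) =
    (\<Sum>i = 1..k. \<Sum>l = 0..k - i.
      a (map s (take l (et xs)) @ a (take i (drop l (et xs))) # drop (l + i) (et xs)))"
    unfolding Let_def sg_sum
  proof (intro sum.cong refl)
    fix i l assume i: "i \<in> {1..k}" and l: "l \<in> {0..k - i}"
    define us ms ws where "us = take l xs" and "ms = take i (drop l xs)" and "ws = drop (l + i) xs"
    define w where "w = k - i - l"
    have xs_eq: "xs = us @ ms @ ws"
      by (simp add: us_def ms_def ws_def add.commute flip: drop_drop)
    have len: "length us = l" "length ms = i" "length ws = w"
      using i l k by (auto simp: us_def ms_def ws_def w_def)
    define X Y where "X = sum_list (take l ns)" and "Y = sum_list (take i (drop l ns))"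
    have hom: "homogeneous_list G (et us) (take l ns)" "homogeneous_list G (et ms) (take i (drop l ns))"
      using xs unfolding us_def ms_def by (auto intro!: et_homogeneous) (auto simp: homogeneous_list_def)
    define y where "y = a (et ms)"
    define R where "R = a (et us @ [y] @ et ws)"
    have y: "y \<in> grd G (Y + 2 - int i)"
      using a_degree[OF hom(2)] by (simp add: y_def Y_def len)
    have et_xs: "et xs = map (tw G ^^ (w + i)) (et us) @ map (tw G ^^ w) (et ms) @ et ws"
      by (simp add: xs_eq et_append len add.commute)
    have parts: "take l (et xs) = map (tw G ^^ (w + i)) (et us)"
      "take i (drop l (et xs)) = map (tw G ^^ w) (et ms)" "drop (l + i) (et xs) = et ws"
      by (simp_all add: et_xs len)
    have \<phi>1: "(tw G ^^ m) x = sg (int m * n + 0) x" if "x \<in> grd G n" for m n x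
      using tw_pow[OF that] by simp
    have \<phi>2: "s ((tw G ^^ m) x) = sg (int (m + 1) * n + 1) x" if "x \<in> grd G n" for m n x
      using s_tw_pow[OF that] by blast
    have sgR: "a (vs @ sg n y # vs') = sg n (a (vs @ y # vs'))" for n vs vs'
      by (rule additive_sg[OF a_additive])
    \<comment> \<open>both terms are signed copies of \<open>R\<close>, and the parities of the exponents agree\<close>
    have 1: "a (map s (take l (et xs)) @ a (take i (drop l (et xs))) # drop (l + i) (et xs)) =
      sg (int (w + i + 1) * X + int l) (sg (int w * Y) R)"
      using multilinear_sign[OF a_linear \<phi>1 hom(2), of "[]" w "[]"]
        multilinear_sign[OF a_linear \<phi>2 hom(1), of "[]" "w + i" "y # et ws"]
      unfolding parts by (simp add: o_def len X_def Y_def R_def y_def[symmetric] sgR sg_sg add.commute)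
    have 2: "a (et (us @ [y] @ ws)) = sg (int (w + 1) * X) (sg (int w * (Y + 2 - int i)) R)"
      using multilinear_sign[OF a_linear \<phi>1 hom(1), of "[]" "w + 1" "(tw G ^^ w) y # et ws"]
      by (simp add: et_append len X_def R_def tw_pow[OF y] sgR o_def)
    have "k - i = l + w" using i l by (auto simp: w_def)
    then show "sg (int (i * (k - i))) (sg (int (l * (i + 1)) + int i * sum_list (take l ns))
        (a (et (take l xs @ [a (et (take i (drop l xs)))] @ drop (l + i) xs)))) =
      a (map s (take l (et xs)) @ a (take i (drop l (et xs))) # drop (l + i) (et xs))"
      unfolding 1 us_def[symmetric] ms_def[symmetric] ws_def[symmetric] y_def[symmetric] 2
        X_def[symmetric] sg_sg
      by (intro sg_cong) (auto simp: algebra_simps)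
  qed
  also have "\<dots> = coder a (et xs)"
    unfolding coder_def
    using cuts_cuts_reindex[of "\<lambda>u m w. a (map s u @ a m # w)" "et xs"]
    by (simp add: k additive.zero[OF a_additive])
  finally show ?thesis by (simp add: bar_relation)
qed

end

text \<open>
  Multilinear maps are determined by their values on homogeneous arguments, which is why the
  recursion determines the operations.
\<close>

lemma multilinear_determined:
  assumes G: "graded_space G"
    and f: "multilinear G H k f" and f': "multilinear G H k f'"
    and eq: "\<And>xs ns. length xs = k \<Longrightarrow> homogeneous_list G xs ns \<Longrightarrow> f xs = f' xs"
    and "length xs = k"
  shows "f xs = f' xs"
proof -
  have "f (us @ ws) = f' (us @ ws)" if "homogeneous_list G us ns" "length us + length ws = k" for us ns ws
    using that
  proof (induction ws arbitrary: us ns)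
    case (Cons w ws)
    have "additive (\<lambda>x. f (us @ x # ws))" "additive (\<lambda>x. f' (us @ x # ws))"
      using f f' Cons.prems(2) by (auto simp: multilinear_def intro!: linearD(5))
    then show ?case
    proof (rule additive_eqI[OF G])
      fix n x assume "x \<in> grd G n"
      then have "homogeneous_list G (us @ [x]) (ns @ [n])"
        using Cons.prems(1) by (simp add: homogeneous_list_def list_all2_appendI)
      from Cons.IH[OF this] show "f (us @ x # ws) = f' (us @ x # ws)" using Cons.prems(2) by simp
    qed
  qed (use eq in auto)
  from this[of "[]" "[]" xs] show ?thesis using assms(5) by (simp add: homogeneous_list_def)
qed

lemma transfer_ops_beta:
  assumes "transfer_ops G H p j h d \<alpha> \<beta> \<gamma>" "k \<ge> 2" "length xs = k" "homogeneous_list G xs ns"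
  shows "\<beta> xs = (\<Sum>l = 1..k - 1. let m = k - l in
    sg (int (l - 1) + int (m - 1) * sum_list (take l ns)) (\<gamma> (take l xs) * \<gamma> (drop l xs)))"
  using assms unfolding transfer_ops_def by blast

lemma transfer_ops_unique:
  assumes G: "graded_space G"
    and t: "transfer_ops G H p j h d \<alpha> \<beta> \<gamma>" and t': "transfer_ops G H p j h d \<alpha>' \<beta>' \<gamma>'"
    and "xs \<noteq> []"
  shows "\<alpha>' xs = \<alpha> xs"
proof -
  have *: "\<gamma>' xs = \<gamma> xs \<and> \<alpha>' xs = \<alpha> xs" if "xs \<noteq> []" for xs
    using that
  proof (induction "length xs" arbitrary: xs rule: less_induct)
    case less
    show ?case
    proof (cases "length xs \<ge> 2")
      case False
      then obtain x where "xs = [x]" using less.prems by (cases xs; cases "tl xs") auto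
      then show ?thesis using t t' by (simp add: transfer_ops_def)
    next
      case True
      have "\<beta>' xs = \<beta> xs"
      proof (rule multilinear_determined[OF G, where f = \<beta>' and f' = \<beta> and k = "length xs"])
        show "multilinear G H (length xs) \<beta>'" "multilinear G H (length xs) \<beta>"
          using t t' True by (simp_all add: transfer_ops_def)
        fix ys ns assume ys: "length ys = length xs" "homogeneous_list G ys ns"
        have "\<gamma>' (take l ys) = \<gamma> (take l ys)" "\<gamma>' (drop l ys) = \<gamma> (drop l ys)"
          if "l \<in> {1..length xs - 1}" for l
        proof -
          have "length (take l ys) < length xs" "length (drop l ys) < length xs"
            "take l ys \<noteq> []" "drop l ys \<noteq> []"
            using that ys(1) True by auto
          then show "\<gamma>' (take l ys) = \<gamma> (take l ys)" "\<gamma>' (drop l ys) = \<gamma> (drop l ys)"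
            using less.hyps by blast+
        qed
        then have "(\<Sum>l = 1..length xs - 1. let m = length xs - l in
            sg (int (l - 1) + int (m - 1) * sum_list (take l ns)) (\<gamma>' (take l ys) * \<gamma>' (drop l ys))) =
          (\<Sum>l = 1..length xs - 1. let m = length xs - l in
            sg (int (l - 1) + int (m - 1) * sum_list (take l ns)) (\<gamma> (take l ys) * \<gamma> (drop l ys)))"
          by (intro sum.cong refl) simp
        then show "\<beta>' ys = \<beta> ys"
          using transfer_ops_beta[OF t True ys] transfer_ops_beta[OF t' True ys] by simp
      qed simp
      then show ?thesis using t t' True by (simp add: transfer_ops_def)
    qed
  qed
  then show ?thesis using assms(4) by blast
qed

text \<open>
  An associative product on the total space of a contraction is transferred to the
  $A_\infty$-structure given by the recursion.
\<close>

theorem transfer_theorem: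
  fixes G :: "('k::field, 't::ab_group_add) gspace" and H :: "('k, 'u::ring) gspace"
  assumes "contraction (with_dif H \<delta>) (with_dif G d) p j h"
    and "graded_bilinear H H H (*)" and "graded_derivation H 1 \<delta>"
  shows "\<exists>\<alpha> \<beta> \<gamma>. transfer_ops G H p j h d \<alpha> \<beta> \<gamma> \<and> A_infinity_algebra G \<alpha> \<and>
    (\<forall>\<alpha>' \<beta>' \<gamma>'. transfer_ops G H p j h d \<alpha>' \<beta>' \<gamma>' \<longrightarrow> (\<forall>xs. xs \<noteq> [] \<longrightarrow> \<alpha>' xs = \<alpha> xs))"
proof -
  interpret dg_contraction G H p j h d \<delta> using assms by unfold_locales
  let ?\<alpha> = "\<lambda>xs. a (et xs)" and ?\<beta> = "\<lambda>xs. b (et xs)" and ?\<gamma> = "\<lambda>xs. g (et xs)"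
  have ops: "transfer_ops G H p j h d ?\<alpha> ?\<beta> ?\<gamma>"
    unfolding transfer_ops_def
  proof (intro conjI allI impI)
    fix xs :: "'t list" assume "length xs \<ge> 2"
    then show "a (et xs) = p (b (et xs))" "g (et xs) = h (b (et xs))" by (simp_all add: a_def g_long)
  next
    fix k :: nat and xs ns assume "length xs = k \<and> homogeneous_list G xs ns"
    then show "b (et xs) = (\<Sum>l = 1..k - 1. let m = k - l in
        sg (int (l - 1) + int (m - 1) * sum_list (take l ns)) (g (et (take l xs)) * g (et (drop l xs))))"
      using b_et[of xs ns] by auto
  qed (simp_all add: a_def g_single multilinear_et[OF b_linear])
  moreover have "A_infinity_algebra G ?\<alpha>"
    unfolding A_infinity_algebra_def
  proof (intro conjI allI impI)
    show "graded_space G" by (rule G)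
    show "multilinear G G k ?\<alpha>" for k by (rule multilinear_et[OF a_linear])
    show "a (et xs) \<in> grd G (sum_list ns + 2 - int (length xs))" if "xs \<noteq> [] \<and> homogeneous_list G xs ns" for xs ns
      using a_degree[OF et_homogeneous[OF conjunct2[OF that]]] by simp
  qed (use a_infinity_relation in blast)
  ultimately show ?thesis using transfer_ops_unique[OF G ops] by blast
qed


section \<open>Homomorphisms from free algebras\<close>

lemma poly_mapping_sum_single: "f = (\<Sum>k\<in>Poly_Mapping.keys f. Poly_Mapping.single k (Poly_Mapping.lookup f k))"
proof (rule poly_mapping_eqI)
  fix k
  have "Poly_Mapping.lookup (\<Sum>k\<in>Poly_Mapping.keys f. Poly_Mapping.single k (Poly_Mapping.lookup f k)) k
      = (\<Sum>i\<in>Poly_Mapping.keys f. if i = k then Poly_Mapping.lookup f i else 0)"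
    by (simp add: lookup_sum lookup_single when_def)
  then show "Poly_Mapping.lookup f k =
      Poly_Mapping.lookup (\<Sum>k\<in>Poly_Mapping.keys f. Poly_Mapping.single k (Poly_Mapping.lookup f k)) k"
    by (simp add: sum.delta in_keys_iff)
qed

lemma poly_mapping_additive_induct [case_names single add]:
  assumes single: "\<And>k c. P (Poly_Mapping.single k c)" and add: "\<And>f g. P f \<Longrightarrow> P g \<Longrightarrow> P (f + g)"
  shows "P (f :: 'x \<Rightarrow>\<^sub>0 'y::comm_monoid_add)"
proof -
  have "P (\<Sum>k\<in>K. Poly_Mapping.single k (Poly_Mapping.lookup f k))" if "finite K" for K
    using that by (induction K) (use single[of undefined 0] single add in auto)
  then show ?thesis using poly_mapping_sum_single[of f] finite_keys by metis
qed

text \<open>The additive map that is \<open>L k\<close> on the coefficients at \<open>k\<close>.\<close>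

definition psum :: "('x \<Rightarrow> 'y \<Rightarrow> 'z) \<Rightarrow> ('x \<Rightarrow>\<^sub>0 'y::zero) \<Rightarrow> 'z::comm_monoid_add" where
  "psum L f = (\<Sum>k\<in>Poly_Mapping.keys f. L k (Poly_Mapping.lookup f k))"

context
  fixes L :: "'x \<Rightarrow> 'y::ab_group_add \<Rightarrow> 'z::ab_group_add"
  assumes L: "\<And>k. additive (L k)"
begin

lemma psum_superset:
  "finite K \<Longrightarrow> Poly_Mapping.keys f \<subseteq> K \<Longrightarrow> psum L f = (\<Sum>k\<in>K. L k (Poly_Mapping.lookup f k))"
  unfolding psum_def by (rule sum.mono_neutral_left) (auto simp: in_keys_iff additive.zero[OF L])

lemma psum_single: "psum L (Poly_Mapping.single k c) = L k c"
  by (subst psum_superset[where K = "{k}"]) auto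

lemma psum_add: "psum L (f + g) = psum L f + psum L g"
proof -
  let ?K = "Poly_Mapping.keys f \<union> Poly_Mapping.keys g"
  have "Poly_Mapping.keys (f + g) \<subseteq> ?K" by (rule keys_add)
  then show ?thesis
    by (subst (1 2 3) psum_superset[where K = ?K]) (auto simp: lookup_add additive.add[OF L] sum.distrib)
qed

end

lemma psum_mult:
  fixes L :: "'x::monoid_add \<Rightarrow> 'y::ring \<Rightarrow> 'z::ring"
  assumes L: "\<And>k. additive (L k)" and mult: "\<And>k l c d. L (k + l) (c * d) = L k c * L l d"
  shows "psum L (f * g) = psum L f * psum L g"
proof (induction f rule: poly_mapping_additive_induct)
  case (single k c)
  show ?case
    by (induction g rule: poly_mapping_additive_induct)
       (simp_all add: mult_single psum_single[OF L] mult psum_add[OF L] distrib_left)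
qed (simp add: distrib_right psum_add[OF L])

lemma lookup_single_mult:
  fixes f :: "int \<Rightarrow>\<^sub>0 'b::ring"
  shows "Poly_Mapping.lookup (Poly_Mapping.single m u * f) k = u * Poly_Mapping.lookup f (k - m)"
  by (induction f rule: poly_mapping_additive_induct)
     (auto simp: mult_single lookup_single when_def distrib_left lookup_add)

text \<open>
  The structure map of a unital algebra over a field; the unit is \<open>\<kappa> 1\<close>.
\<close>

locale unital_algebra =
  fixes \<kappa> :: "'k::field \<Rightarrow> 'b::ring"
  assumes scalar_add: "\<kappa> (c + d) = \<kappa> c + \<kappa> d"
    and scalar_mult: "\<kappa> (c * d) = \<kappa> c * \<kappa> d"
    and scalar_one: "\<kappa> 1 * x = x"
    and scalar_central: "\<kappa> c * x = x * \<kappa> c"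
begin

lemma scalar_one_right: "x * \<kappa> 1 = x"
  by (metis scalar_one scalar_central)

lemma scalar_mult_right: "x * (\<kappa> c * y) = \<kappa> c * (x * y)"
  by (metis scalar_central mult.assoc)

lemma scalar_vector_space: "vector_space (\<lambda>c x. \<kappa> c * x)"
  by standard (simp_all add: distrib_left distrib_right scalar_add scalar_mult scalar_one mult.assoc)

end

text \<open>The product of the values \<open>\<phi>\<close> of the letters of a word.\<close>

definition word_lift :: "('k::field \<Rightarrow> 'b::ring) \<Rightarrow> ('v \<Rightarrow> 'b) \<Rightarrow> 'v list \<Rightarrow> 'b" where
  "word_lift \<kappa> \<phi> ws = foldr (\<lambda>v x. \<phi> v * x) ws (\<kappa> 1)"

text \<open>The homomorphism from the free algebra given by the values \<open>\<phi>\<close> on the generators.\<close>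

definition free_lift :: "('k::field \<Rightarrow> 'b::ring) \<Rightarrow> ('v \<Rightarrow> 'b) \<Rightarrow> ('k, 'v) free_alg \<Rightarrow> 'b" where
  "free_lift \<kappa> \<phi> = psum (\<lambda>w c. \<kappa> c * word_lift \<kappa> \<phi> (letters w))"

context unital_algebra
begin

lemma word_lift_append: "word_lift \<kappa> \<phi> (v @ w) = word_lift \<kappa> \<phi> v * word_lift \<kappa> \<phi> w"
  by (induction v) (simp_all add: word_lift_def scalar_one mult.assoc)

lemma free_lift_coeff_additive: "additive (\<lambda>c. \<kappa> c * word_lift \<kappa> \<phi> (letters w))"
  by (simp add: additive_def scalar_add distrib_right)

lemma free_lift_add: "free_lift \<kappa> \<phi> (f + g) = free_lift \<kappa> \<phi> f + free_lift \<kappa> \<phi> g"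
  unfolding free_lift_def by (rule psum_add[OF free_lift_coeff_additive])

lemma free_lift_mult: "free_lift \<kappa> \<phi> (f * g) = free_lift \<kappa> \<phi> f * free_lift \<kappa> \<phi> g"
  unfolding free_lift_def
  by (rule psum_mult[OF free_lift_coeff_additive])
     (use scalar_mult_right[of "word_lift \<kappa> \<phi> (letters _)"] in
       \<open>simp add: plus_word_def word_lift_append scalar_mult mult.assoc\<close>)

lemma free_lift_generator: "free_lift \<kappa> \<phi> (monom [v]) = \<phi> v"
  unfolding free_lift_def monom_def psum_single[OF free_lift_coeff_additive]
  by (simp add: word_lift_def scalar_one scalar_one_right)

lemma free_lift_cnst: "free_lift \<kappa> \<phi> (cnst c) = \<kappa> c"
  unfolding free_lift_def cnst_def psum_single[OF free_lift_coeff_additive]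
  by (simp add: word_lift_def zero_word_def scalar_one_right)

lemma free_lift_additive: "additive (free_lift \<kappa> \<phi>)"
  by standard (rule free_lift_add)

end


section \<open>The algebras generated by a graded algebra and a module\<close>

text \<open>
  The symmetric and the enveloping algebra are the instances of one construction, with the graded
  commutators of elements of \<open>M\<close> with elements of \<open>A\<close> and of \<open>M\<close> prescribed by \<open>act\<close> and \<open>lbr\<close>.
  For the symmetric algebra both are zero.
\<close>

definition comm_rels ::
  "('k::field, 'a::ring) dg_alg \<Rightarrow> ('k, 'a, 'm::ab_group_add, 'z) dg_mod_scheme
     \<Rightarrow> ('m \<Rightarrow> 'a \<Rightarrow> 'a) \<Rightarrow> ('m \<Rightarrow> 'm \<Rightarrow> 'm) \<Rightarrow> ('k, 'a \<times> 'm) free_alg set" where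
  "comm_rels A M act lbr =
     {gM q * gA a - sg (m * n) (gA a * gM q) - gA (act q a)
        | m n a q. a \<in> grd A m \<and> q \<in> grd M n} \<union>
     {gM q * gM r - sg (m * n) (gM r * gM q) - gM (lbr q r)
        | m n q r. q \<in> grd M m \<and> r \<in> grd M n}"

text \<open>
  The maps \<open>act\<close> and \<open>lbr\<close> need to respect the degrees only; they need not be a Lie action and
  bracket, so that the quotient may be smaller than expected.
\<close>

locale quot_alg =
  fixes A :: "('k::field, 'a::ring) dg_alg"
    and M :: "('k, 'a, 'm::ab_group_add, 'z) dg_mod_scheme"
    and act :: "'m \<Rightarrow> 'a \<Rightarrow> 'a" and lbr :: "'m \<Rightarrow> 'm \<Rightarrow> 'm"
    and \<pi> :: "('k, 'a \<times> 'm) free_alg \<Rightarrow> 'u::ring"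
  assumes A: "graded_comm_dga A" and M: "dg_module A M"
    and act_degree: "a \<in> grd A m \<Longrightarrow> q \<in> grd M n \<Longrightarrow> act q a \<in> grd A (m + n)"
    and lbr_degree: "q \<in> grd M m \<Longrightarrow> r \<in> grd M n \<Longrightarrow> lbr q r \<in> grd M (m + n)"
    and quot: "quotient_by
      (two_sided_ideal hull (tensor_rels A M \<union> module_rels A M \<union> comm_rels A M act lbr)) \<pi>"
begin

abbreviation "rels \<equiv> tensor_rels A M \<union> module_rels A M \<union> comm_rels A M act lbr"
abbreviation "U \<equiv> quot_space A M \<pi>"
abbreviation "\<kappa> c \<equiv> \<pi> (cnst c)"

lemma grA: "graded_space A" and grM: "graded_space M"
  and unt_degree: "unt A \<in> grd A 0" and unt_mult: "unt A * a = a" "a * unt A = a"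
  and mulA: "graded_bilinear A A A (*)" and mulM: "graded_bilinear A M M (smul M)"
  using A M unfolding graded_comm_dga_def dg_module_def cochain_complex_def by blast+

lemma mult_degree_A: "a \<in> grd A m \<Longrightarrow> b \<in> grd A n \<Longrightarrow> a * b \<in> grd A (m + n)"
  and smul_degree: "a \<in> grd A m \<Longrightarrow> q \<in> grd M n \<Longrightarrow> smul M a q \<in> grd M (m + n)"
  and smul_additive: "additive (smul M a)" "additive (\<lambda>a. smul M a q)"
  using mulA mulM by (auto simp: graded_bilinear_def Vector_Spaces.linear_iff additive_def)

lemma proj_add: "\<pi> (x + y) = \<pi> x + \<pi> y" and proj_mult: "\<pi> (x * y) = \<pi> x * \<pi> y"
  and proj_surj: "\<exists>x. \<pi> x = u"
  and proj_kernel: "\<pi> x = 0 \<longleftrightarrow> x \<in> two_sided_ideal hull rels"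
proof -
  show "\<pi> (x + y) = \<pi> x + \<pi> y" "\<pi> (x * y) = \<pi> x * \<pi> y"
    using quot by (simp_all add: quotient_by_def)
  show "\<exists>x. \<pi> x = u" using quot unfolding quotient_by_def by (metis surj_def)
  show "\<pi> x = 0 \<longleftrightarrow> x \<in> two_sided_ideal hull rels"
    using quot unfolding quotient_by_def by blast
qed

lemma proj_additive: "additive \<pi>"
  by standard (rule proj_add)

lemmas proj_zero [simp] = additive.zero[OF proj_additive]
  and proj_diff = additive.diff[OF proj_additive]
  and proj_sum = additive.sum[OF proj_additive]
  and proj_sg = additive_sg[OF proj_additive]

lemma proj_rel: "r \<in> rels \<Longrightarrow> \<pi> r = 0"
  by (simp add: proj_kernel hull_inc)

lemma cnst_central: "cnst c * f = f * (cnst c :: ('k, 'a \<times> 'm) free_alg)"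
  by (induction f rule: poly_mapping_additive_induct)
     (simp_all add: cnst_def mult_single mult.commute distrib_left distrib_right)

sublocale unital_algebra \<kappa>
proof
  fix c d :: 'k and x
  show "\<kappa> (c + d) = \<kappa> c + \<kappa> d" by (simp add: cnst_def single_add proj_add)
  show "\<kappa> (c * d) = \<kappa> c * \<kappa> d" by (simp add: cnst_def mult_single flip: proj_mult)
  obtain f where f: "x = \<pi> f" using proj_surj by metis
  show "\<kappa> c * x = x * \<kappa> c" by (simp add: f cnst_central flip: proj_mult)
  show "\<kappa> 1 * x = x" by (simp add: f cnst_def flip: proj_mult)
qed

lemma one_scalar: "\<pi> 1 = \<kappa> 1"
  by (simp add: cnst_def)

lemma letter_add: "\<pi> (monom [(a + b, q + r)]) = \<pi> (monom [(a, q)]) + \<pi> (monom [(b, r)])"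
proof -
  have "monom [(a + b, q + r)] - monom [(a, q)] - monom [(b, r)] \<in> rels"
    unfolding tensor_rels_def by blast
  from proj_rel[OF this] show ?thesis by (simp add: proj_diff diff_eq_eq add.commute)
qed

lemma letter_scl: "\<pi> (monom [(scl A c a, scl M c q)]) = \<kappa> c * \<pi> (monom [(a, q)])"
proof -
  have "monom [(scl A c a, scl M c q)] - cnst c * monom [(a, q)] \<in> rels"
    unfolding tensor_rels_def by blast
  from proj_rel[OF this] show ?thesis by (simp add: proj_diff proj_mult)
qed

lemma letter: "\<pi> (monom [(a, q)]) = inA \<pi> a + inM \<pi> q"
  using letter_add[of a 0 0 q] by (simp add: inA_def inM_def gA_def gM_def)

lemma inA_add: "inA \<pi> (a + b) = inA \<pi> a + inA \<pi> b"
  and inM_add: "inM \<pi> (q + r) = inM \<pi> q + inM \<pi> r"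
  using letter_add[of a b 0 0] letter_add[of 0 0 q r] by (simp_all add: inA_def inM_def gA_def gM_def)

lemma inA_additive: "additive (inA \<pi>)" and inM_additive: "additive (inM \<pi>)"
  by (simp_all add: additive_def inA_add inM_add)

lemmas inA_zero [simp] = additive.zero[OF inA_additive]
  and inM_zero [simp] = additive.zero[OF inM_additive]
  and inA_minus = additive.minus[OF inA_additive]
  and inM_minus = additive.minus[OF inM_additive]
  and inA_diff = additive.diff[OF inA_additive]
  and inM_diff = additive.diff[OF inM_additive]
  and inA_sg = additive_sg[OF inA_additive]
  and inM_sg = additive_sg[OF inM_additive]

lemma inA_scl: "inA \<pi> (scl A c a) = \<kappa> c * inA \<pi> a"
  and inM_scl: "inM \<pi> (scl M c q) = \<kappa> c * inM \<pi> q"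
proof -
  have z: "scl A c 0 = 0" "scl M c 0 = 0"
    using graded_vector_space[OF grA] graded_vector_space[OF grM]
    by (simp_all add: module.scale_zero_right flip: module_iff_vector_space)
  show "inA \<pi> (scl A c a) = \<kappa> c * inA \<pi> a" "inM \<pi> (scl M c q) = \<kappa> c * inM \<pi> q"
    using letter_scl[of c a 0] letter_scl[of c 0 q] by (simp_all add: inA_def inM_def gA_def gM_def z)
qed

lemma inA_unt: "inA \<pi> (unt A) = \<kappa> 1"
  and inA_mult: "inA \<pi> (a * b) = inA \<pi> a * inA \<pi> b"
  and inM_smul: "inM \<pi> (smul M a q) = inA \<pi> a * inM \<pi> q"
proof -
  have "gA (unt A) - 1 \<in> rels" "gA a * gA b - gA (a * b) \<in> rels" "gA a * gM q - gM (smul M a q) \<in> rels"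
    by (auto simp: module_rels_def)
  from this[THEN proj_rel] show "inA \<pi> (unt A) = \<kappa> 1" "inA \<pi> (a * b) = inA \<pi> a * inA \<pi> b"
    "inM \<pi> (smul M a q) = inA \<pi> a * inM \<pi> q"
    by (simp_all add: proj_diff proj_mult inA_def inM_def one_scalar)
qed

lemma scalar_inA: "\<kappa> c = inA \<pi> (scl A c (unt A))"
  by (simp add: inA_scl inA_unt scalar_one_right)

lemma comm_A: "a \<in> grd A m \<Longrightarrow> q \<in> grd M n \<Longrightarrow>
    inM \<pi> q * inA \<pi> a = sg (m * n) (inA \<pi> a * inM \<pi> q) + inA \<pi> (act q a)"
  and comm_M: "q \<in> grd M m \<Longrightarrow> r \<in> grd M n \<Longrightarrow>
    inM \<pi> q * inM \<pi> r = sg (m * n) (inM \<pi> r * inM \<pi> q) + inM \<pi> (lbr q r)"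
proof -
  show "inM \<pi> q * inA \<pi> a = sg (m * n) (inA \<pi> a * inM \<pi> q) + inA \<pi> (act q a)"
    if "a \<in> grd A m" "q \<in> grd M n"
  proof -
    have "gM q * gA a - sg (m * n) (gA a * gM q) - gA (act q a) \<in> rels"
      using that by (auto simp: comm_rels_def)
    from proj_rel[OF this] show ?thesis
      by (simp add: proj_diff proj_mult inA_def inM_def proj_sg diff_eq_eq add.commute)
  qed
  show "inM \<pi> q * inM \<pi> r = sg (m * n) (inM \<pi> r * inM \<pi> q) + inM \<pi> (lbr q r)"
    if "q \<in> grd M m" "r \<in> grd M n"
  proof -
    have "gM q * gM r - sg (m * n) (gM r * gM q) - gM (lbr q r) \<in> rels"
      using that by (auto simp: comm_rels_def)
    from proj_rel[OF this] show ?thesis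
      by (simp add: proj_diff proj_mult inA_def inM_def proj_sg diff_eq_eq add.commute)
  qed
qed

lemma prods_Nil: "prods \<pi> [] = \<kappa> 1"
  and prods_Cons: "prods \<pi> (q # qs) = inM \<pi> q * prods \<pi> qs"
proof -
  show "prods \<pi> [] = \<kappa> 1" by (simp add: prods_def monom_def cnst_def zero_word_def)
  have "monom ((0, q) # vs) = gM q * (monom vs :: ('k, 'a \<times> 'm) free_alg)" for vs
    by (simp add: monom_def gM_def mult_single plus_word_def)
  then show "prods \<pi> (q # qs) = inM \<pi> q * prods \<pi> qs"
    by (simp add: prods_def inM_def proj_mult)
qed


text \<open>
  The universal property: a pair of maps on \<open>A\<close> and \<open>M\<close> that respects the relations extends to a
  homomorphism.
\<close>

lemma lift_exists:
  fixes \<kappa>' :: "'k \<Rightarrow> 'b::ring"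
  assumes "unital_algebra \<kappa>'"
    and fA: "additive fA" "\<And>c a. fA (scl A c a) = \<kappa>' c * fA a" "\<And>a b. fA (a * b) = fA a * fA b"
      "fA (unt A) = \<kappa>' 1"
    and fM: "additive fM" "\<And>c q. fM (scl M c q) = \<kappa>' c * fM q" "\<And>a q. fM (smul M a q) = fA a * fM q"
    and cA: "\<And>a q m n. a \<in> grd A m \<Longrightarrow> q \<in> grd M n \<Longrightarrow>
      fM q * fA a = sg (m * n) (fA a * fM q) + fA (act q a)"
    and cM: "\<And>q r m n. q \<in> grd M m \<Longrightarrow> r \<in> grd M n \<Longrightarrow>
      fM q * fM r = sg (m * n) (fM r * fM q) + fM (lbr q r)"
  shows "\<exists>F. (\<forall>x y. F (x + y) = F x + F y) \<and> (\<forall>x y. F (x * y) = F x * F y) \<and>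
    (\<forall>c. F (\<kappa> c) = \<kappa>' c) \<and> (\<forall>a. F (inA \<pi> a) = fA a) \<and> (\<forall>q. F (inM \<pi> q) = fM q)"
proof -
  interpret B: unital_algebra \<kappa>' by fact
  define L where "L = free_lift \<kappa>' (\<lambda>(a, q). fA a + fM q)"
  note L_add = B.free_lift_add[of "\<lambda>(a, q). fA a + fM q", folded L_def]
    and L_mult = B.free_lift_mult[of "\<lambda>(a, q). fA a + fM q", folded L_def]
    and L_letter = B.free_lift_generator[of "\<lambda>(a, q). fA a + fM q", folded L_def]
    and L_cnst = B.free_lift_cnst[of "\<lambda>(a, q). fA a + fM q", folded L_def]
    and L_additive = B.free_lift_additive[of "\<lambda>(a, q). fA a + fM q", folded L_def]
  note L_diff = additive.diff[OF L_additive] and L_zero = additive.zero[OF L_additive]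
  have L_gA: "L (gA a) = fA a" and L_gM: "L (gM q) = fM q" for a q
    by (simp_all add: gA_def gM_def L_letter additive.zero[OF fA(1)] additive.zero[OF fM(1)])
  have L_one: "L 1 = \<kappa>' 1" using L_cnst[of 1] by (simp add: cnst_def)
  have "two_sided_ideal {f. L f = 0}"
    by (simp add: two_sided_ideal_def L_zero L_diff L_mult)
  moreover have "rels \<subseteq> {f. L f = 0}"
  proof -
    note simps = L_diff L_mult L_letter L_cnst L_gA L_gM L_one additive_sg[OF L_additive]
    have "tensor_rels A M \<subseteq> {f. L f = 0}"
      by (auto simp: tensor_rels_def simps fA(2) fM(2) additive.add[OF fA(1)] additive.add[OF fM(1)]
          distrib_left)
    moreover have "module_rels A M \<subseteq> {f. L f = 0}"
      by (auto simp: module_rels_def simps fA(3,4) fM(3))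
    moreover have "comm_rels A M act lbr \<subseteq> {f. L f = 0}"
    proof -
      have "L (gM q * gA a - sg (m * n) (gA a * gM q) - gA (act q a)) = 0"
        if "a \<in> grd A m" "q \<in> grd M n" for a q m n
        using cA[OF that] by (simp add: simps)
      moreover have "L (gM q * gM r - sg (m * n) (gM r * gM q) - gM (lbr q r)) = 0"
        if "q \<in> grd M m" "r \<in> grd M n" for q r m n
        using cM[OF that] by (simp add: simps)
      ultimately show ?thesis by (auto simp: comm_rels_def)
    qed
    ultimately show ?thesis by blast
  qed
  ultimately have "two_sided_ideal hull rels \<subseteq> {f. L f = 0}" by (metis hull_minimal)
  then have ker: "L f = 0" if "\<pi> f = 0" for f using that proj_kernel by auto
  define F where "F u = L (SOME f. \<pi> f = u)" for u
  have F: "F (\<pi> f) = L f" for f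
  proof -
    have "\<pi> (SOME f'. \<pi> f' = \<pi> f) = \<pi> f" by (rule someI) simp
    then have "L ((SOME f'. \<pi> f' = \<pi> f) - f) = 0" by (intro ker) (simp add: proj_diff)
    then show ?thesis by (simp add: F_def L_diff)
  qed
  have "F (x + y) = F x + F y" "F (x * y) = F x * F y" for x y
  proof -
    obtain f g where "x = \<pi> f" "y = \<pi> g" using proj_surj by metis
    then show "F (x + y) = F x + F y" "F (x * y) = F x * F y"
      by (simp_all add: F L_add L_mult flip: proj_add proj_mult)
  qed
  then show ?thesis by (intro exI[of _ F]) (simp add: inA_def inM_def F L_gA L_gM L_cnst)
qed

text \<open>
  Left multiplication by homogeneous generators reaches everything; the scalars are in the image of \<open>A\<close>.
\<close>

lemma quot_induct [case_names add one inA inM]: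
  assumes add: "\<And>x y. P x \<Longrightarrow> P y \<Longrightarrow> P (x + y)" and one: "P (\<kappa> 1)"
    and A: "\<And>a m x. a \<in> grd A m \<Longrightarrow> P x \<Longrightarrow> P (inA \<pi> a * x)"
    and M: "\<And>q m x. q \<in> grd M m \<Longrightarrow> P x \<Longrightarrow> P (inM \<pi> q * x)"
  shows "P u"
proof -
  have A': "P (inA \<pi> a * x)" if "P x" for a x
    by (induction a rule: graded_induct[OF grA]) (use A add that in \<open>auto simp: inA_add distrib_right\<close>)
  have M': "P (inM \<pi> q * x)" if "P x" for q x
    by (induction q rule: graded_induct[OF grM]) (use M add that in \<open>auto simp: inM_add distrib_right\<close>)
  obtain f where "u = \<pi> f" using proj_surj by metis
  moreover have "P (\<pi> f)"
  proof (induction f rule: poly_mapping_additive_induct)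
    case (single w c)
    obtain vs where w: "w = Word vs" by (cases w)
    have "P (\<pi> (monom vs))"
    proof (induction vs)
      case Nil
      then show ?case using one by (simp add: monom_def cnst_def zero_word_def)
    next
      case (Cons v vs)
      obtain a q where v: "v = (a, q)" by (cases v)
      have "monom (v # vs) = monom [v] * (monom vs :: ('k, 'a \<times> 'm) free_alg)"
        by (simp add: monom_def mult_single plus_word_def)
      then have "\<pi> (monom (v # vs)) = inA \<pi> a * \<pi> (monom vs) + inM \<pi> q * \<pi> (monom vs)"
        by (simp add: proj_mult v letter distrib_right)
      then show ?case using Cons A' M' add by simp
    qed
    moreover have "Poly_Mapping.single w c = cnst c * (monom vs :: ('k, 'a \<times> 'm) free_alg)"
      by (simp add: w cnst_def monom_def mult_single)
    ultimately show ?case using A' by (simp add: proj_mult scalar_inA)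
  qed (simp add: proj_add add)
  ultimately show ?thesis by simp
qed

lemma quot_hom_eqI:
  assumes "additive F" "additive F'" "F (\<kappa> 1) = F' (\<kappa> 1)"
    and "\<And>a m x. a \<in> grd A m \<Longrightarrow> F x = F' x \<Longrightarrow> F (inA \<pi> a * x) = F' (inA \<pi> a * x)"
    and "\<And>q m x. q \<in> grd M m \<Longrightarrow> F x = F' x \<Longrightarrow> F (inM \<pi> q * x) = F' (inM \<pi> q * x)"
  shows "F u = F' u"
  by (induction u rule: quot_induct) (use assms in \<open>auto simp: additive.add\<close>)

lemma scl_quot [simp]: "scl U c u = \<kappa> c * u"
  by (simp add: quot_space_def)

lemma grd_quot_iff:
  "u \<in> grd U n \<longleftrightarrow> (\<exists>f. u = \<pi> f \<and> (\<forall>w\<in>Poly_Mapping.keys f. homogeneous_word A M n w))"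
  by (auto simp: quot_space_def)

lemma grd_quotI: "(\<And>w. w \<in> Poly_Mapping.keys f \<Longrightarrow> homogeneous_word A M n w) \<Longrightarrow> \<pi> f \<in> grd U n"
  unfolding grd_quot_iff by blast

lemma grd_quot_zero: "0 \<in> grd U n"
  using grd_quotI[of 0 n] by simp

lemma grd_quot_add:
  assumes "x \<in> grd U n" "y \<in> grd U n" shows "x + y \<in> grd U n"
proof -
  obtain f where f: "x = \<pi> f" "\<forall>w\<in>Poly_Mapping.keys f. homogeneous_word A M n w"
    using assms(1) unfolding grd_quot_iff by blast
  obtain g where g: "y = \<pi> g" "\<forall>w\<in>Poly_Mapping.keys g. homogeneous_word A M n w"
    using assms(2) unfolding grd_quot_iff by blast
  show ?thesis unfolding f(1) g(1) proj_add[symmetric] using f(2) g(2) keys_add[of f g] by (intro grd_quotI) auto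
qed

lemma grd_quot_mult:
  assumes "x \<in> grd U m" "y \<in> grd U n" shows "x * y \<in> grd U (m + n)"
proof -
  obtain f where f: "x = \<pi> f" "\<forall>w\<in>Poly_Mapping.keys f. homogeneous_word A M m w"
    using assms(1) unfolding grd_quot_iff by blast
  obtain g where g: "y = \<pi> g" "\<forall>w\<in>Poly_Mapping.keys g. homogeneous_word A M n w"
    using assms(2) unfolding grd_quot_iff by blast
  have "homogeneous_word A M (m + n) (v + w)" if "homogeneous_word A M m v" "homogeneous_word A M n w" for v w
  proof -
    obtain ns ns' where "list_all2 (\<lambda>v i. v \<in> grd A i \<times> grd M i) (letters v) ns" "sum_list ns = m"
      "list_all2 (\<lambda>v i. v \<in> grd A i \<times> grd M i) (letters w) ns'" "sum_list ns' = n"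
      using \<open>homogeneous_word A M m v\<close> \<open>homogeneous_word A M n w\<close> unfolding homogeneous_word_def by blast
    then show ?thesis
      unfolding homogeneous_word_def plus_word_def word.sel
      by (intro exI[of _ "ns @ ns'"] conjI list_all2_appendI) simp_all
  qed
  then show ?thesis unfolding f(1) g(1) proj_mult[symmetric]
    using f(2) g(2) keys_mult[of f g] by (intro grd_quotI) blast
qed

lemma inA_degree: "a \<in> grd A m \<Longrightarrow> inA \<pi> a \<in> grd U m"
  and inM_degree: "q \<in> grd M m \<Longrightarrow> inM \<pi> q \<in> grd U m"
  and scalar_degree: "\<kappa> c \<in> grd U 0"
proof -
  show "inA \<pi> a \<in> grd U m" if "a \<in> grd A m"
    unfolding inA_def gA_def using that grd_zero[OF grM, of m]
    by (intro grd_quotI) (auto simp: monom_def homogeneous_word_def intro!: exI[of _ "[m]"])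
  show "inM \<pi> q \<in> grd U m" if "q \<in> grd M m"
    unfolding inM_def gM_def using that grd_zero[OF grA, of m]
    by (intro grd_quotI) (auto simp: monom_def homogeneous_word_def intro!: exI[of _ "[m]"])
  show "\<kappa> c \<in> grd U 0"
    by (intro grd_quotI) (auto simp: cnst_def homogeneous_word_def zero_word_def split: if_splits)
qed

lemma quot_grd_induct [consumes 1, case_names zero add one inA inM]:
  assumes "u \<in> grd U n"
    and zero: "\<And>n. P n 0" and add: "\<And>n x y. P n x \<Longrightarrow> P n y \<Longrightarrow> P n (x + y)" and one: "P 0 (\<kappa> 1)"
    and A: "\<And>a m n x. a \<in> grd A m \<Longrightarrow> x \<in> grd U n \<Longrightarrow> P n x \<Longrightarrow> P (m + n) (inA \<pi> a * x)"
    and M: "\<And>q m n x. q \<in> grd M m \<Longrightarrow> x \<in> grd U n \<Longrightarrow> P n x \<Longrightarrow> P (m + n) (inM \<pi> q * x)"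
  shows "P n u"
proof -
  obtain f where f: "u = \<pi> f" "\<forall>w\<in>Poly_Mapping.keys f. homogeneous_word A M n w"
    using assms(1) unfolding grd_quot_iff by blast
  have word: "\<pi> (monom vs) \<in> grd U n \<and> P n (\<pi> (monom vs))"
    if "list_all2 (\<lambda>v i. v \<in> grd A i \<times> grd M i) vs ns" "sum_list ns = n" for vs ns n
    using that
  proof (induction arbitrary: n rule: list_all2_induct)
    case Nil
    then show ?case using one scalar_degree[of 1] by (simp add: monom_def cnst_def zero_word_def)
  next
    case (Cons v vs i ns)
    obtain a q where v: "v = (a, q)" "a \<in> grd A i" "q \<in> grd M i" using Cons by auto
    have "monom (v # vs) = monom [v] * (monom vs :: ('k, 'a \<times> 'm) free_alg)"
      by (simp add: monom_def mult_single plus_word_def)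
    then have e: "\<pi> (monom (v # vs)) = inA \<pi> a * \<pi> (monom vs) + inM \<pi> q * \<pi> (monom vs)"
      by (simp add: proj_mult v letter distrib_right)
    have n: "n = i + sum_list ns" using Cons by simp
    have IH: "\<pi> (monom vs) \<in> grd U (sum_list ns)" "P (sum_list ns) (\<pi> (monom vs))" using Cons.IH by auto
    show ?case unfolding e n
      by (intro conjI grd_quot_add grd_quot_mult inA_degree inM_degree add A M v IH)
  qed
  have "P n (\<Sum>w\<in>K. \<pi> (Poly_Mapping.single w (Poly_Mapping.lookup f w)))" if "K \<subseteq> Poly_Mapping.keys f" for K
    using finite_subset[OF that finite_keys] that
  proof (induction K)
    case (insert w K)
    obtain vs where w: "w = Word vs" by (cases w)
    obtain ns where "list_all2 (\<lambda>v i. v \<in> grd A i \<times> grd M i) vs ns" "sum_list ns = n"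
      using bspec[OF f(2), of w] insert.prems by (auto simp: homogeneous_word_def w)
    note word[OF this]
    moreover have "scl A c (unt A) \<in> grd A 0" for c by (rule grd_scl[OF grA unt_degree])
    ultimately have "P (0 + n) (inA \<pi> (scl A c (unt A)) * \<pi> (monom vs))" for c using A by blast
    moreover have "Poly_Mapping.single w c = cnst c * (monom vs :: ('k, 'a \<times> 'm) free_alg)" for c
      by (simp add: w cnst_def monom_def mult_single)
    ultimately have "P n (\<pi> (Poly_Mapping.single w c))" for c by (simp add: proj_mult scalar_inA)
    then show ?case using insert add by simp
  qed (simp add: zero)
  from this[OF subset_refl] show ?thesis
    by (subst f(1), subst poly_mapping_sum_single[of f]) (simp add: proj_sum)
qed

end


section \<open>The grading of the generated algebras\<close>

text \<open>The value of a Laurent polynomial at $1$.\<close>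

definition total :: "(int \<Rightarrow>\<^sub>0 'b::ring) \<Rightarrow> 'b" where
  "total = psum (\<lambda>_ x. x)"

lemma total_add: "total (f + g) = total f + total g"
  and total_single: "total (Poly_Mapping.single n x) = x"
  and total_mult: "total (f * g) = total f * total g"
  for f g :: "int \<Rightarrow>\<^sub>0 'b::ring" and x :: 'b
proof -
  have a: "additive (\<lambda>x::'b. x)" by (simp add: additive_def)
  show "total (f + g) = total f + total g" "total (Poly_Mapping.single n x) = x"
    "total (f * g) = total f * total g"
    by (simp_all add: total_def psum_add[where L = "\<lambda>_ x. x", OF a] psum_single[where L = "\<lambda>_ x. x", OF a]
        psum_mult[where L = "\<lambda>_ x. x", OF a])
qed

lemma total_eq: "total f = (\<Sum>n | Poly_Mapping.lookup f n \<noteq> 0. Poly_Mapping.lookup f n)"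
  unfolding total_def psum_def by (rule sum.cong) (auto simp: in_keys_iff)

lemma single_additive: "additive f \<Longrightarrow> additive (\<lambda>x. Poly_Mapping.single n (f x))"
  by (simp add: additive_def single_add)

lemma (in unital_algebra) laurent_unital: "unital_algebra (\<lambda>c. Poly_Mapping.single (0::int) (\<kappa> c))"
proof
  fix c d :: 'k and f :: "int \<Rightarrow>\<^sub>0 'b"
  show "Poly_Mapping.single 0 (\<kappa> (c + d)) = Poly_Mapping.single (0::int) (\<kappa> c) + Poly_Mapping.single 0 (\<kappa> d)"
    by (simp add: scalar_add single_add)
  show "Poly_Mapping.single 0 (\<kappa> (c * d)) = Poly_Mapping.single (0::int) (\<kappa> c) * Poly_Mapping.single 0 (\<kappa> d)"
    by (simp add: scalar_mult mult_single)
  show "Poly_Mapping.single 0 (\<kappa> 1) * f = f"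
    by (rule poly_mapping_eqI) (simp add: lookup_single_mult scalar_one)
  show "Poly_Mapping.single 0 (\<kappa> c) * f = f * Poly_Mapping.single 0 (\<kappa> c)"
    by (induction f rule: poly_mapping_additive_induct)
       (simp_all add: mult_single distrib_left distrib_right scalar_central)
qed

context quot_alg
begin

text \<open>
  The grading is exhibited by the homomorphism to Laurent polynomials that multiplies a generator of
  degree $n$ by the $n$-th power of the variable.
\<close>

lemma coaction_exists:
  "\<exists>\<psi> :: 'u \<Rightarrow> (int \<Rightarrow>\<^sub>0 'u). (\<forall>x y. \<psi> (x + y) = \<psi> x + \<psi> y) \<and> (\<forall>x y. \<psi> (x * y) = \<psi> x * \<psi> y) \<and>
    (\<forall>c. \<psi> (\<kappa> c) = Poly_Mapping.single 0 (\<kappa> c)) \<and>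
    (\<forall>m. \<forall>a\<in>grd A m. \<psi> (inA \<pi> a) = Poly_Mapping.single m (inA \<pi> a)) \<and>
    (\<forall>m. \<forall>q\<in>grd M m. \<psi> (inM \<pi> q) = Poly_Mapping.single m (inM \<pi> q))"
proof -
  define fA where "fA = gext A (\<lambda>n a. Poly_Mapping.single n (inA \<pi> a))"
  define fM where "fM = gext M (\<lambda>n q. Poly_Mapping.single n (inM \<pi> q))"
  note addA = single_additive[OF inA_additive] and addM = single_additive[OF inM_additive]
  have fA_additive: "additive fA" and fM_additive: "additive fM"
    unfolding fA_def fM_def by (rule gext_additive[OF grA addA], rule gext_additive[OF grM addM])
  have fA: "fA a = Poly_Mapping.single n (inA \<pi> a)" if "a \<in> grd A n" for a n
    unfolding fA_def by (rule gext_homogeneous[OF grA addA that])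
  have fM: "fM q = Poly_Mapping.single n (inM \<pi> q)" if "q \<in> grd M n" for q n
    unfolding fM_def by (rule gext_homogeneous[OF grM addM that])
  note adds = additive.add[OF fA_additive] additive.add[OF fM_additive]
  interpret VA: vector_space "scl A" by (rule graded_vector_space[OF grA])
  interpret VM: vector_space "scl M" by (rule graded_vector_space[OF grM])
  have ex: "\<exists>F. (\<forall>x y. F (x + y) = F x + F y) \<and> (\<forall>x y. F (x * y) = F x * F y) \<and>
    (\<forall>c. F (\<kappa> c) = Poly_Mapping.single 0 (\<kappa> c)) \<and> (\<forall>a. F (inA \<pi> a) = fA a) \<and> (\<forall>q. F (inM \<pi> q) = fM q)"
  proof (rule lift_exists)
    show "unital_algebra (\<lambda>c. Poly_Mapping.single (0::int) (\<kappa> c))" by (rule laurent_unital)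
    show "additive fA" "additive fM" by fact+
    show "fA (scl A c a) = Poly_Mapping.single 0 (\<kappa> c) * fA a" for c a
      by (induction a rule: graded_induct[OF grA])
         (simp_all add: VA.scale_right_distrib adds distrib_left fA fA[OF grd_scl[OF grA]] inA_scl mult_single)
    show "fM (scl M c q) = Poly_Mapping.single 0 (\<kappa> c) * fM q" for c q
      by (induction q rule: graded_induct[OF grM])
         (simp_all add: VM.scale_right_distrib adds distrib_left fM fM[OF grd_scl[OF grM]] inM_scl mult_single)
    show "fA (unt A) = Poly_Mapping.single 0 (\<kappa> 1)" by (simp add: fA[OF unt_degree] inA_unt)
    show "fA (a * b) = fA a * fA b" for a b
    proof (induction a rule: graded_induct[OF grA, case_names add homogeneous])
      case (homogeneous m a)
      then show ?case
        by (induction b rule: graded_induct[OF grA])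
           (simp_all add: distrib_left adds fA fA[OF mult_degree_A] inA_mult mult_single)
    qed (simp add: distrib_right adds)
    show "fM (smul M a q) = fA a * fM q" for a q
    proof (induction a rule: graded_induct[OF grA, case_names add homogeneous])
      case (homogeneous m a)
      then show ?case
        by (induction q rule: graded_induct[OF grM])
           (simp_all add: additive.add[OF smul_additive(1)] distrib_left adds fA fM fM[OF smul_degree] inM_smul mult_single)
    qed (simp add: additive.add[OF smul_additive(2)] distrib_right adds)
    show "fM q * fA a = sg (m * n) (fA a * fM q) + fA (act q a)"
      if "a \<in> grd A m" "q \<in> grd M n" for a q m n
      using comm_A[OF that] that
      by (simp add: fA fM fA[OF act_degree] mult_single additive_sg[OF single_additive, of "\<lambda>x. x", unfolded additive_def, simplified, symmetric] single_add add.commute[of n m])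
    show "fM q * fM r = sg (m * n) (fM r * fM q) + fM (lbr q r)"
      if "q \<in> grd M m" "r \<in> grd M n" for q r m n
      using comm_M[OF that] that
      by (simp add: fM fM[OF lbr_degree] mult_single additive_sg[OF single_additive, of "\<lambda>x. x", unfolded additive_def, simplified, symmetric] single_add add.commute[of n m])
  qed
  then show ?thesis using fA fM by (elim exE conjE, intro exI conjI) auto
qed

lemma graded_quot: "graded_space U"
proof -
  obtain \<psi> :: "'u \<Rightarrow> (int \<Rightarrow>\<^sub>0 'u)" where
    \<psi>_add: "\<forall>x y. \<psi> (x + y) = \<psi> x + \<psi> y" and \<psi>_mult: "\<forall>x y. \<psi> (x * y) = \<psi> x * \<psi> y"
    and \<psi>_scalar: "\<forall>c. \<psi> (\<kappa> c) = Poly_Mapping.single 0 (\<kappa> c)"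
    and \<psi>_A': "\<forall>m. \<forall>a\<in>grd A m. \<psi> (inA \<pi> a) = Poly_Mapping.single m (inA \<pi> a)"
    and \<psi>_M': "\<forall>m. \<forall>q\<in>grd M m. \<psi> (inM \<pi> q) = Poly_Mapping.single m (inM \<pi> q)"
    using coaction_exists by blast
  have \<psi>_A: "\<psi> (inA \<pi> a) = Poly_Mapping.single m (inA \<pi> a)" if "a \<in> grd A m" for a m using \<psi>_A' that by blast
  have \<psi>_M: "\<psi> (inM \<pi> q) = Poly_Mapping.single m (inM \<pi> q)" if "q \<in> grd M m" for q m using \<psi>_M' that by blast
  have \<psi>_additive: "additive \<psi>" by (simp add: additive_def \<psi>_add)
  \<comment> \<open>the coefficients of \<open>\<psi> u\<close> are the homogeneous components of \<open>u\<close>\<close>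
  have \<psi>_hom: "\<psi> u = Poly_Mapping.single n u" if "u \<in> grd U n" for u n
    using that
    by (induction rule: quot_grd_induct)
       (simp_all add: additive.zero[OF \<psi>_additive] \<psi>_add single_add \<psi>_scalar \<psi>_mult \<psi>_A \<psi>_M mult_single)
  have \<psi>_total: "total (\<psi> u) = u" for u
    by (induction u rule: quot_induct)
       (simp_all add: \<psi>_add total_add \<psi>_scalar total_single \<psi>_mult total_mult \<psi>_A \<psi>_M)
  have \<psi>_lookup: "Poly_Mapping.lookup (\<psi> u) n \<in> grd U n" for u n
  proof (induction u arbitrary: n rule: quot_induct)
    case (inA a m x)
    then have "inA \<pi> a * Poly_Mapping.lookup (\<psi> x) (n - m) \<in> grd U (m + (n - m))"
      by (intro grd_quot_mult inA_degree)
    then show ?case by (simp add: \<psi>_mult \<psi>_A[OF inA(1)] lookup_single_mult)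
  next
    case (inM q m x)
    then have "inM \<pi> q * Poly_Mapping.lookup (\<psi> x) (n - m) \<in> grd U (m + (n - m))"
      by (intro grd_quot_mult inM_degree)
    then show ?case by (simp add: \<psi>_mult \<psi>_M[OF inM(1)] lookup_single_mult)
  qed (auto simp: \<psi>_add lookup_add grd_quot_add \<psi>_scalar lookup_single when_def scalar_degree grd_quot_zero)
  have scl: "scl U = (\<lambda>c u. \<kappa> c * u)" by (simp add: fun_eq_iff)
  interpret V: vector_space "scl U" unfolding scl by (rule scalar_vector_space)
  show ?thesis
    unfolding graded_space_def
  proof (intro conjI allI)
    show "vector_space (scl U)" by (rule V.vector_space_axioms)
    show "V.subspace (grd U n)" for n
    proof (rule V.subspaceI)
      show "scl U c x \<in> grd U n" if "x \<in> grd U n" for c x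
        using grd_quot_mult[OF scalar_degree that] by simp
    qed (auto intro: grd_quot_zero grd_quot_add)
    show "\<exists>!c. (\<forall>n. c n \<in> grd U n) \<and> finite {n. c n \<noteq> 0} \<and> x = (\<Sum>n | c n \<noteq> 0. c n)" for x
    proof (rule ex1I)
      show "(\<forall>n. Poly_Mapping.lookup (\<psi> x) n \<in> grd U n) \<and> finite {n. Poly_Mapping.lookup (\<psi> x) n \<noteq> 0} \<and>
          x = (\<Sum>n | Poly_Mapping.lookup (\<psi> x) n \<noteq> 0. Poly_Mapping.lookup (\<psi> x) n)"
        using \<psi>_lookup \<psi>_total[of x] by (simp add: total_eq)
      fix c assume c: "(\<forall>n. c n \<in> grd U n) \<and> finite {n. c n \<noteq> 0} \<and> x = (\<Sum>n | c n \<noteq> 0. c n)"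
      show "c = Poly_Mapping.lookup (\<psi> x)"
      proof
        fix m
        have "\<psi> x = (\<Sum>n | c n \<noteq> 0. Poly_Mapping.single n (c n))"
          using c by (metis (no_types, lifting) \<psi>_hom additive.sum[OF \<psi>_additive] sum.cong)
        then have "Poly_Mapping.lookup (\<psi> x) m = (\<Sum>n | c n \<noteq> 0. if n = m then c n else 0)"
          by (simp add: lookup_sum lookup_single when_def)
        then show "c m = Poly_Mapping.lookup (\<psi> x) m" using c by (simp add: sum.delta)
      qed
    qed
  qed
qed

lemma mult_bilinear: "graded_bilinear U U U (*)"
proof -
  have "vector_space (scl U)" by (rule graded_vector_space[OF graded_quot])
  then show ?thesis
    by (auto simp: graded_bilinear_def grd_quot_mult distrib_left distrib_right scalar_mult_right mult.assoc
        intro!: linearI)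
qed

abbreviation "T \<equiv> tw U"

lemmas T_add = tw_add[OF graded_quot] and T_additive = tw_additive[OF graded_quot]
  and T_homogeneous = tw_homogeneous[OF graded_quot]

lemma T_mult: "T (x * y) = T x * T y"
  by (rule tw_mult[OF graded_quot grd_quot_mult])

lemma T_inA: "T (inA \<pi> a) = inA \<pi> (tw A a)" and T_inM: "T (inM \<pi> q) = inM \<pi> (tw M q)"
proof -
  show "T (inA \<pi> a) = inA \<pi> (tw A a)"
    by (induction a rule: graded_induct[OF grA])
       (simp_all add: inA_add T_add tw_add[OF grA] tw_homogeneous[OF grA] T_homogeneous[OF inA_degree] inA_sg)
  show "T (inM \<pi> q) = inM \<pi> (tw M q)"
    by (induction q rule: graded_induct[OF grM])
       (simp_all add: inM_add T_add tw_add[OF grM] tw_homogeneous[OF grM] T_homogeneous[OF inM_degree] inM_sg)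
qed

lemma T_scalar: "T (\<kappa> c) = \<kappa> c"
  by (simp add: T_homogeneous[OF scalar_degree])

end


section \<open>Extension of derivations and morphisms\<close>

text \<open>
  Upper triangular matrices with rows $(t, d)$ and $(0, x)$.  If $T$ is the sign automorphism, then
  $x \mapsto (T x, D x, x)$ is a homomorphism if and only if $D$ is an odd derivation.
\<close>

datatype 'u tri = Tri (tri_t: 'u) (tri_d: 'u) (tri_x: 'u)

instantiation tri :: (ring) ring
begin
definition "0 = Tri 0 0 0"
definition "x + y = Tri (tri_t x + tri_t y) (tri_d x + tri_d y) (tri_x x + tri_x y)"
definition "x - y = Tri (tri_t x - tri_t y) (tri_d x - tri_d y) (tri_x x - tri_x y)"
definition "- x = Tri (- tri_t x) (- tri_d x) (- tri_x x)"
definition "x * y = Tri (tri_t x * tri_t y) (tri_t x * tri_d y + tri_d x * tri_x y) (tri_x x * tri_x y)"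
instance
  by standard
     (auto simp: zero_tri_def plus_tri_def minus_tri_def uminus_tri_def times_tri_def algebra_simps)
end

lemma tri_simps [simp]:
  "Tri t d x + Tri t' d' x' = Tri (t + t') (d + d') (x + x')"
  "Tri t d x * Tri t' d' x' = Tri (t * t') (t * d' + d * x') (x * x')"
  "sg n (Tri t d x) = Tri (sg n t) (sg n d) (sg n x)"
  by (simp_all add: plus_tri_def times_tri_def uminus_tri_def sg_def)

text \<open>
  Maps \<open>f\<close> on \<open>A\<close> and \<open>g\<close> on \<open>M\<close> of odd degree \<open>e\<close> that are compatible with the structure, and
  hence extend to a derivation \<open>D\<close>.  As \<open>e\<close> is odd, the sign of the Leibniz rule is the sign
  automorphism.
\<close>

locale quot_derivation = quot_alg A M act lbr \<pi>
  for A :: "('k::field, 'a::ring) dg_alg" and M :: "('k, 'a, 'm::ab_group_add, 'z) dg_mod_scheme"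
    and act lbr and \<pi> :: "('k, 'a \<times> 'm) free_alg \<Rightarrow> 'u::ring" +
  fixes e :: int and f :: "'a \<Rightarrow> 'a" and g :: "'m \<Rightarrow> 'm"
  assumes odd: "odd e"
    and f: "degree_map A A e f" and g: "degree_map M M e g"
    and f_mult: "a \<in> grd A m \<Longrightarrow> f (a * b) = f a * b + sg m (a * f b)"
    and g_smul: "a \<in> grd A m \<Longrightarrow> g (smul M a q) = smul M (f a) q + sg m (smul M a (g q))"
    and f_act: "q \<in> grd M m \<Longrightarrow> f (act q a) = act (g q) a + sg m (act q (f a))"
    and g_lbr: "q \<in> grd M m \<Longrightarrow> g (lbr q r) = lbr (g q) r + sg m (lbr q (g r))"
begin

lemma f_unt: "f (unt A) = 0"
  using f_mult[OF unt_degree, of "unt A"] by (simp add: unt_mult)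

lemma derivation_exists:
  "\<exists>D. graded_derivation U e D \<and> (\<forall>a. D (inA \<pi> a) = inA \<pi> (f a)) \<and> (\<forall>q. D (inM \<pi> q) = inM \<pi> (g q))"
proof -
  define \<kappa>' where "\<kappa>' c = Tri (\<kappa> c) 0 (\<kappa> c)" for c
  define fA where "fA a = Tri (T (inA \<pi> a)) (inA \<pi> (f a)) (inA \<pi> a)" for a
  define fM where "fM q = Tri (T (inM \<pi> q)) (inM \<pi> (g q)) (inM \<pi> q)" for q
  have "\<exists>F. (\<forall>x y. F (x + y) = F x + F y) \<and> (\<forall>x y. F (x * y) = F x * F y) \<and>
    (\<forall>c. F (\<kappa> c) = \<kappa>' c) \<and> (\<forall>a. F (inA \<pi> a) = fA a) \<and> (\<forall>q. F (inM \<pi> q) = fM q)"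
  proof (rule lift_exists)
    show "unital_algebra \<kappa>'"
    proof
      fix c d and x :: "'u tri"
      show "\<kappa>' (c + d) = \<kappa>' c + \<kappa>' d" by (simp add: \<kappa>'_def scalar_add)
      show "\<kappa>' (c * d) = \<kappa>' c * \<kappa>' d" by (simp add: \<kappa>'_def scalar_mult)
      show "\<kappa>' 1 * x = x" by (cases x) (simp add: \<kappa>'_def scalar_one)
      show "\<kappa>' c * x = x * \<kappa>' c" by (cases x) (simp add: \<kappa>'_def scalar_central)
    qed
    show "additive fA" "additive fM"
      by (simp_all add: additive_def fA_def fM_def inA_add inM_add T_add degree_mapD(4)[OF f] degree_mapD(4)[OF g])
    show "fA (scl A c a) = \<kappa>' c * fA a" "fM (scl M c q) = \<kappa>' c * fM q" for c a q
      by (simp_all add: fA_def fM_def \<kappa>'_def inA_scl inM_scl T_mult T_scalar degree_mapD(5)[OF f] degree_mapD(5)[OF g])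
    show "fA (unt A) = \<kappa>' 1" by (simp add: fA_def \<kappa>'_def inA_unt T_scalar f_unt)
    have f': "inA \<pi> (f (a * b)) = T (inA \<pi> a) * inA \<pi> (f b) + inA \<pi> (f a) * inA \<pi> b" for a b
      by (induction a rule: graded_induct[OF grA])
         (simp_all add: distrib_right degree_mapD(4)[OF f] inA_add T_add f_mult T_homogeneous[OF inA_degree]
            inA_mult inA_sg sg_mult_left add.commute add.left_commute)
    have g': "inM \<pi> (g (smul M a q)) = T (inA \<pi> a) * inM \<pi> (g q) + inA \<pi> (f a) * inM \<pi> q" for a q
      by (induction a rule: graded_induct[OF grA])
         (simp_all add: distrib_right degree_mapD(4)[OF f] degree_mapD(4)[OF g] inA_add inM_add T_add g_smul
            T_homogeneous[OF inA_degree] inM_smul inM_sg sg_mult_left additive.add[OF smul_additive(2)]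
            add.commute add.left_commute)
    show "fA (a * b) = fA a * fA b" for a b
      by (simp add: fA_def inA_mult T_mult f')
    show "fM (smul M a q) = fA a * fM q" for a q
      by (simp add: fA_def fM_def inM_smul T_mult g')
    show "fM q * fA a = sg (m * n) (fA a * fM q) + fA (act q a)"
      if a: "a \<in> grd A m" and q: "q \<in> grd M n" for a q m n
    proof -
      note 1 = comm_A[OF degree_mapD(2)[OF f a] q] comm_A[OF a degree_mapD(2)[OF g q]]
      have "sg n (inM \<pi> q) * inA \<pi> (f a) + inM \<pi> (g q) * inA \<pi> a =
        sg (m * n) (sg m (inA \<pi> a) * inM \<pi> (g q) + inA \<pi> (f a) * inM \<pi> q) + inA \<pi> (f (act q a))"
        using odd by (cases "even m"; cases "even n")
          (simp_all add: sg_mult_left 1 f_act[OF q] inA_add inA_sg sg_add inA_minus inA_diff algebra_simps)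
      moreover have "T (inM \<pi> q) * T (inA \<pi> a) = sg (m * n) (T (inA \<pi> a) * T (inM \<pi> q)) + T (inA \<pi> (act q a))"
        by (simp add: comm_A[OF a q] T_add additive_sg[OF T_additive] flip: T_mult)
      ultimately show ?thesis
        by (simp add: fA_def fM_def comm_A[OF a q] T_homogeneous[OF inA_degree[OF a]] T_homogeneous[OF inM_degree[OF q]])
    qed
    show "fM q * fM r = sg (m * n) (fM r * fM q) + fM (lbr q r)"
      if q: "q \<in> grd M m" and r: "r \<in> grd M n" for q r m n
    proof -
      note 1 = comm_M[OF q degree_mapD(2)[OF g r]] comm_M[OF degree_mapD(2)[OF g q] r]
      have "sg m (inM \<pi> q) * inM \<pi> (g r) + inM \<pi> (g q) * inM \<pi> r =
        sg (m * n) (sg n (inM \<pi> r) * inM \<pi> (g q) + inM \<pi> (g r) * inM \<pi> q) + inM \<pi> (g (lbr q r))"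
        using odd by (cases "even m"; cases "even n")
          (simp_all add: sg_mult_left 1 g_lbr[OF q] inM_add inM_sg sg_add inM_minus inM_diff algebra_simps)
      moreover have "T (inM \<pi> q) * T (inM \<pi> r) = sg (m * n) (T (inM \<pi> r) * T (inM \<pi> q)) + T (inM \<pi> (lbr q r))"
        by (simp add: comm_M[OF q r] T_add additive_sg[OF T_additive] flip: T_mult)
      ultimately show ?thesis
        by (simp add: fM_def comm_M[OF q r] T_homogeneous[OF inM_degree[OF q]] T_homogeneous[OF inM_degree[OF r]])
    qed
  qed
  then obtain F where F_add: "\<And>x y. F (x + y) = F x + F y" and F_mult: "\<And>x y. F (x * y) = F x * F y"
    and F_scalar: "\<And>c. F (\<kappa> c) = \<kappa>' c" and F_A: "\<And>a. F (inA \<pi> a) = fA a" and F_M: "\<And>q. F (inM \<pi> q) = fM q"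
    by blast
  define D where "D x = tri_d (F x)" for x
  have F: "F x = Tri (T x) (D x) x" for x
  proof -
    have "tri_t (F x) = T x \<and> tri_x (F x) = x"
      by (induction x rule: quot_induct)
         (simp_all add: F_add F_mult F_scalar F_A F_M \<kappa>'_def fA_def fM_def T_scalar T_add T_mult
            plus_tri_def times_tri_def)
    then show ?thesis by (cases "F x") (simp add: D_def)
  qed
  have D_add: "D (x + y) = D x + D y" and D_mult: "D (x * y) = T x * D y + D x * y" for x y
    using F_add[of x y] F_mult[of x y] by (simp_all add: F)
  have D_scalar: "D (\<kappa> c) = 0" for c using F_scalar[of c] by (simp add: F \<kappa>'_def)
  have D_A: "D (inA \<pi> a) = inA \<pi> (f a)" and D_M: "D (inM \<pi> q) = inM \<pi> (g q)" for a q
    using F_A[of a] F_M[of q] by (simp_all add: F fA_def fM_def)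
  have D_grd: "D x \<in> grd U (n + e)" if "x \<in> grd U n" for x n
    using that
  proof (induction rule: quot_grd_induct)
    case (zero n)
    then show ?case using D_add[of 0 0] grd_quot_zero by simp
  next
    case (inA a m n x)
    have "sg m (inA \<pi> a) * D x \<in> grd U (m + (n + e))" "inA \<pi> (f a) * x \<in> grd U ((m + e) + n)"
      by (intro grd_quot_mult grd_sg[OF graded_quot] inA_degree inA degree_mapD(2)[OF f])+
    then show ?case
      by (simp add: D_mult T_homogeneous[OF inA_degree[OF inA(1)]] D_A grd_quot_add algebra_simps)
  next
    case (inM q m n x)
    have "sg m (inM \<pi> q) * D x \<in> grd U (m + (n + e))" "inM \<pi> (g q) * x \<in> grd U ((m + e) + n)"
      by (intro grd_quot_mult grd_sg[OF graded_quot] inM_degree inM degree_mapD(2)[OF g])+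
    then show ?case
      by (simp add: D_mult T_homogeneous[OF inM_degree[OF inM(1)]] D_M grd_quot_add algebra_simps)
  qed (simp_all add: D_add grd_quot_add D_scalar grd_quot_zero)
  have "graded_derivation U e D"
    unfolding graded_derivation_def degree_map_def
  proof (intro conjI allI ballI)
    show "Vector_Spaces.linear (scl U) (scl U) D"
      by (intro linearI graded_vector_space[OF graded_quot]) (simp_all add: D_add D_mult D_scalar T_scalar)
    show "D x \<in> grd U (n + e)" if "x \<in> grd U n" for n x by (rule D_grd[OF that])
    show "D (x * y) = D x * y + sg (e * n) (x * D y)" if x: "x \<in> grd U n" for n x y
      using odd by (simp add: D_mult T_homogeneous[OF x] sg_mult_left add.commute sg_def)
  qed
  then show ?thesis using D_A D_M by blast
qed

abbreviation "D \<equiv> ext_derivation A M \<pi> e f g"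

lemma derivation_mult:
  assumes "graded_derivation U e D'"
  shows "D' (x * y) = D' x * y + T x * D' y"
proof -
  have a: "additive D'" using assms unfolding graded_derivation_def by (blast intro: degree_mapD(3))
  show ?thesis
  proof (rule additive_eqI[OF graded_quot, where f = "\<lambda>x. D' (x * y)" and g = "\<lambda>x. D' x * y + T x * D' y"])
    fix n x assume x: "x \<in> grd U n"
    then show "D' (x * y) = D' x * y + T x * D' y"
      using assms odd by (simp add: graded_derivation_def T_homogeneous sg_mult_left sg_def)
  qed (auto simp: additive_def additive.add[OF a] T_add distrib_right)
qed

lemma derivation_unique:
  assumes D1: "graded_derivation U e D1" "\<And>a. D1 (inA \<pi> a) = inA \<pi> (f a)" "\<And>q. D1 (inM \<pi> q) = inM \<pi> (g q)"
    and D2: "graded_derivation U e D2" "\<And>a. D2 (inA \<pi> a) = inA \<pi> (f a)" "\<And>q. D2 (inM \<pi> q) = inM \<pi> (g q)"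
  shows "D1 = D2"
proof
  fix x
  show "D1 x = D2 x"
  proof (rule quot_hom_eqI[where F = D1 and F' = D2])
    show "additive D1" "additive D2"
      using D1(1) D2(1) unfolding graded_derivation_def by (blast intro: degree_mapD(3))+
    show "D1 (\<kappa> 1) = D2 (\<kappa> 1)" unfolding inA_unt[symmetric] by (simp only: D1 D2)
  qed (simp_all add: derivation_mult[OF D1(1)] derivation_mult[OF D2(1)] D1(2,3) D2(2,3))
qed

lemma D_derivation: "graded_derivation U e D" and D_inA: "D (inA \<pi> a) = inA \<pi> (f a)"
  and D_inM: "D (inM \<pi> q) = inM \<pi> (g q)"
proof -
  have "\<exists>!D. graded_derivation U e D \<and> (\<forall>a. D (inA \<pi> a) = inA \<pi> (f a)) \<and> (\<forall>q. D (inM \<pi> q) = inM \<pi> (g q))"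
    using derivation_exists derivation_unique by blast
  from theI'[OF this] show "graded_derivation U e D" "D (inA \<pi> a) = inA \<pi> (f a)" "D (inM \<pi> q) = inM \<pi> (g q)"
    by (simp_all add: ext_derivation_def)
qed

lemma D_degree_map: "degree_map U U e D"
  using D_derivation by (simp add: graded_derivation_def)

lemmas D_mult = derivation_mult[OF D_derivation]
  and D_add = degree_mapD(4)[OF D_degree_map]
  and D_additive = degree_mapD(3)[OF D_degree_map]

lemma D_scalar: "D (\<kappa> c) = 0"
proof -
  have "D (\<kappa> 1) = 0" using D_inA[of "unt A"] by (simp add: inA_unt f_unt)
  then show ?thesis using degree_mapD(5)[OF D_degree_map, of c "\<kappa> 1"] by (simp add: scalar_one_right)
qed

lemma T_D: "T (D x) = - D (T x)"
  using tw_degree_map[OF graded_quot graded_quot D_degree_map, of x] odd by simp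

end


subsection \<open>Odd derivations\<close>

context quot_alg
begin

lemma odd_derivation_square:
  assumes "additive D" and m: "\<And>x y. D (x * y) = D x * y + T x * D y" and T: "\<And>x. T (D x) = - D (T x)"
  shows "D (D (x * y)) = D (D x) * y + x * D (D y)"
  by (simp add: m additive.add[OF assms(1)] T tw_tw[OF graded_quot])

lemma odd_derivations_commutator:
  assumes "additive D" "\<And>x y. D (x * y) = D x * y + T x * D y" "\<And>x. T (D x) = - D (T x)"
    and "additive D'" "\<And>x y. D' (x * y) = D' x * y + T x * D' y" "\<And>x. T (D' x) = - D' (T x)"
  shows "D (D' (x * y)) + D' (D (x * y)) = (D (D' x) + D' (D x)) * y + x * (D (D' y) + D' (D y))"
  by (simp add: assms(2,3,5,6) additive.add[OF assms(1)] additive.add[OF assms(4)] tw_tw[OF graded_quot]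
      distrib_left distrib_right add.commute add.left_commute)

end

context quot_derivation
begin

lemma D_square:
  assumes "\<And>a. f (f a) = 0" "\<And>q. g (g q) = 0"
  shows "D (D x) = 0"
  by (induction x rule: quot_induct)
     (simp_all add: D_add D_scalar odd_derivation_square[OF D_additive D_mult T_D] D_inA D_inM assms
        additive.zero[OF D_additive])

end


subsection \<open>The filtration\<close>

lemma A_submodule_hull: "A_submodule \<pi> (A_submodule \<pi> hull S)"
  by (rule hull_in) (auto simp: A_submodule_def)

lemma submodule_hull_zero: "0 \<in> A_submodule \<pi> hull S"
  and submodule_hull_add: "x \<in> A_submodule \<pi> hull S \<Longrightarrow> y \<in> A_submodule \<pi> hull S \<Longrightarrow> x + y \<in> A_submodule \<pi> hull S"
  and submodule_hull_inA: "x \<in> A_submodule \<pi> hull S \<Longrightarrow> inA \<pi> a * x \<in> A_submodule \<pi> hull S"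
  using A_submodule_hull[of \<pi> S] by (auto simp: A_submodule_def)

lemma submodule_hull_induct [consumes 1, case_names gen zero add inA]:
  assumes "x \<in> A_submodule \<pi> hull S"
    and "\<And>x. x \<in> S \<Longrightarrow> P x" "P 0"
    and "\<And>x y. x \<in> A_submodule \<pi> hull S \<Longrightarrow> y \<in> A_submodule \<pi> hull S \<Longrightarrow> P x \<Longrightarrow> P y \<Longrightarrow> P (x + y)"
    and "\<And>a x. x \<in> A_submodule \<pi> hull S \<Longrightarrow> P x \<Longrightarrow> P (inA \<pi> a * x)"
  shows "P x"
proof -
  define B where "B = A_submodule \<pi> hull S"
  note B = submodule_hull_zero[of \<pi> S, folded B_def] submodule_hull_add[of _ \<pi> S, folded B_def]
    submodule_hull_inA[of _ \<pi> S, folded B_def]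
  have "x \<in> B \<and> P x"
    using assms(1)
  proof (rule hull_induct)
    show "x \<in> B \<and> P x" if "x \<in> S" for x using that assms(2) by (simp add: hull_inc B_def)
    show "A_submodule \<pi> {x. x \<in> B \<and> P x}"
      using B assms(3-5)[folded B_def] by (simp add: A_submodule_def)
  qed
  then show ?thesis ..
qed

text \<open>The summands of the Leibniz expansion of a derivation on a product.\<close>

fun derlist :: "('m \<Rightarrow> 'm) \<Rightarrow> ('m \<Rightarrow> 'm) \<Rightarrow> 'm list \<Rightarrow> 'm list list" where
  "derlist \<tau> g [] = []"
| "derlist \<tau> g (q # qs) = (g q # qs) # map ((#) (\<tau> q)) (derlist \<tau> g qs)"

lemma length_derlist: "l \<in> set (derlist \<tau> g qs) \<Longrightarrow> length l = length qs"
  by (induction qs arbitrary: l) auto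

context quot_alg
begin

lemma filt_prods: "int (length qs) \<le> i \<Longrightarrow> prods \<pi> qs \<in> filt \<pi> i"
  unfolding filt_def by (rule hull_inc) blast

lemma filt_zero: "0 \<in> filt \<pi> i"
  and filt_add: "x \<in> filt \<pi> i \<Longrightarrow> y \<in> filt \<pi> i \<Longrightarrow> x + y \<in> filt \<pi> i"
  and filt_inA: "x \<in> filt \<pi> i \<Longrightarrow> inA \<pi> a * x \<in> filt \<pi> i"
  unfolding filt_def by (fact submodule_hull_zero submodule_hull_add submodule_hull_inA)+

lemma filt_minus: "x \<in> filt \<pi> i \<Longrightarrow> - x \<in> filt \<pi> i"
  using filt_inA[of x i "- unt A"] by (simp add: inA_minus inA_unt scalar_one)

lemma filt_diff: "x \<in> filt \<pi> i \<Longrightarrow> y \<in> filt \<pi> i \<Longrightarrow> x - y \<in> filt \<pi> i"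
  using filt_add[OF _ filt_minus, of x i y] by simp

lemma filt_sg: "x \<in> filt \<pi> i \<Longrightarrow> sg n x \<in> filt \<pi> i"
  by (simp add: sg_def filt_minus)

lemma filt_scalar: "x \<in> filt \<pi> i \<Longrightarrow> \<kappa> c * x \<in> filt \<pi> i"
  by (simp add: scalar_inA filt_inA)

lemma filt_sum: "(\<And>k. k \<in> K \<Longrightarrow> f k \<in> filt \<pi> i) \<Longrightarrow> sum f K \<in> filt \<pi> i"
  by (induction K rule: infinite_finite_induct) (auto simp: filt_zero filt_add)

lemma filt_sum_list: "(\<And>l. l \<in> set ls \<Longrightarrow> f l \<in> filt \<pi> i) \<Longrightarrow> (\<Sum>l\<leftarrow>ls. f l) \<in> filt \<pi> i"
  by (induction ls) (auto simp: filt_zero filt_add)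

lemma filt_mono: "i \<le> j \<Longrightarrow> filt \<pi> i \<subseteq> filt \<pi> j"
  unfolding filt_def by (rule hull_mono) auto

lemma filt_negative: "i < 0 \<Longrightarrow> filt \<pi> i = {0}"
proof -
  assume "i < 0"
  then have "filt \<pi> i = A_submodule \<pi> hull {}" unfolding filt_def by (intro arg_cong2[where f = "(hull)"]) auto
  also have "\<dots> \<subseteq> {0}" by (rule hull_minimal) (auto simp: A_submodule_def)
  finally show ?thesis using filt_zero by blast
qed

lemma filt_induct [consumes 1, case_names prods zero add inA]:
  assumes "x \<in> filt \<pi> i"
    and "\<And>qs. int (length qs) \<le> i \<Longrightarrow> P (prods \<pi> qs)" "P 0"
    and "\<And>x y. x \<in> filt \<pi> i \<Longrightarrow> y \<in> filt \<pi> i \<Longrightarrow> P x \<Longrightarrow> P y \<Longrightarrow> P (x + y)"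
    and "\<And>a x. x \<in> filt \<pi> i \<Longrightarrow> P x \<Longrightarrow> P (inA \<pi> a * x)"
  shows "P x"
  using assms(1)[unfolded filt_def]
  by (rule submodule_hull_induct) (use assms(2-5)[unfolded filt_def] in auto)

lemma filt_inM: "x \<in> filt \<pi> i \<Longrightarrow> inM \<pi> q * x \<in> filt \<pi> (i + 1)"
proof (induction q rule: graded_induct[OF grM, case_names add homogeneous])
  case (homogeneous n q)
  from homogeneous(2) show ?case
  proof (induction rule: filt_induct)
    case (prods qs)
    then show ?case using filt_prods[of "q # qs" "i + 1"] by (simp add: prods_Cons)
  next
    case (inA a x)
    show ?case
    proof (induction a rule: graded_induct[OF grA, case_names add homogeneous])
      case (homogeneous m a)
      have "inM \<pi> q * (inA \<pi> a * x) = sg (m * n) (inA \<pi> a * (inM \<pi> q * x)) + inA \<pi> (act q a) * x"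
        using comm_A[OF homogeneous \<open>q \<in> grd M n\<close>] by (simp add: distrib_right sg_mult_left mult.assoc flip: mult.assoc[of "inM \<pi> q"])
      moreover have "x \<in> filt \<pi> (i + 1)" using inA(1) filt_mono[of i "i + 1"] by auto
      ultimately show ?case using inA(2) by (simp add: filt_add filt_sg filt_inA)
    qed (simp add: inA_add distrib_left distrib_right filt_add)
  qed (simp_all add: distrib_left filt_zero filt_add)
qed (simp add: inM_add distrib_right filt_add)

lemma filt_exhaustive: "\<exists>i. x \<in> filt \<pi> (int i)"
proof (induction x rule: quot_induct)
  case (add x y)
  then obtain i j where "x \<in> filt \<pi> (int i)" "y \<in> filt \<pi> (int j)" by blast
  then have "x \<in> filt \<pi> (int (max i j))" "y \<in> filt \<pi> (int (max i j))"
    using filt_mono[of "int i" "int (max i j)"] filt_mono[of "int j" "int (max i j)"] by auto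
  then show ?case using filt_add by blast
next
  case one
  then show ?case using filt_prods[of "[]" 0] by (intro exI[of _ 0]) (simp add: prods_Nil)
next
  case (inA a m x)
  then show ?case using filt_inA by blast
next
  case (inM q m x)
  then obtain i where "x \<in> filt \<pi> (int i)" by blast
  from filt_inM[OF this, of q] show ?case by (intro exI[of _ "Suc i"]) (simp add: add.commute)
qed

end

context quot_derivation
begin

lemma D_prods: "D (prods \<pi> qs) = (\<Sum>l\<leftarrow>derlist (tw M) g qs. prods \<pi> l)"
proof (induction qs)
  case Nil
  then show ?case by (simp add: prods_Nil D_scalar)
next
  case (Cons q qs)
  have "T (inM \<pi> q) * (\<Sum>l\<leftarrow>ls. prods \<pi> l) = (\<Sum>l\<leftarrow>map ((#) (tw M q)) ls. prods \<pi> l)" for ls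
    by (induction ls) (simp_all add: distrib_left prods_Cons T_inM)
  then show ?case by (simp add: prods_Cons D_mult D_inM Cons)
qed

lemma D_filt: "x \<in> filt \<pi> i \<Longrightarrow> D x \<in> filt \<pi> i"
proof (induction rule: filt_induct)
  case (prods qs)
  then show ?case unfolding D_prods by (auto intro!: filt_sum_list filt_prods dest: length_derlist)
qed (simp_all add: D_mult D_inA T_inA D_add filt_add filt_inA filt_zero additive.zero[OF D_additive])

end


subsection \<open>Symmetric algebras and their morphisms\<close>

lemma two_sided_ideal_hull: "two_sided_ideal (two_sided_ideal hull S)"
  by (rule hull_in) (auto simp: two_sided_ideal_def)

lemma two_sided_ideal_add: "two_sided_ideal I \<Longrightarrow> x \<in> I \<Longrightarrow> y \<in> I \<Longrightarrow> x + y \<in> I"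
  unfolding two_sided_ideal_def by (metis diff_0 diff_minus_eq_add)

lemma two_sided_ideal_hull_subset:
  "X \<subseteq> two_sided_ideal hull Y \<Longrightarrow> two_sided_ideal hull X \<subseteq> two_sided_ideal hull Y"
  using two_sided_ideal_hull by (rule hull_minimal[rotated])

text \<open>
  The relations with vanishing \<open>act\<close> and \<open>lbr\<close> differ from those of the symmetric algebra by the
  generator $0$, which is in the ideal of the tensor relations.
\<close>

lemma sym_ideal_eq:
  "two_sided_ideal hull (tensor_rels A M \<union> module_rels A M \<union> comm_rels A M (\<lambda>_ _. 0) (\<lambda>_ _. 0)) =
   two_sided_ideal hull (tensor_rels A M \<union> module_rels A M \<union> sym_rels A M)"
  (is "_ hull ?C = _ hull ?S")
proof -
  have zero: "monom [(0, 0)] \<in> two_sided_ideal hull X" if "tensor_rels A M \<subseteq> X" for X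
  proof -
    have "monom [(0 + 0, 0 + 0)] - monom [(0, 0)] - monom [(0, 0)] \<in> tensor_rels A M"
      unfolding tensor_rels_def by blast
    then have "- monom [(0, 0)] \<in> two_sided_ideal hull X" using that by (simp add: hull_inc subset_iff)
    moreover have "0 \<in> two_sided_ideal hull X" "\<And>x y. x \<in> two_sided_ideal hull X \<Longrightarrow> y \<in> two_sided_ideal hull X \<Longrightarrow> x - y \<in> two_sided_ideal hull X"
      using two_sided_ideal_hull[of X] by (auto simp: two_sided_ideal_def)
    ultimately show ?thesis by (metis diff_0 minus_minus)
  qed
  have zS: "gA 0 \<in> two_sided_ideal hull ?S" "gM 0 \<in> two_sided_ideal hull ?S"
    and zC: "gA 0 \<in> two_sided_ideal hull ?C" "gM 0 \<in> two_sided_ideal hull ?C"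
    unfolding gA_def gM_def by (auto intro!: zero)
  note IS = two_sided_ideal_hull[of ?S] and IC = two_sided_ideal_hull[of ?C]
  have dS: "x - y \<in> two_sided_ideal hull ?S" if "x \<in> ?S" "y \<in> two_sided_ideal hull ?S" for x y
    using IS hull_inc[OF that(1), of two_sided_ideal] that(2) unfolding two_sided_ideal_def by blast
  have dC: "x \<in> two_sided_ideal hull ?C" if "x - y \<in> ?C" "y \<in> two_sided_ideal hull ?C" for x y
    using two_sided_ideal_add[OF IC hull_inc[OF that(1)] that(2)] by simp
  show ?thesis
  proof
    have "comm_rels A M (\<lambda>_ _. 0) (\<lambda>_ _. 0) \<subseteq> two_sided_ideal hull ?S"
      unfolding comm_rels_def by (auto intro!: dS zS) (auto simp: sym_rels_def)
    then show "two_sided_ideal hull ?C \<subseteq> two_sided_ideal hull ?S"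
      by (intro two_sided_ideal_hull_subset) (auto intro: hull_inc)
    have "gM q * gA a - sg (m * n) (gA a * gM q) \<in> two_sided_ideal hull ?C"
      if "a \<in> grd A m" "q \<in> grd M n" for m n a q
      using that by (intro dC[OF _ zC(1)]) (auto simp: comm_rels_def)
    moreover have "gM q * gM r - sg (m * n) (gM r * gM q) \<in> two_sided_ideal hull ?C"
      if "q \<in> grd M m" "r \<in> grd M n" for m n q r
      using that by (intro dC[OF _ zC(2)]) (auto simp: comm_rels_def)
    ultimately have "sym_rels A M \<subseteq> two_sided_ideal hull ?C" by (auto simp: sym_rels_def)
    then show "two_sided_ideal hull ?S \<subseteq> two_sided_ideal hull ?C"
      by (intro two_sided_ideal_hull_subset) (auto intro: hull_inc)
  qed
qed

lemma symmetric_quot_alg: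
  assumes "graded_comm_dga A" "dg_module A M" "symmetric_algebra A M \<pi>"
  shows "quot_alg A M (\<lambda>_ _. 0) (\<lambda>_ _. 0) \<pi>"
proof
  show "quotient_by (two_sided_ideal hull (tensor_rels A M \<union> module_rels A M \<union> comm_rels A M (\<lambda>_ _. 0) (\<lambda>_ _. 0))) \<pi>"
    using assms(3) unfolding symmetric_algebra_def sym_ideal_eq .
  have "graded_space A" "graded_space M"
    using assms(1,2) by (simp_all add: graded_comm_dga_def dg_module_def cochain_complex_def)
  then show "0 \<in> grd A n" "0 \<in> grd M n" for n by (auto intro: grd_zero)
qed fact+

lemma symmetric_differential:
  assumes A: "graded_comm_dga A" and M: "dg_module A M" and "symmetric_algebra A M \<pi>"
  shows "quot_derivation A M (\<lambda>_ _. 0) (\<lambda>_ _. 0) \<pi> 1 (dif A) (dif M)"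
proof -
  interpret quot_alg A M "\<lambda>_ _. 0" "\<lambda>_ _. 0" \<pi> by (rule symmetric_quot_alg[OF assms])
  have d: "degree_map A A 1 (dif A)" "degree_map M M 1 (dif M)"
    using A M by (simp_all add: graded_comm_dga_def dg_module_def cochain_complex_def)
  show ?thesis
  proof
    show "dif A (a * b) = dif A a * b + sg m (a * dif A b)" if "a \<in> grd A m" for a m b
      using A that unfolding graded_comm_dga_def by blast
    show "dif M (smul M a q) = smul M (dif A a) q + sg m (smul M a (dif M q))" if "a \<in> grd A m" for a m q
      using M that unfolding dg_module_def by blast
  qed (simp_all add: d degree_mapD(6)[OF d(1)] degree_mapD(6)[OF d(2)])
qed

text \<open>
  A morphism \<open>k\<close> of modules, which extends to a morphism \<open>F\<close> of symmetric algebras.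
\<close>

locale sym_morphism =
  S: quot_alg A M "\<lambda>_ _. 0" "\<lambda>_ _. 0" \<pi> + R: quot_alg A N "\<lambda>_ _. 0" "\<lambda>_ _. 0" \<rho>
  for A :: "('k::field, 'a::ring) dg_alg" and M :: "('k, 'a, 'm::ab_group_add, 'y) dg_mod_scheme"
    and N :: "('k, 'a, 'n::ab_group_add, 'z) dg_mod_scheme"
    and \<pi> :: "('k, 'a \<times> 'm) free_alg \<Rightarrow> 'u::ring" and \<rho> :: "('k, 'a \<times> 'n) free_alg \<Rightarrow> 'v::ring" +
  fixes k :: "'m \<Rightarrow> 'n"
  assumes k: "degree_map M N 0 k" and k_smul: "k (smul M a q) = smul N a (k q)"
begin

abbreviation "F \<equiv> ext_morphism \<pi> \<rho> k"

lemma morphism_unique: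
  assumes "\<And>x y. F1 (x + y) = F1 x + F1 y" "\<And>x y. F1 (x * y) = F1 x * F1 y"
    "\<And>a. F1 (inA \<pi> a) = inA \<rho> a" "\<And>q. F1 (inM \<pi> q) = inM \<rho> (k q)"
    and "\<And>x y. F2 (x + y) = F2 x + F2 y" "\<And>x y. F2 (x * y) = F2 x * F2 y"
    "\<And>a. F2 (inA \<pi> a) = inA \<rho> a" "\<And>q. F2 (inM \<pi> q) = inM \<rho> (k q)"
  shows "F1 = F2"
proof
  have one: "F1 (S.\<kappa> 1) = F2 (S.\<kappa> 1)" unfolding S.inA_unt[symmetric] by (simp only: assms)
  show "F1 x = F2 x" for x
    by (rule S.quot_hom_eqI[where F = F1 and F' = F2]) (simp_all add: assms additive_def one)
qed

lemma F_exists: "\<exists>F. (\<forall>x y. F (x + y) = F x + F y) \<and> (\<forall>x y. F (x * y) = F x * F y) \<and>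
    (\<forall>c. F (S.\<kappa> c) = R.\<kappa> c) \<and> (\<forall>a. F (inA \<pi> a) = inA \<rho> a) \<and> (\<forall>q. F (inM \<pi> q) = inM \<rho> (k q))"
proof (rule S.lift_exists)
  show "unital_algebra R.\<kappa>" by (rule R.unital_algebra_axioms)
  show "additive (inA \<rho>)" by (rule R.inA_additive)
  show "additive (\<lambda>q. inM \<rho> (k q))" by (simp add: additive_def R.inM_add degree_mapD(4)[OF k])
  show "inM \<rho> (k q) * inA \<rho> a = sg (m * n) (inA \<rho> a * inM \<rho> (k q)) + inA \<rho> 0"
    if "a \<in> grd A m" "q \<in> grd M n" for a q m n
    by (rule R.comm_A[OF that(1)]) (use degree_mapD(2)[OF k that(2)] in simp)
  show "inM \<rho> (k q) * inM \<rho> (k r) = sg (m * n) (inM \<rho> (k r) * inM \<rho> (k q)) + inM \<rho> (k 0)"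
    if "q \<in> grd M m" "r \<in> grd M n" for q r m n
    using R.comm_M[of "k q" m "k r" n] degree_mapD(2)[OF k that(1)] degree_mapD(2)[OF k that(2)]
    by (simp add: degree_mapD(6)[OF k])
qed (simp_all add: R.inA_scl R.inA_mult R.inA_unt R.inM_scl R.inM_smul degree_mapD(5)[OF k] k_smul)

lemma F_add: "F (x + y) = F x + F y" and F_mult: "F (x * y) = F x * F y"
  and F_inA: "F (inA \<pi> a) = inA \<rho> a" and F_inM: "F (inM \<pi> q) = inM \<rho> (k q)"
proof -
  have "\<exists>!F. (\<forall>x y. F (x + y) = F x + F y) \<and> (\<forall>x y. F (x * y) = F x * F y) \<and>
      (\<forall>a. F (inA \<pi> a) = inA \<rho> a) \<and> (\<forall>q. F (inM \<pi> q) = inM \<rho> (k q))"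
  proof -
    obtain F1 where F1: "\<forall>x y. F1 (x + y) = F1 x + F1 y" "\<forall>x y. F1 (x * y) = F1 x * F1 y"
      "\<forall>a. F1 (inA \<pi> a) = inA \<rho> a" "\<forall>q. F1 (inM \<pi> q) = inM \<rho> (k q)"
      using F_exists by blast
    show ?thesis
    proof (rule ex1I[of _ F1])
      fix F2 assume "(\<forall>x y. F2 (x + y) = F2 x + F2 y) \<and> (\<forall>x y. F2 (x * y) = F2 x * F2 y) \<and>
        (\<forall>a. F2 (inA \<pi> a) = inA \<rho> a) \<and> (\<forall>q. F2 (inM \<pi> q) = inM \<rho> (k q))"
      then show "F2 = F1" using F1 by (intro morphism_unique) auto
    qed (use F1 in auto)
  qed
  from theI'[OF this] show "F (x + y) = F x + F y" "F (x * y) = F x * F y"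
    "F (inA \<pi> a) = inA \<rho> a" "F (inM \<pi> q) = inM \<rho> (k q)"
    by (simp_all add: ext_morphism_def)
qed

lemma F_additive: "additive F"
  by (simp add: additive_def F_add)

lemma F_scalar: "F (S.\<kappa> c) = R.\<kappa> c"
  by (simp add: S.scalar_inA R.scalar_inA F_inA)

lemma F_degree_map: "degree_map S.U R.U 0 F"
  unfolding degree_map_def
proof (intro conjI allI ballI)
  show "Vector_Spaces.linear (scl S.U) (scl R.U) F"
    by (intro linearI graded_vector_space[OF S.graded_quot] graded_vector_space[OF R.graded_quot])
       (simp_all add: F_add F_mult F_scalar)
  show "F x \<in> grd R.U (n + 0)" if "x \<in> grd S.U n" for n x
    unfolding add_0_right using that
  proof (induction rule: S.quot_grd_induct)
    case (inM q m n x)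
    have "inM \<rho> (k q) \<in> grd R.U m" using degree_mapD(2)[OF k inM(1)] by (simp add: R.inM_degree)
    then show ?case using inM by (simp add: F_mult F_inM R.grd_quot_mult)
  qed (simp_all add: F_add F_mult F_inA F_scalar R.grd_quot_zero R.grd_quot_add R.scalar_degree
        R.grd_quot_mult R.inA_degree additive.zero[OF F_additive])
qed

end


section \<open>The contraction of symmetric algebras\<close>

text \<open>
  The derivations \<open>S.D\<close>, \<open>R.D\<close> and \<open>h'\<close> extend the two differentials and the homotopy, and \<open>P\<close> and
  \<open>J\<close> extend the projection \<open>p0\<close> and the inclusion \<open>j0\<close>.
\<close>

locale sym_contraction =
  fixes A :: "('k::field_char_0, 'a::ring) dg_alg"
    and K :: "('k, 'a, 'q::ab_group_add, 'y) dg_mod_scheme" and M :: "('k, 'a, 'r::ab_group_add, 'z) dg_mod_scheme"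
    and p0 :: "'q \<Rightarrow> 'r" and j0 :: "'r \<Rightarrow> 'q" and h0 :: "'q \<Rightarrow> 'q"
    and \<sigma> :: "('k, 'a \<times> 'q) free_alg \<Rightarrow> 's::ring"
    and \<rho> :: "('k, 'a \<times> 'r) free_alg \<Rightarrow> 't::ring"
  assumes A: "graded_comm_dga A" and K: "dg_module A K" and M: "dg_module A M"
    and con: "A_linear_contraction A K M p0 j0 h0"
    and sym_K: "symmetric_algebra A K \<sigma>" and sym_M: "symmetric_algebra A M \<rho>"
begin

lemma con_facts:
  "degree_map K M 0 p0" "degree_map M K 0 j0" "degree_map K K (-1) h0"
  "p0 (dif K x) = dif M (p0 x)" "j0 (dif M y) = dif K (j0 y)" "p0 (j0 y) = y"
  "h0 (dif K x) + dif K (h0 x) = x - j0 (p0 x)" "h0 (h0 x) = 0" "h0 (j0 y) = 0" "p0 (h0 x) = 0"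
  "p0 (smul K a x) = smul M a (p0 x)" "j0 (smul M a y) = smul K a (j0 y)"
  "a \<in> grd A n \<Longrightarrow> h0 (smul K a x) = sg n (smul K a (h0 x))"
  using con by (simp_all add: A_linear_contraction_def contraction_def)

lemma complexes: "cochain_complex A" "cochain_complex K" "cochain_complex M"
  using A K M by (simp_all add: graded_comm_dga_def dg_module_def)

lemma dif_facts:
  "degree_map A A 1 (dif A)" "degree_map K K 1 (dif K)" "degree_map M M 1 (dif M)"
  "dif A (dif A a) = 0" "dif K (dif K x) = 0" "dif M (dif M y) = 0"
  using complexes by (simp_all add: cochain_complex_def)

sublocale S: quot_derivation A K "\<lambda>_ _. 0" "\<lambda>_ _. 0" \<sigma> 1 "dif A" "dif K"
  by (rule symmetric_differential[OF A K sym_K])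

sublocale H: quot_derivation A K "\<lambda>_ _. 0" "\<lambda>_ _. 0" \<sigma> "-1" "\<lambda>_. 0" h0
proof
  have "vector_space (scl A)" by (rule graded_vector_space[OF S.grA])
  then show "degree_map A A (-1) (\<lambda>_. 0)"
    by (simp add: degree_map_def linear_zero grd_zero[OF S.grA])
  show "h0 (smul K a q) = smul K 0 q + sg m (smul K a (h0 q))" if "a \<in> grd A m" for a m q
    using con_facts(13)[OF that] by (simp add: additive.zero[OF S.smul_additive(2)])
qed (simp_all add: con_facts degree_mapD(6)[OF con_facts(3)])

sublocale R: quot_derivation A M "\<lambda>_ _. 0" "\<lambda>_ _. 0" \<rho> 1 "dif A" "dif M"
  by (rule symmetric_differential[OF A M sym_M])

sublocale P: sym_morphism A K M \<sigma> \<rho> p0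
  by unfold_locales (simp_all add: con_facts)

sublocale J: sym_morphism A M K \<rho> \<sigma> j0
  by unfold_locales (simp_all add: con_facts)

abbreviation "P \<equiv> ext_morphism \<sigma> \<rho> p0"
abbreviation "J \<equiv> ext_morphism \<rho> \<sigma> j0"
abbreviation "h' \<equiv> H.D"

lemmas P_zero = additive.zero[OF P.F_additive] and J_zero = additive.zero[OF J.F_additive]

lemma P_J: "P (J y) = y"
  by (induction y rule: R.quot_induct)
     (simp_all add: P.F_add P.F_mult P.F_inA P.F_inM P.F_scalar J.F_add J.F_mult J.F_inA J.F_inM
        J.F_scalar con_facts)

lemma tw_p0: "p0 (tw K q) = tw M (p0 q)" and tw_j0: "j0 (tw M r) = tw K (j0 r)"
  using tw_degree_map[OF S.grM R.grM con_facts(1), of q] tw_degree_map[OF R.grM S.grM con_facts(2), of r]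
  by simp_all

lemma P_D: "P (S.D x) = R.D (P x)"
  by (induction x rule: S.quot_induct)
     (simp_all add: P.F_add P.F_mult P.F_inA P.F_inM P.F_scalar S.D_add S.D_mult S.D_inA S.D_inM S.D_scalar
        R.D_add R.D_mult R.D_inA R.D_inM R.D_scalar con_facts S.T_inA S.T_inM R.T_inA R.T_inM tw_p0
        P_zero)

lemma J_D: "J (R.D y) = S.D (J y)"
  by (induction y rule: R.quot_induct)
     (simp_all add: J.F_add J.F_mult J.F_inA J.F_inM J.F_scalar S.D_add S.D_mult S.D_inA S.D_inM S.D_scalar
        R.D_add R.D_mult R.D_inA R.D_inM R.D_scalar con_facts S.T_inA S.T_inM R.T_inA R.T_inM tw_j0
        J_zero)

lemma D_square: "S.D (S.D x) = 0" and h'_square: "h' (h' x) = 0" and R_square: "R.D (R.D y) = 0"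
  by (rule S.D_square H.D_square R.D_square; simp add: dif_facts con_facts)+

text \<open>
  The commutator \<open>N\<close> of $h'$ with the differential is the derivation that counts the factors in
  \<open>Z\<close>, the kernel of \<open>p0\<close>.
\<close>

definition N :: "'s \<Rightarrow> 's" where "N x = h' (S.D x) + S.D (h' x)"

lemma N_add: "N (x + y) = N x + N y"
  by (simp add: N_def S.D_add H.D_add)

lemma N_mult: "N (x * y) = N x * y + x * N y"
  unfolding N_def
  by (rule S.odd_derivations_commutator[OF H.D_additive H.D_mult H.T_D S.D_additive S.D_mult S.T_D])

lemma N_inA: "N (inA \<sigma> a) = 0" and N_inM: "N (inM \<sigma> q) = inM \<sigma> (q - j0 (p0 q))"
  by (simp_all add: N_def S.D_inA H.D_inA S.D_inM H.D_inM additive.zero[OF S.D_additive]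
      con_facts(7) flip: S.inM_add)

lemma N_scalar: "N (S.\<kappa> c) = 0"
  by (simp add: S.scalar_inA N_inA)

lemma N_D: "N (S.D x) = S.D (N x)" and N_h': "N (h' x) = h' (N x)"
  by (simp_all add: N_def D_square h'_square S.D_add H.D_add additive.zero[OF S.D_additive]
      additive.zero[OF H.D_additive])

text \<open>The complement of the image of \<open>j0\<close>; the projection to it is \<open>q - j0 (p0 q)\<close>.\<close>

definition Z :: "'q set" where "Z = {q. p0 q = 0}"

lemma Z_I: "q - j0 (p0 q) \<in> Z"
  by (simp add: Z_def degree_mapD(7)[OF con_facts(1)] con_facts(6))

abbreviation "W i \<equiv> A_submodule \<sigma> hull {prods \<sigma> zs | zs. length zs = i \<and> set zs \<subseteq> Z}"
abbreviation "Zp \<equiv> Z_part \<sigma> J Z"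

lemma Zp_zero: "0 \<in> Zp i" and Zp_add: "x \<in> Zp i \<Longrightarrow> y \<in> Zp i \<Longrightarrow> x + y \<in> Zp i"
  and Zp_inA: "x \<in> Zp i \<Longrightarrow> inA \<sigma> a * x \<in> Zp i"
  unfolding Z_part_def by (fact submodule_hull_zero submodule_hull_add submodule_hull_inA)+

lemma Zp_gen: "w \<in> W i \<Longrightarrow> J s * w \<in> Zp i"
  unfolding Z_part_def by (rule hull_inc) blast

lemma Zp_induct [consumes 1, case_names gen zero add inA]:
  assumes "x \<in> Zp i" and "\<And>s w. w \<in> W i \<Longrightarrow> Q (J s * w)" "Q 0"
    and "\<And>x y. x \<in> Zp i \<Longrightarrow> y \<in> Zp i \<Longrightarrow> Q x \<Longrightarrow> Q y \<Longrightarrow> Q (x + y)"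
    and "\<And>a x. x \<in> Zp i \<Longrightarrow> Q x \<Longrightarrow> Q (inA \<sigma> a * x)"
  shows "Q x"
  using assms(1)[unfolded Z_part_def]
  by (rule submodule_hull_induct) (use assms(2-5)[unfolded Z_part_def] in auto)

lemma Zp_J: "x \<in> Zp i \<Longrightarrow> J s * x \<in> Zp i"
proof (induction arbitrary: s rule: Zp_induct)
  case (gen s' w)
  then show ?case using Zp_gen[of w i "s * s'"] by (simp add: J.F_mult mult.assoc)
next
  case (inA a x)
  from inA(2)[of "s * inA \<rho> a"] show ?case by (simp add: J.F_mult J.F_inA mult.assoc)
qed (simp_all add: Zp_zero Zp_add distrib_left)

lemma comm_hom: "q \<in> grd K m \<Longrightarrow> x \<in> grd S.U n \<Longrightarrow> inM \<sigma> q * x = sg (m * n) (x * inM \<sigma> q)"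
proof (rotate_tac, induction rule: S.quot_grd_induct)
  case one
  then show ?case by (simp add: S.scalar_central)
next
  case (inA a k n x)
  have "inM \<sigma> q * (inA \<sigma> a * x) = sg (k * m) (inA \<sigma> a * (inM \<sigma> q * x))"
    using S.comm_A[OF inA(1,4)] by (simp add: sg_mult_left flip: mult.assoc)
  then show ?case using inA by (simp add: sg_mult_right sg_sg mult.assoc algebra_simps)
next
  case (inM r k n x)
  have "inM \<sigma> q * (inM \<sigma> r * x) = sg (m * k) (inM \<sigma> r * (inM \<sigma> q * x))"
    using S.comm_M[OF inM(4,1)] by (simp add: sg_mult_left flip: mult.assoc)
  then show ?case using inM by (simp add: sg_mult_right sg_sg mult.assoc algebra_simps)
qed (simp_all add: distrib_left distrib_right sg_add)

text \<open>
  Graded commutativity moves an element of \<open>Z\<close> past homogeneous elements only, so that the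
  homogeneous components of an element of \<open>Z\<close> are needed, which are again in \<open>Z\<close>.
\<close>

lemma Z_components: "z \<in> Z \<Longrightarrow> hcomp K z n \<in> Z"
proof -
  assume "z \<in> Z"
  have "p0 (hcomp K z n) = hcomp M (p0 z) n"
  proof (induction z rule: graded_induct[OF S.grM, case_names add homogeneous])
    case (homogeneous m z)
    then have "p0 z \<in> grd M m" using degree_mapD(2)[OF con_facts(1)] by force
    then show ?case using homogeneous
      by (simp add: hcomp_homogeneous[OF S.grM] hcomp_homogeneous[OF R.grM] degree_mapD(6)[OF con_facts(1)])
  qed (simp add: hcomp_add[OF S.grM] hcomp_add[OF R.grM] degree_mapD(4)[OF con_facts(1)])
  also have "hcomp M (p0 z) n = 0"
    using \<open>z \<in> Z\<close> hcomp_homogeneous[OF R.grM grd_zero[OF R.grM, of n]] by (simp add: Z_def)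
  finally show ?thesis by (simp add: Z_def)
qed

lemma Zp_inM_hom:
  assumes z: "z \<in> Z" "z \<in> grd K m"
  shows "x \<in> Zp i \<Longrightarrow> inM \<sigma> z * x \<in> Zp (Suc i)"
proof (induction rule: Zp_induct)
  case (gen s w)
  from gen have w: "inM \<sigma> z * w \<in> W (Suc i)"
  proof (induction rule: submodule_hull_induct)
    case (gen x)
    then obtain zs where zs: "x = prods \<sigma> zs" "length zs = i" "set zs \<subseteq> Z" by blast
    then show ?case using z(1) by (intro hull_inc) (auto simp: S.prods_Cons intro!: exI[of _ "z # zs"])
  next
    case (inA a x)
    show ?case
    proof (induction a rule: graded_induct[OF S.grA, case_names add homogeneous])
      case (homogeneous n a)
      have "inM \<sigma> z * (inA \<sigma> a * x) = inA \<sigma> (sg (n * m) a) * (inM \<sigma> z * x)"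
        using S.comm_A[OF homogeneous z(2)] by (simp add: sg_mult_left S.inA_sg flip: mult.assoc)
      then show ?case using submodule_hull_inA[OF inA(2)] by simp
    qed (simp add: S.inA_add distrib_left distrib_right submodule_hull_add)
  qed (simp_all add: distrib_left submodule_hull_zero submodule_hull_add)
  show ?case
  proof (induction s rule: graded_induct[OF R.graded_quot, case_names add homogeneous])
    case (homogeneous n s)
    then have "J s \<in> grd S.U n" using degree_mapD(2)[OF J.F_degree_map] by force
    from comm_hom[OF z(2) this] have "inM \<sigma> z * (J s * w) = J (sg (m * n) s) * (inM \<sigma> z * w)"
      by (simp add: sg_mult_left additive_sg[OF J.F_additive] flip: mult.assoc)
    then show ?case using Zp_gen[OF w] by simp
  qed (simp add: J.F_add distrib_left distrib_right Zp_add)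
next
  case (inA a x)
  show ?case
  proof (induction a rule: graded_induct[OF S.grA, case_names add homogeneous])
    case (homogeneous n a)
    have "inM \<sigma> z * (inA \<sigma> a * x) = inA \<sigma> (sg (n * m) a) * (inM \<sigma> z * x)"
      using S.comm_A[OF homogeneous z(2)] by (simp add: sg_mult_left S.inA_sg flip: mult.assoc)
    then show ?case using Zp_inA[OF inA(2)] by simp
  qed (simp add: S.inA_add distrib_left distrib_right Zp_add)
qed (simp_all add: distrib_left Zp_zero Zp_add)

lemma Zp_inM: "z \<in> Z \<Longrightarrow> x \<in> Zp i \<Longrightarrow> inM \<sigma> z * x \<in> Zp (Suc i)"
proof -
  assume z: "z \<in> Z" and x: "x \<in> Zp i"
  have "inM \<sigma> (\<Sum>n\<in>I. hcomp K z n) * x \<in> Zp (Suc i)" if "finite I" for I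
    using that
    by (induction I) (simp_all add: Zp_zero S.inM_add distrib_right Zp_add
        Zp_inM_hom[OF Z_components[OF z] hcomp(1)[OF S.grM] x])
  then show ?thesis using hcomp(2,3)[OF S.grM, of z] by metis
qed

text \<open>
  The decomposition into the parts \<open>Zp i\<close> is exhibited by the homomorphism \<open>\<omega>\<close> to polynomials
  that multiplies the component in \<open>Z\<close> of each generator by the variable.  Its coefficients give the
  projections \<open>part\<close>; the exponents are integers, those of negative exponents being zero.
\<close>

definition \<omega>_spec :: "('s \<Rightarrow> (int \<Rightarrow>\<^sub>0 's)) \<Rightarrow> bool" where
  "\<omega>_spec F \<longleftrightarrow> (\<forall>x y. F (x + y) = F x + F y) \<and> (\<forall>x y. F (x * y) = F x * F y) \<and>
    (\<forall>c. F (S.\<kappa> c) = Poly_Mapping.single 0 (S.\<kappa> c)) \<and>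
    (\<forall>a. F (inA \<sigma> a) = Poly_Mapping.single 0 (inA \<sigma> a)) \<and>
    (\<forall>q. F (inM \<sigma> q) = Poly_Mapping.single 0 (inM \<sigma> (j0 (p0 q))) + Poly_Mapping.single 1 (inM \<sigma> (q - j0 (p0 q))))"

definition \<omega> :: "'s \<Rightarrow> (int \<Rightarrow>\<^sub>0 's)" where "\<omega> = (SOME F. \<omega>_spec F)"

lemma single_sg: "Poly_Mapping.single n (sg m x) = sg m (Poly_Mapping.single n x)"
  for x :: "'b::ring"
  by (simp add: sg_def single_uminus)

lemma \<omega>_exists: "\<exists>F. \<omega>_spec F"
  unfolding \<omega>_spec_def
proof (rule S.lift_exists)
  show "unital_algebra (\<lambda>c. Poly_Mapping.single (0::int) (S.\<kappa> c))" by (rule S.laurent_unital)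
  let ?fM = "\<lambda>q. Poly_Mapping.single (0::int) (inM \<sigma> (j0 (p0 q))) + Poly_Mapping.single 1 (inM \<sigma> (q - j0 (p0 q)))"
  note lin = degree_mapD(4,5,6)[OF con_facts(1)] degree_mapD(4,5,6)[OF con_facts(2)] con_facts(11,12)
  show "additive (\<lambda>a. Poly_Mapping.single (0::int) (inA \<sigma> a))" by (simp add: additive_def S.inA_add single_add)
  show "additive ?fM"
    by (simp add: additive_def lin S.inM_add S.inM_diff single_add single_diff algebra_simps)
  show "?fM (scl K c q) = Poly_Mapping.single 0 (S.\<kappa> c) * ?fM q" for c q
    by (simp add: lin S.inM_scl S.inM_diff distrib_left mult_single right_diff_distrib)
  show "?fM (smul K a q) = Poly_Mapping.single 0 (inA \<sigma> a) * ?fM q" for a q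
    by (simp add: lin S.inM_smul S.inM_diff distrib_left mult_single right_diff_distrib)
  have deg: "j0 (p0 q) \<in> grd K n" "q - j0 (p0 q) \<in> grd K n" if "q \<in> grd K n" for q n
  proof -
    show "j0 (p0 q) \<in> grd K n"
      using degree_mapD(2)[OF con_facts(2) degree_mapD(2)[OF con_facts(1) that]] by simp
    with that show "q - j0 (p0 q) \<in> grd K n" by (rule grd_diff[OF S.grM])
  qed
  show "?fM q * Poly_Mapping.single 0 (inA \<sigma> a) = sg (m * n) (Poly_Mapping.single 0 (inA \<sigma> a) * ?fM q) +
      Poly_Mapping.single 0 (inA \<sigma> 0)" if "a \<in> grd A m" "q \<in> grd K n" for a q m n
    using S.comm_A[OF that(1) deg(1)[OF that(2)]] S.comm_A[OF that(1) deg(2)[OF that(2)]]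
    by (simp add: distrib_left distrib_right mult_single single_sg sg_add)
  show "?fM q * ?fM r = sg (m * n) (?fM r * ?fM q) + ?fM 0" if "q \<in> grd K m" "r \<in> grd K n" for q r m n
    using S.comm_M[OF deg(1)[OF that(1)] deg(1)[OF that(2)]] S.comm_M[OF deg(1)[OF that(1)] deg(2)[OF that(2)]]
      S.comm_M[OF deg(2)[OF that(1)] deg(1)[OF that(2)]] S.comm_M[OF deg(2)[OF that(1)] deg(2)[OF that(2)]]
    by (simp add: distrib_left distrib_right mult_single single_sg sg_add lin add.commute add.left_commute)
qed (simp_all add: S.inA_scl S.inA_mult S.inA_unt mult_single)

lemma \<omega>_add: "\<omega> (x + y) = \<omega> x + \<omega> y" and \<omega>_mult: "\<omega> (x * y) = \<omega> x * \<omega> y"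
  and \<omega>_scalar: "\<omega> (S.\<kappa> c) = Poly_Mapping.single 0 (S.\<kappa> c)"
  and \<omega>_inA: "\<omega> (inA \<sigma> a) = Poly_Mapping.single 0 (inA \<sigma> a)"
  and \<omega>_inM: "\<omega> (inM \<sigma> q) = Poly_Mapping.single 0 (inM \<sigma> (j0 (p0 q))) + Poly_Mapping.single 1 (inM \<sigma> (q - j0 (p0 q)))"
  using someI_ex[OF \<omega>_exists] unfolding \<omega>_def[symmetric] by (simp_all add: \<omega>_spec_def)

definition part :: "'s \<Rightarrow> int \<Rightarrow> 's" where "part x k = Poly_Mapping.lookup (\<omega> x) k"

lemma part_add: "part (x + y) k = part x k + part y k"
  and part_scalar: "part (S.\<kappa> c) k = (if k = 0 then S.\<kappa> c else 0)"
  and part_inA: "part (inA \<sigma> a * x) k = inA \<sigma> a * part x k"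
  and part_inM: "part (inM \<sigma> q * x) k = inM \<sigma> (j0 (p0 q)) * part x k + inM \<sigma> (q - j0 (p0 q)) * part x (k - 1)"
  by (simp_all add: part_def \<omega>_add \<omega>_scalar \<omega>_mult \<omega>_inA \<omega>_inM lookup_add lookup_single_mult distrib_right
      lookup_single when_def)

lemma part_zero: "part 0 k = 0"
  using part_add[of 0 0 k] by simp

lemma part_scale: "part (S.\<kappa> c * x) k = S.\<kappa> c * part x k"
  by (simp add: S.scalar_inA part_inA)

lemma part_total: "x = (\<Sum>k\<in>Poly_Mapping.keys (\<omega> x). part x k)"
proof -
  have "total (\<omega> x) = x"
    by (induction x rule: S.quot_induct)
       (simp_all add: \<omega>_add \<omega>_mult \<omega>_scalar \<omega>_inA \<omega>_inM total_add total_mult total_single S.inM_diff)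
  then show ?thesis by (simp add: total_def psum_def part_def)
qed

lemma part_degree: "x \<in> grd S.U n \<Longrightarrow> part x k \<in> grd S.U n"
proof (induction arbitrary: k rule: S.quot_grd_induct)
  case (inM q m n x)
  have "j0 (p0 q) \<in> grd K m"
    using degree_mapD(2)[OF con_facts(2) degree_mapD(2)[OF con_facts(1) inM(1)]] by simp
  moreover from this have "q - j0 (p0 q) \<in> grd K m" using inM(1) by (intro grd_diff[OF S.grM])
  ultimately show ?case using inM
    by (auto simp: part_inM intro!: S.grd_quot_add S.grd_quot_mult S.inM_degree)
qed (simp_all add: part_zero part_add part_scalar part_inA S.grd_quot_zero S.grd_quot_add S.scalar_degree
      S.grd_quot_mult S.inA_degree)

lemma part_filt: "x \<in> filt \<sigma> i \<Longrightarrow> part x k \<in> filt \<sigma> i"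
proof (induction arbitrary: k rule: S.filt_induct)
  case (prods qs)
  have "part (prods \<sigma> qs) k \<in> filt \<sigma> (int (length qs))" for k
  proof (induction qs arbitrary: k)
    case Nil
    show ?case using S.filt_prods[of "[]" 0] by (simp add: S.prods_Nil part_scalar S.filt_zero)
  next
    case (Cons q qs)
    then show ?case
      using S.filt_add[OF S.filt_inM[OF Cons[of k]] S.filt_inM[OF Cons[of "k - 1"]]]
      by (simp add: S.prods_Cons part_inM add.commute)
  qed
  then show ?case using S.filt_mono[OF prods] by blast
qed (simp_all add: part_zero part_add part_inA S.filt_zero S.filt_add S.filt_inA)

lemma part_Zp: "if k < 0 then part x k = 0 else part x k \<in> Zp (nat k)"
proof (induction x arbitrary: k rule: S.quot_induct)
  case one
  have "S.\<kappa> 1 \<in> W 0" using hull_inc[of "prods \<sigma> []" _ "A_submodule \<sigma>"] by (force simp: S.prods_Nil)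
  from Zp_gen[OF this, of "R.\<kappa> 1"] show ?case
    by (simp add: part_scalar Zp_zero J.F_scalar S.scalar_one)
next
  case (inM q m x)
  have 1: "inM \<sigma> (j0 (p0 q)) * part x k \<in> Zp (nat k)" if "k \<ge> 0"
    using Zp_J[of "part x k" "nat k" "inM \<rho> (p0 q)"] inM(2)[of k] that by (simp add: J.F_inM)
  have 2: "inM \<sigma> (q - j0 (p0 q)) * part x (k - 1) \<in> Zp (nat k)" if "k \<ge> 0"
  proof (cases "k = 0")
    case True
    then show ?thesis using inM(2)[of "-1"] by (simp add: Zp_zero)
  next
    case False
    then have "nat k = Suc (nat (k - 1))" using that by simp
    then show ?thesis using Zp_inM[OF Z_I] inM(2)[of "k - 1"] that False by (simp split: if_splits)
  qed
  show ?case
  proof (cases "k < 0")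
    case True
    then show ?thesis using inM(2)[of k] inM(2)[of "k - 1"] by (simp add: part_inM)
  next
    case False
    then show ?thesis using 1 2 by (simp add: part_inM Zp_add)
  qed
qed (simp_all add: part_add part_inA Zp_add Zp_inA)

lemma part_N: "part (N x) k = S.\<kappa> (of_int k) * part x k"
proof (induction x arbitrary: k rule: S.quot_induct)
  case one
  have "S.\<kappa> 0 = 0" using S.scalar_add[of 0 0] by simp
  then show ?case by (simp add: N_scalar part_zero part_scalar)
next
  case (inA a m x)
  then show ?case by (simp add: N_mult N_inA part_inA S.scalar_mult_right)
next
  case (inM q m x)
  let ?u = "inM \<sigma> (j0 (p0 q))" and ?v = "inM \<sigma> (q - j0 (p0 q))"
  have jp: "j0 (p0 (q - j0 (p0 q))) = 0"
    using Z_I[of q] by (simp add: Z_def degree_mapD(6)[OF con_facts(2)])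
  have e: "S.\<kappa> (of_int k) = S.\<kappa> (of_int (k - 1)) + S.\<kappa> 1"
    by (simp add: S.scalar_add[symmetric])
  have "part (N (inM \<sigma> q * x)) k = ?v * part x (k - 1) + (?u * part (N x) k + ?v * part (N x) (k - 1))"
    unfolding N_mult N_inM part_add part_inM by (simp only: jp) simp
  also have "\<dots> = ?v * part x (k - 1) + (S.\<kappa> (of_int k) * (?u * part x k) + S.\<kappa> (of_int (k - 1)) * (?v * part x (k - 1)))"
    by (simp only: inM(2) S.scalar_mult_right)
  also have "\<dots> = S.\<kappa> (of_int k) * (?u * part x k) + S.\<kappa> (of_int k) * (?v * part x (k - 1))"
    unfolding e by (simp add: distrib_right S.scalar_one)
  also have "\<dots> = S.\<kappa> (of_int k) * part (inM \<sigma> q * x) k"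
    by (simp add: part_inM distrib_left)
  finally show ?case .
qed (simp add: N_add part_add distrib_left)

lemma N_J: "N (J s) = 0"
  by (induction s rule: R.quot_induct)
     (simp_all add: J.F_add N_add J.F_scalar N_scalar J.F_mult N_mult J.F_inA N_inA J.F_inM N_inM
        con_facts degree_mapD(6)[OF con_facts(2)])

lemma N_W: "w \<in> W i \<Longrightarrow> N w = S.\<kappa> (of_nat i) * w"
proof (induction rule: submodule_hull_induct)
  case (gen x)
  then obtain zs where zs: "x = prods \<sigma> zs" "length zs = i" "set zs \<subseteq> Z" by blast
  have "N (prods \<sigma> zs) = S.\<kappa> (of_nat (length zs)) * prods \<sigma> zs" using zs(3)
  proof (induction zs)
    case Nil
    have "S.\<kappa> 0 = 0" using S.scalar_add[of 0 0] by simp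
    then show ?case by (simp add: S.prods_Nil N_scalar)
  next
    case (Cons z zs)
    then have "p0 z = 0" by (simp add: Z_def)
    then have "N (inM \<sigma> z) = inM \<sigma> z" by (simp add: N_inM degree_mapD(6)[OF con_facts(2)])
    then show ?case using Cons
      by (simp add: S.prods_Cons N_mult S.scalar_mult_right S.scalar_add distrib_right S.scalar_one)
  qed
  then show ?case by (simp add: zs)
next
  case zero
  show ?case using N_scalar[of 0] N_add[of 0 0] by simp
next
  case (inA a x)
  then show ?case by (simp add: N_mult N_inA S.scalar_mult_right)
qed (simp add: N_add distrib_left)

lemma N_Zp: "x \<in> Zp i \<Longrightarrow> N x = S.\<kappa> (of_nat i) * x"
proof (induction rule: Zp_induct)
  case (gen s w)
  then show ?case by (simp add: N_mult N_J N_W S.scalar_mult_right)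
next
  case zero
  show ?case using N_add[of 0 0] by simp
next
  case (inA a x)
  then show ?case by (simp add: N_mult N_inA S.scalar_mult_right)
qed (simp add: N_add distrib_left)

lemma scalar_cancel: "S.\<kappa> c * x = S.\<kappa> d * x \<Longrightarrow> c = d \<or> x = 0"
proof -
  interpret V: vector_space "\<lambda>c x. S.\<kappa> c * x" by (rule S.scalar_vector_space)
  assume "S.\<kappa> c * x = S.\<kappa> d * x"
  then show ?thesis by simp
qed

text \<open>
  By \<open>part_N\<close> and because the characteristic is zero, an eigenvector of \<open>N\<close> for the eigenvalue \<open>i\<close>
  has no part other than the one of index \<open>i\<close>.
\<close>

lemma eigen_parts:
  assumes "N x = S.\<kappa> (of_nat i) * x"
  shows "part x k = (if k = int i then x else 0)"
proof -
  have z: "part x k = 0" if "k \<noteq> int i" for k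
  proof -
    have "S.\<kappa> (of_int k) * part x k = S.\<kappa> (of_nat i) * part x k"
      using part_N[of x k] by (simp add: assms part_scale)
    moreover have "of_int k \<noteq> (of_nat i :: 'k)" using that by (metis of_int_eq_iff of_int_of_nat_eq)
    ultimately show ?thesis using scalar_cancel by blast
  qed
  have "x = part x (int i)"
  proof (cases "part x (int i) = 0")
    case True
    then have "part x k = 0" for k using z by metis
    then show ?thesis using part_total[of x] by simp
  next
    case False
    then have "Poly_Mapping.keys (\<omega> x) = {int i}" using z by (auto simp: part_def in_keys_iff)
    then show ?thesis using part_total[of x] by simp
  qed
  then show ?thesis using z by auto
qed

lemma Zp_iff: "x \<in> Zp i \<longleftrightarrow> N x = S.\<kappa> (of_nat i) * x"
proof
  assume "N x = S.\<kappa> (of_nat i) * x"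
  from eigen_parts[OF this, of "int i"] part_Zp[of "int i" x] show "x \<in> Zp i" by simp
qed (rule N_Zp)

lemma Zp_D: "x \<in> Zp i \<Longrightarrow> S.D x \<in> Zp i" and Zp_h': "x \<in> Zp i \<Longrightarrow> h' x \<in> Zp i"
  using degree_mapD(5)[OF S.D_degree_map] degree_mapD(5)[OF H.D_degree_map]
  by (simp_all add: Zp_iff N_D N_h')

lemma Zp_scalar: "x \<in> Zp i \<Longrightarrow> S.\<kappa> c * x \<in> Zp i"
  by (simp add: S.scalar_inA Zp_inA)

lemma Zp_decomp_induct [case_names Zp add]:
  assumes "\<And>i x. x \<in> Zp i \<Longrightarrow> Q x" "\<And>x y. Q x \<Longrightarrow> Q y \<Longrightarrow> Q (x + y)"
  shows "Q x"
proof -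
  have 1: "Q (part x k)" for k
    using assms(1)[of "part x k" "nat k"] assms(1)[OF Zp_zero[of 0]] part_Zp[of k x] by (auto split: if_splits)
  have "Q (\<Sum>k\<in>I. part x k)" if "finite I" for I
    using that by (induction I) (simp_all add: assms(1)[OF Zp_zero[of 0]] assms(2) 1)
  then show ?thesis using part_total[of x] finite_keys by metis
qed

text \<open>
  The extension of the homotopy is $h'$ divided by the number of factors in \<open>Z\<close>, and zero on the
  part without such factors.
\<close>

definition coef :: "int \<Rightarrow> 'k" where "coef k = (if k \<le> 0 then 0 else 1 / of_int k)"

definition Hx :: "'s \<Rightarrow> 's" where "Hx x = psum (\<lambda>k y. S.\<kappa> (coef k) * h' y) (\<omega> x)"

lemma Hx_coeff_additive: "additive (\<lambda>y. S.\<kappa> (coef k) * h' y)"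
  by (simp add: additive_def H.D_add distrib_left)

lemma Hx_sum: "Hx x = (\<Sum>k\<in>Poly_Mapping.keys (\<omega> x). S.\<kappa> (coef k) * h' (part x k))"
  by (simp add: Hx_def psum_def part_def)

lemma h'_scale: "h' (S.\<kappa> c * x) = S.\<kappa> c * h' x" and D_scale: "S.D (S.\<kappa> c * x) = S.\<kappa> c * S.D x"
  using degree_mapD(5)[OF H.D_degree_map, of c x] degree_mapD(5)[OF S.D_degree_map, of c x] by simp_all

lemma Hx_add: "Hx (x + y) = Hx x + Hx y"
  unfolding Hx_def \<omega>_add by (rule psum_add[OF Hx_coeff_additive])

lemma Hx_Zp: "x \<in> Zp i \<Longrightarrow> Hx x = S.\<kappa> (coef (int i)) * h' x"
proof -
  assume "x \<in> Zp i"
  then have "\<omega> x = Poly_Mapping.single (int i) x"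
    using eigen_parts[OF N_Zp] by (intro poly_mapping_eqI) (simp add: lookup_single when_def flip: part_def)
  then show ?thesis by (simp add: Hx_def psum_single[OF Hx_coeff_additive])
qed

lemma Hx_degree_map: "degree_map S.U S.U (-1) Hx"
  unfolding degree_map_def
proof (intro conjI allI ballI)
  show "Vector_Spaces.linear (scl S.U) (scl S.U) Hx"
  proof (intro linearI graded_vector_space[OF S.graded_quot])
    show "Hx (scl S.U c x) = scl S.U c (Hx x)" for c x
    proof (induction x rule: Zp_decomp_induct)
      case (Zp i x)
      then show ?case by (simp add: Hx_Zp[OF Zp] Hx_Zp[OF Zp_scalar[OF Zp]] h'_scale
            S.scalar_mult_right[of "S.\<kappa> (coef _)" c])
    qed (simp add: distrib_left Hx_add)
  qed (rule Hx_add)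
  show "Hx x \<in> grd S.U (n + - 1)" if "x \<in> grd S.U n" for n x
    unfolding Hx_sum
  proof (intro grd_sum[OF S.graded_quot])
    fix k
    show "S.\<kappa> (coef k) * h' (part x k) \<in> grd S.U (n + - 1)"
      using S.grd_quot_mult[OF S.scalar_degree degree_mapD(2)[OF H.D_degree_map part_degree[OF that]]] by simp
  qed
qed

lemma Hx_filt: "x \<in> filt \<sigma> i \<Longrightarrow> Hx x \<in> filt \<sigma> i"
  unfolding Hx_sum by (intro S.filt_sum S.filt_scalar H.D_filt part_filt)

lemma ext_homotopy_eq: "ext_homotopy A K \<sigma> \<rho> p0 j0 h0 = Hx"
  unfolding ext_homotopy_def Let_def Z_def[symmetric]
proof (rule the_equality)
  have "S.\<kappa> 0 = 0" using S.scalar_add[of 0 0] by simp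
  then show "Vector_Spaces.linear (scl S.U) (scl S.U) Hx \<and> (\<forall>x\<in>Zp 0. Hx x = 0) \<and>
      (\<forall>i>0. \<forall>x\<in>Zp i. Hx x = scl S.U (1 / of_nat i) (h' x))"
    using degree_mapD(1)[OF Hx_degree_map] by (auto simp: Hx_Zp coef_def)
  fix G assume G: "Vector_Spaces.linear (scl S.U) (scl S.U) G \<and> (\<forall>x\<in>Zp 0. G x = 0) \<and>
      (\<forall>i>0. \<forall>x\<in>Zp i. G x = scl S.U (1 / of_nat i) (h' x))"
  show "G = Hx"
  proof
    show "G x = Hx x" for x
    proof (induction x rule: Zp_decomp_induct)
      case (Zp i x)
      then show ?case using G \<open>S.\<kappa> 0 = 0\<close> by (cases "i = 0") (auto simp: Hx_Zp[OF Zp] coef_def)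
    qed (use linearD(3)[of "scl S.U" "scl S.U" G] G in \<open>auto simp: Hx_add\<close>)
  qed
qed

lemma J_P_Zp: "x \<in> Zp i \<Longrightarrow> J (P x) = (if i = 0 then x else 0)"
proof (induction rule: Zp_induct)
  case (gen s w)
  have "J (P w) = (if i = 0 then w else 0)" using gen
  proof (induction rule: submodule_hull_induct)
    case (gen x)
    then obtain zs where zs: "x = prods \<sigma> zs" "length zs = i" "set zs \<subseteq> Z" by blast
    then show ?case
      by (cases zs) (auto simp: S.prods_Nil S.prods_Cons P.F_scalar J.F_scalar P.F_mult P.F_inM Z_def J_zero)
  qed (simp_all add: P_zero J_zero P.F_add J.F_add P.F_mult J.F_mult P.F_inA J.F_inA)
  then show ?case by (simp add: P.F_mult J.F_mult P_J)
qed (simp_all add: P_zero J_zero P.F_add J.F_add P.F_mult J.F_mult P.F_inA J.F_inA)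

lemma sym_contraction: "contraction (with_dif S.U S.D) (with_dif R.U R.D) P J Hx"
proof -
  have k0: "S.\<kappa> 0 = 0" using S.scalar_add[of 0 0] by simp
  have lin: "S.D 0 = 0" "h' 0 = 0" "Hx 0 = 0"
    by (simp_all add: additive.zero[OF S.D_additive] additive.zero[OF H.D_additive]
        degree_mapD(6)[OF Hx_degree_map])
  have "Hx (S.D x) + S.D (Hx x) = x - J (P x)" for x
  proof (induction x rule: Zp_decomp_induct)
    case (Zp i x)
    have "Hx (S.D x) + S.D (Hx x) = S.\<kappa> (coef (int i)) * N x"
      by (simp add: Hx_Zp[OF Zp_D[OF Zp]] Hx_Zp[OF Zp] D_scale N_def distrib_left)
    also have "\<dots> = S.\<kappa> (coef (int i) * of_nat i) * x" by (simp add: N_Zp[OF Zp] S.scalar_mult mult.assoc)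
    also have "\<dots> = x - J (P x)" by (simp add: J_P_Zp[OF Zp] coef_def k0 S.scalar_one)
    finally show ?case .
  next
    case (add x y)
    have "Hx (S.D (x + y)) + S.D (Hx (x + y)) =
        (Hx (S.D x) + S.D (Hx x)) + (Hx (S.D y) + S.D (Hx y))"
      by (simp add: S.D_add Hx_add algebra_simps)
    also have "\<dots> = (x - J (P x)) + (y - J (P y))" by (simp only: add)
    finally show ?case by (simp add: P.F_add J.F_add)
  qed
  moreover have "Hx (Hx x) = 0" for x
  proof (induction x rule: Zp_decomp_induct)
    case (Zp i x)
    then show ?case by (simp add: Hx_Zp[OF Zp] Hx_Zp[OF Zp_scalar[OF Zp_h'[OF Zp]]] h'_scale h'_square)
  qed (simp add: Hx_add)
  moreover have "Hx (J y) = 0" for y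
  proof -
    have "J y \<in> Zp 0" by (simp add: Zp_iff N_J k0)
    then show ?thesis by (simp add: Hx_Zp coef_def k0)
  qed
  moreover have "P (Hx x) = 0" for x
  proof (induction x rule: Zp_decomp_induct)
    case (Zp i x)
    have "J (P (Hx x)) = 0"
    proof (cases "i = 0")
      case False
      then show ?thesis using J_P_Zp[OF Zp_scalar[OF Zp_h'[OF Zp]]] by (simp add: Hx_Zp[OF Zp])
    qed (simp add: Hx_Zp[OF Zp] coef_def k0 P_zero J_zero)
    then show ?case using P_J[of "P (Hx x)"] by (simp add: P_zero)
  qed (simp add: Hx_add P.F_add)
  ultimately show ?thesis
    unfolding contraction_def cochain_complex_def with_dif_simps graded_space_with_dif
      degree_map_with_dif_left degree_map_with_dif_right
    by (intro conjI allI S.graded_quot R.graded_quot S.D_degree_map R.D_degree_map P.F_degree_map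
        J.F_degree_map Hx_degree_map D_square R_square P_D J_D P_J)
qed

end


section \<open>The enveloping algebra and the perturbation\<close>

text \<open>
  The prefixes \<open>C.S\<close>, \<open>C.R\<close> and \<open>E\<close> refer to the symmetric algebra of \<open>\<K>\<close>, the symmetric algebra
  of \<open>M\<close> and the enveloping algebra.
\<close>

locale pbw_contraction =
  fixes A :: "('k::field_char_0, 'a::ring) dg_alg"
    and \<K> :: "('k, 'a, 'q::ab_group_add) lie_rinehart"
    and M :: "('k, 'a, 'r::ab_group_add) dg_mod"
    and p0 :: "'q \<Rightarrow> 'r" and j0 :: "'r \<Rightarrow> 'q" and h0 :: "'q \<Rightarrow> 'q"
    and \<sigma> :: "('k, 'a \<times> 'q) free_alg \<Rightarrow> 's::ring"
    and \<rho> :: "('k, 'a \<times> 'r) free_alg \<Rightarrow> 't::ring"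
    and \<upsilon> :: "('k, 'a \<times> 'q) free_alg \<Rightarrow> 'u::ring"
    and PBW :: "'s \<Rightarrow> 'u"
  assumes A: "graded_comm_dga A" and \<K>: "dg_lie_rinehart A \<K>" and M: "dg_module A M"
    and con: "A_linear_contraction A \<K> M p0 j0 h0"
    and sym_K: "symmetric_algebra A \<K> \<sigma>" and sym_M: "symmetric_algebra A M \<rho>"
    and env: "enveloping_algebra A \<K> \<upsilon>"
    and pbw: "pbw_isomorphism A \<K> \<sigma> \<upsilon> PBW"
begin

sublocale C: sym_contraction A \<K> M p0 j0 h0 \<sigma> \<rho>
  by unfold_locales (use A \<K> M con sym_K sym_M in \<open>simp_all add: dg_lie_rinehart_def\<close>)

sublocale E: quot_derivation A \<K> "anc \<K>" "brk \<K>" \<upsilon> 1 "dif A" "dif \<K>"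
proof -
  have K: "dg_module A \<K>" and lie: "graded_lie_algebra \<K>" and bil: "graded_bilinear \<K> A A (anc \<K>)"
    and anc_dif: "\<And>m q a. q \<in> grd \<K> m \<Longrightarrow> dif A (anc \<K> q a) = anc \<K> (dif \<K> q) a + sg m (anc \<K> q (dif A a))"
    and brk_dif: "\<And>m q r. q \<in> grd \<K> m \<Longrightarrow> dif \<K> (brk \<K> q r) = brk \<K> (dif \<K> q) r + sg m (brk \<K> q (dif \<K> r))"
    using \<K> unfolding dg_lie_rinehart_def by blast+
  interpret quot_alg A \<K> "anc \<K>" "brk \<K>" \<upsilon>
  proof
    show "anc \<K> q a \<in> grd A (m + n)" if "a \<in> grd A m" "q \<in> grd \<K> n" for a m q n
      using bil that unfolding graded_bilinear_def by (metis add.commute)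
    show "brk \<K> q r \<in> grd \<K> (m + n)" if "q \<in> grd \<K> m" "r \<in> grd \<K> n" for q m r n
      using lie that unfolding graded_lie_algebra_def graded_bilinear_def by blast
    show "quotient_by (two_sided_ideal hull (tensor_rels A \<K> \<union> module_rels A \<K> \<union>
        comm_rels A \<K> (anc \<K>) (brk \<K>))) \<upsilon>"
      using env by (simp add: enveloping_algebra_def env_rels_def comm_rels_def)
  qed (fact A K)+
  show "quot_derivation A \<K> (anc \<K>) (brk \<K>) \<upsilon> 1 (dif A) (dif \<K>)"
  proof
    show "dif A (a * b) = dif A a * b + sg m (a * dif A b)" if "a \<in> grd A m" for a m b
      using A that unfolding graded_comm_dga_def by blast
    show "dif \<K> (smul \<K> a q) = smul \<K> (dif A a) q + sg m (smul \<K> a (dif \<K> q))" if "a \<in> grd A m" for a m q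
      using K that unfolding dg_module_def by blast
  qed (simp_all add: C.dif_facts anc_dif brk_dif)
qed

abbreviation "U \<equiv> E.U"
abbreviation "\<delta>U \<equiv> E.D"

lemma pbw_facts:
  "bij PBW" "degree_map C.S.U U 0 PBW" "PBW (inA \<sigma> a * x) = inA \<upsilon> a * PBW x"
  "PBW ` filt \<sigma> i = filt \<upsilon> i"
  "x \<in> sym_power \<sigma> k \<Longrightarrow> y \<in> filt \<sigma> (int k - 1) \<Longrightarrow>
    gr_class \<upsilon> k (PBW (x + y)) = gr_surjection \<sigma> \<upsilon> k x"
  using pbw by (simp_all add: pbw_isomorphism_def)

lemma inv_PBW [simp]: "inv PBW (PBW x) = x" "PBW (inv PBW u) = u"
  using pbw_facts(1) by (simp_all add: bij_is_inj bij_is_surj surj_f_inv_f)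

lemmas PBW_lin = degree_mapD(4,6,7,8)[OF pbw_facts(2)]

lemma inv_PBW_lin: "inv PBW (u + v) = inv PBW u + inv PBW v" "inv PBW (inA \<upsilon> a * u) = inA \<sigma> a * inv PBW u"
proof -
  have "inv PBW (PBW (inv PBW u) + PBW (inv PBW v)) = inv PBW u + inv PBW v"
    by (simp only: PBW_lin(1)[symmetric] inv_PBW(1))
  then show "inv PBW (u + v) = inv PBW u + inv PBW v" by simp
  have "inv PBW (inA \<upsilon> a * PBW (inv PBW u)) = inA \<sigma> a * inv PBW u"
    by (simp only: pbw_facts(3)[symmetric] inv_PBW(1))
  then show "inv PBW (inA \<upsilon> a * u) = inA \<sigma> a * inv PBW u" by simp
qed

lemma PBW_filt: "x \<in> filt \<sigma> i \<Longrightarrow> PBW x \<in> filt \<upsilon> i" and inv_PBW_filt: "u \<in> filt \<upsilon> i \<Longrightarrow> inv PBW u \<in> filt \<sigma> i"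
  using pbw_facts(4)[of i] by (blast, metis imageE inv_PBW(1))

text \<open>The symbol of a product in the enveloping algebra is the product in the symmetric algebra.\<close>

lemma PBW_prods: "prods \<upsilon> qs - PBW (prods \<sigma> qs) \<in> filt \<upsilon> (int (length qs) - 1)"
proof -
  let ?k = "length qs"
  have one: "inA \<sigma> (unt A) * prods \<sigma> qs = prods \<sigma> qs" "inA \<upsilon> (unt A) * prods \<upsilon> qs = prods \<upsilon> qs"
    by (simp_all add: C.S.inA_unt C.S.scalar_one E.inA_unt E.scalar_one)
  have "prods \<upsilon> qs \<in> gr_surjection \<sigma> \<upsilon> ?k (prods \<sigma> qs)"
    unfolding gr_surjection_def
    by (rule CollectI, rule exI[of _ "[(unt A, qs)]"]) (simp add: one gr_class_def E.filt_zero)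
  also have "\<dots> = gr_class \<upsilon> ?k (PBW (prods \<sigma> qs + 0))"
  proof -
    have "prods \<sigma> qs \<in> sym_power \<sigma> ?k" unfolding sym_power_def by (rule hull_inc) blast
    from pbw_facts(5)[OF this C.S.filt_zero] show ?thesis by simp
  qed
  finally show ?thesis by (simp add: gr_class_def)
qed

text \<open>
  The differential and the homotopy of the symmetric algebra on the enveloping algebra, and the
  difference \<open>t\<close> of the two differentials.
\<close>

definition \<delta>0 :: "'u \<Rightarrow> 'u" where "\<delta>0 = PBW \<circ> C.S.D \<circ> inv PBW"

definition t :: "'u \<Rightarrow> 'u" where "t u = \<delta>0 u - \<delta>U u"

definition h :: "'u \<Rightarrow> 'u" where "h = PBW \<circ> C.Hx \<circ> inv PBW"

lemma t_add: "t (u + v) = t u + t v"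
  by (simp add: t_def \<delta>0_def inv_PBW_lin C.S.D_add E.D_add PBW_lin algebra_simps)

text \<open>
  Both differentials have the same Leibniz rule for the action of \<open>A\<close>, and so \<open>t\<close> is \<open>A\<close>-linear up to
  sign.
\<close>

lemma t_inA: "t (inA \<upsilon> a * u) = inA \<upsilon> (tw A a) * t u"
proof -
  have "\<delta>0 (inA \<upsilon> a * u) = inA \<upsilon> (dif A a) * u + inA \<upsilon> (tw A a) * \<delta>0 u"
    by (simp add: \<delta>0_def inv_PBW_lin C.S.D_mult C.S.D_inA C.S.T_inA PBW_lin pbw_facts(3))
  then show ?thesis by (simp add: t_def E.D_mult E.D_inA E.T_inA right_diff_distrib)
qed

text \<open>
  Both differentials expand the product of \<open>qs\<close> by the Leibniz rule into products with the same
  number of factors, so that they agree up to lower order.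
\<close>

lemma t_prods: "t (prods \<upsilon> qs) \<in> filt \<upsilon> (int (length qs) - 1)"
proof -
  let ?i = "int (length qs) - 1" and ?ls = "derlist (tw \<K>) (dif \<K>) qs"
  define v where "v = prods \<upsilon> qs - PBW (prods \<sigma> qs)"
  have v: "v \<in> filt \<upsilon> ?i" unfolding v_def by (rule PBW_prods)
  have sum: "(\<Sum>l\<leftarrow>ls. prods \<upsilon> l) - PBW (\<Sum>l\<leftarrow>ls. prods \<sigma> l) \<in> filt \<upsilon> ?i"
    if "\<forall>l\<in>set ls. length l = length qs" for ls
    using that
  proof (induction ls)
    case (Cons l ls)
    have "(prods \<upsilon> l - PBW (prods \<sigma> l)) + ((\<Sum>l\<leftarrow>ls. prods \<upsilon> l) - PBW (\<Sum>l\<leftarrow>ls. prods \<sigma> l)) \<in> filt \<upsilon> ?i"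
      using PBW_prods[of l] Cons by (intro E.filt_add) auto
    then show ?case by (simp add: PBW_lin algebra_simps)
  qed (simp add: PBW_lin E.filt_zero)
  have "\<delta>U (prods \<upsilon> qs) - PBW (C.S.D (prods \<sigma> qs)) \<in> filt \<upsilon> ?i"
    unfolding E.D_prods C.S.D_prods by (rule sum) (simp add: length_derlist)
  moreover have "\<delta>0 v \<in> filt \<upsilon> ?i"
    using PBW_filt[OF C.S.D_filt[OF inv_PBW_filt[OF v]]] by (simp add: \<delta>0_def)
  moreover have "t (prods \<upsilon> qs) = \<delta>0 v - (\<delta>U (prods \<upsilon> qs) - PBW (C.S.D (prods \<sigma> qs)))"
  proof -
    have "prods \<upsilon> qs = v + PBW (prods \<sigma> qs)" by (simp add: v_def)
    then have "\<delta>0 (prods \<upsilon> qs) = \<delta>0 v + PBW (C.S.D (prods \<sigma> qs))"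
      by (metis (no_types, lifting) \<delta>0_def comp_apply inv_PBW(1) inv_PBW_lin(1) C.S.D_add PBW_lin(1))
    then show ?thesis by (simp add: t_def)
  qed
  ultimately show ?thesis by (simp add: E.filt_diff)
qed

lemma t_filt: "u \<in> filt \<upsilon> i \<Longrightarrow> t u \<in> filt \<upsilon> (i - 1)"
proof (induction rule: E.filt_induct)
  case (prods qs)
  then show ?case using t_prods[of qs] E.filt_mono[of "int (length qs) - 1" "i - 1"] by auto
next
  case zero
  then show ?case using t_add[of 0 0] by (simp add: E.filt_zero)
qed (simp_all add: t_add t_inA E.filt_add E.filt_inA)

lemma h_filt: "u \<in> filt \<upsilon> i \<Longrightarrow> h u \<in> filt \<upsilon> i"
  by (simp add: h_def PBW_filt C.Hx_filt inv_PBW_filt)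

lemma t_h_nilpotent: "locally_nilpotent (t \<circ> h)"
  unfolding locally_nilpotent_def
proof
  fix u
  obtain i where i: "u \<in> filt \<upsilon> (int i)" using E.filt_exhaustive by blast
  have "((t \<circ> h) ^^ n) u \<in> filt \<upsilon> (int i - int n)" for n
  proof (induction n)
    case (Suc n)
    from t_filt[OF h_filt[OF this]] show ?case by (simp add: algebra_simps)
  qed (simp add: i)
  from this[of "Suc i"] have "((t \<circ> h) ^^ Suc i) u = 0"
    using E.filt_negative[of "-1"] by (simp del: funpow.simps)
  then show "\<exists>n. ((t \<circ> h) ^^ n) u = 0" by blast
qed

lemma unperturbed_contraction:
  "contraction (with_dif U \<delta>0) (with_dif C.R.U C.R.D) (C.P \<circ> inv PBW) (PBW \<circ> C.J) h"
  unfolding \<delta>0_def h_def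
  by (rule contraction_transport[OF C.sym_contraction E.graded_quot pbw_facts(2,1)])

lemma perturbed_contraction:
  defines "X \<equiv> pert_series t h"
  shows "contraction (with_dif U \<delta>U)
    (with_dif C.R.U (\<lambda>y. C.R.D y - (C.P \<circ> inv PBW) (X ((PBW \<circ> C.J) y))))
    (\<lambda>u. (C.P \<circ> inv PBW) (u + X (h u))) (\<lambda>y. (PBW \<circ> C.J) y + h (X ((PBW \<circ> C.J) y)))
    (\<lambda>u. h u + h (X (h u)))"
proof -
  have \<delta>0: "degree_map U U 1 \<delta>0"
    using unperturbed_contraction by (simp add: contraction_def cochain_complex_def)
  have t: "degree_map U U 1 t"
    unfolding t_def by (intro degree_map_add(2) E.graded_quot \<delta>0 E.D_degree_map)
  have \<delta>: "\<delta>0 x - t x = \<delta>U x" for x by (simp add: t_def)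
  have sq: "\<delta>U (\<delta>U x) = 0" for x by (rule E.D_square) (simp_all add: C.dif_facts)
  have "\<delta>0 (\<delta>0 x - t x) - t (\<delta>0 x - t x) = 0" for x by (simp only: \<delta> sq)
  from perturbation_lemma[OF unperturbed_contraction t this t_h_nilpotent]
  show ?thesis unfolding X_def \<delta> .
qed

end

theorem mainTheorem2:
  fixes A :: "('k::field_char_0, 'a::ring) dg_alg"
    and \<K> :: "('k, 'a, 'q::ab_group_add) lie_rinehart"
    and M :: "('k, 'a, 'r::ab_group_add) dg_mod"
    and p\<^sub>0 :: "'q \<Rightarrow> 'r" and j\<^sub>0 :: "'r \<Rightarrow> 'q" and h\<^sub>0 :: "'q \<Rightarrow> 'q"
    and \<sigma> :: "('k, 'a \<times> 'q) free_alg \<Rightarrow> 's::ring"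
    and \<rho> :: "('k, 'a \<times> 'r) free_alg \<Rightarrow> 't::ring"
    and \<upsilon> :: "('k, 'a \<times> 'q) free_alg \<Rightarrow> 'u::ring"
    and PBW :: "'s \<Rightarrow> 'u"
  assumes "graded_comm_dga A"
    and "dg_lie_rinehart A \<K>"
    and "dg_module A M"
    and "A_linear_contraction A \<K> M p\<^sub>0 j\<^sub>0 h\<^sub>0"
    and "symmetric_algebra A \<K> \<sigma>"
    and "symmetric_algebra A M \<rho>"
    and "enveloping_algebra A \<K> \<upsilon>"
    and "pbw_isomorphism A \<K> \<sigma> \<upsilon> PBW"
  shows
    "let U = quot_space A \<K> \<upsilon>;
         SM = quot_space A M \<rho>;
         \<delta>U = ext_derivation A \<K> \<upsilon> 1 (dif A) (dif \<K>);
         \<delta>M = ext_derivation A M \<rho> 1 (dif A) (dif M);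
         \<delta>\<^sub>0 = PBW \<circ> ext_derivation A \<K> \<sigma> 1 (dif A) (dif \<K>) \<circ> inv PBW;
         p = ext_morphism \<sigma> \<rho> p\<^sub>0 \<circ> inv PBW;
         j = PBW \<circ> ext_morphism \<rho> \<sigma> j\<^sub>0;
         h = PBW \<circ> ext_homotopy A \<K> \<sigma> \<rho> p\<^sub>0 j\<^sub>0 h\<^sub>0 \<circ> inv PBW;
         t = (\<lambda>u. \<delta>\<^sub>0 u - \<delta>U u);
         X = pert_series t h;
         p\<^sub>t = (\<lambda>u. p (u + X (h u)));
         j\<^sub>t = (\<lambda>y. j y + h (X (j y)));
         h\<^sub>t = (\<lambda>u. h u + h (X (h u)));
         \<delta>\<^sub>t = (\<lambda>y. \<delta>M y - p (X (j y)))
     in ((\<forall>i. t ` filt \<upsilon> i \<subseteq> filt \<upsilon> (i - 1)) \<and>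
         locally_nilpotent (t \<circ> h) \<and>
         contraction (with_dif U \<delta>U) (with_dif SM \<delta>\<^sub>t) p\<^sub>t j\<^sub>t h\<^sub>t) \<and>
        (\<exists>\<alpha> \<beta> \<gamma>.
           transfer_ops SM U p\<^sub>t j\<^sub>t h\<^sub>t \<delta>\<^sub>t \<alpha> \<beta> \<gamma> \<and>
           A_infinity_algebra SM \<alpha> \<and>
           (\<forall>\<alpha>' \<beta>' \<gamma>'. transfer_ops SM U p\<^sub>t j\<^sub>t h\<^sub>t \<delta>\<^sub>t \<alpha>' \<beta>' \<gamma>' \<longrightarrow>
              (\<forall>xs. xs \<noteq> [] \<longrightarrow> \<alpha>' xs = \<alpha> xs)))"
proof -
  interpret pbw_contraction A \<K> M p\<^sub>0 j\<^sub>0 h\<^sub>0 \<sigma> \<rho> \<upsilon> PBW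
    using assms by unfold_locales
  have t: "(\<lambda>u. (PBW \<circ> ext_derivation A \<K> \<sigma> 1 (dif A) (dif \<K>) \<circ> inv PBW) u -
      ext_derivation A \<K> \<upsilon> 1 (dif A) (dif \<K>) u) = t"
    by (simp add: t_def \<delta>0_def fun_eq_iff)
  have h: "PBW \<circ> ext_homotopy A \<K> \<sigma> \<rho> p\<^sub>0 j\<^sub>0 h\<^sub>0 \<circ> inv PBW = h"
    by (simp only: h_def C.ext_homotopy_eq)
  have filt: "\<forall>i. t ` filt \<upsilon> i \<subseteq> filt \<upsilon> (i - 1)" using t_filt by blast
  note transfer = transfer_theorem[OF perturbed_contraction E.mult_bilinear E.D_derivation]
  show ?thesis
    unfolding Let_def t h by (intro conjI filt t_h_nilpotent perturbed_contraction transfer)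
qed


end
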